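(* Let $\mu\in H^3((0,1);\mathbb{R})$ be such that there exists $c>0$ with $|\langle \mu\varphi_1,\varphi_k\rangle|\ge c/k^3$ for all $k\in\mathbb{N}^*$. Then, for every $\lambda>0$, there exist $C>0$ and a real-valued feedback law $v(t)=K(\Psi(t,\cdot))$ such that, for every $\Psi_0\in H^3_{(0)}((0,1);\mathbb{C})$, the associated solution $\Psi$ of the closed-loop system $$\begin{cases} i\partial_t\Psi=-\Delta\Psi-v(t)\mu(x)\varphi_1(x), & t>0,\ x\in(0,1),\\ \Psi(t,0)=\Psi(t,1)=0, & t>0,\\ \Psi(0,x)=\Psi_0(x), & x\in(0,1),\end{cases}$$ satisfies $$\|\Psi(t,\cdot)\|_{H^3_{(0)}}\le C e^{-\lambda t}\|\Psi_0\|_{H^3_{(0)}},\qquad t\ge0.$$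
   Context: $\mathbb{N}^*=\{1,2,3,\dots\}$. $\langle\cdot,\cdot\rangle$ is the $L^2((0,1);\mathbb{C})$ inner product. For $k\in\mathbb{N}^*$, $\lambda_k=(k\pi)^2$ and $\varphi_k(x)=\sqrt2\sin(k\pi x)$ are the eigenvalues and eigenfunctions of $\mathcal{A}=-\Delta$ with domain $H^2\cap H^1_0((0,1);\mathbb{C})$. For $s\ge0$, $H^s_{(0)}=H^s_{(0)}((0,1);\mathbb{C})=D(\mathcal{A}^{s/2})$ with norm $\|\phi\|_{H^s_{(0)}}^2=\sum_{k\ge1}\lambda_k^s|\langle\phi,\varphi_k\rangle|^2$. In particular $H^3_{(0)}=\{\phi\in H^3\cap H^1_0:\phi''(0)=\phi''(1)=0\}$ and $H^5_{(0)}=\{\phi\in H^5\cap H^3_{(0)}:\phi^{(4)}(0)=\phi^{(4)}(1)=0\}$. Feedback laws and closed-loop solutions. The feedback need not be bounded on $H^3_{(0)}$: it is a real-linear, real-valued functional $K$ defined on $\{\phi\in H^3_{(0)}:\Im\phi\in H^4_{(0)}\}$. The closed-loop equation is formally $\partial_t\Psi=i\Delta\Psi+iK(\Psi)\mu\varphi_1$. The closed-loop solution associated with $\Psi_0$ is $\Psi(t)=S(t)\Psi_0$, where $(S(t))_{t\ge0}$ is the $C^0$-semigroup on $H^3_{(0)}$ (viewed as a real Hilbert space) generated by $\phi\mapsto i\Delta\phi+iK(\phi)\mu\varphi_1$ on the domain of those $\phi$ with $\Re\phi\in H^5\cap H^3_{(0)}$, $\Im\phi\in H^5_{(0)}$ and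 $\Delta(\Re\phi)+K(\phi)\mu\varphi_1\in H^3_{(0)}$. Being a feedback law includes that this operator generates such a semigroup. *)

theory Defs
  imports "HOL-Analysis.Analysis"
begin

text \<open>
  Elements of function spaces over \<open>(0,1)\<close> are functions \<^typ>\<open>real \<Rightarrow> complex\<close>, of which only the
  values on \<open>(0,1)\<close> matter, up to null sets; equality in these spaces is \<open>ae_eq\<close>.
\<close>

abbreviation leb01 :: "real measure"
  where "leb01 \<equiv> lebesgue_on {0<..<1}"

definition ae_eq :: "(real \<Rightarrow> complex) \<Rightarrow> (real \<Rightarrow> complex) \<Rightarrow> bool"
  where "ae_eq f g \<longleftrightarrow> (AE x in leb01. f x = g x)"

definition L2 :: "(real \<Rightarrow> complex) set"
  where "L2 = {f \<in> borel_measurable leb01. integrable leb01 (\<lambda>x. (cmod (f x))\<^sup>2)}"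

definition inner_L2 :: "(real \<Rightarrow> complex) \<Rightarrow> (real \<Rightarrow> complex) \<Rightarrow> complex"
  where "inner_L2 f g = (LINT x|leb01. f x * cnj (g x))"

definition re_part :: "(real \<Rightarrow> complex) \<Rightarrow> real \<Rightarrow> complex"
  where "re_part f = (\<lambda>x. complex_of_real (Re (f x)))"

definition im_part :: "(real \<Rightarrow> complex) \<Rightarrow> real \<Rightarrow> complex"
  where "im_part f = (\<lambda>x. complex_of_real (Im (f x)))"


subsection \<open>Sobolev spaces on \<open>(0,1)\<close>\<close>

text \<open>
  \<open>C\<^sub>c\<^sup>\<infinity>(0,1)\<close>. Real-valued test functions suffice for complex-valued distributions, by linearity.
\<close>

definition test_functions :: "(real \<Rightarrow> real) set"
  where "test_functions =
    {\<eta>. (\<forall>n x. (deriv ^^ n) \<eta> differentiable at x) \<and>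
        (\<exists>a b. 0 < a \<and> b < 1 \<and> (\<forall>x. x \<notin> {a..b} \<longrightarrow> \<eta> x = 0))}"

definition weak_deriv :: "nat \<Rightarrow> (real \<Rightarrow> complex) \<Rightarrow> (real \<Rightarrow> complex) \<Rightarrow> bool"
  where "weak_deriv j f g \<longleftrightarrow>
    (\<forall>\<eta>\<in>test_functions.
      (LINT x|leb01. (deriv ^^ j) \<eta> x *\<^sub>R f x) = (- 1) ^ j * (LINT x|leb01. \<eta> x *\<^sub>R g x))"

definition sobolev :: "nat \<Rightarrow> (real \<Rightarrow> complex) set"
  where "sobolev m = {f \<in> L2. \<forall>j\<le>m. \<exists>g\<in>L2. weak_deriv j f g}"

text \<open>Unique up to \<open>ae_eq\<close> where it exists, in particular on \<open>sobolev 2\<close>.\<close>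

definition laplacian :: "(real \<Rightarrow> complex) \<Rightarrow> real \<Rightarrow> complex"
  where "laplacian f = (SOME g. g \<in> L2 \<and> weak_deriv 2 f g)"


subsection \<open>The Dirichlet Laplacian and its scale of spaces\<close>

definition eigval :: "nat \<Rightarrow> real"
  where "eigval k = (real k * pi)\<^sup>2"

definition eigfun :: "nat \<Rightarrow> real \<Rightarrow> complex"
  where "eigfun k = (\<lambda>x. complex_of_real (sqrt 2 * sin (real k * pi * x)))"

text \<open>
  \<open>Hz s\<close> is \<open>H\<^sup>s\<^sub>(\<^sub>0\<^sub>) = D(A\<^bsup>s/2\<^esup>)\<close>, the power of \<open>A = -\<Delta>\<close> (domain \<open>H\<^sup>2 \<inter> H\<^sup>1\<^sub>0\<close>) being the one given by
  functional calculus in the orthonormal basis of eigenfunctions \<open>eigfun k\<close>, \<open>k \<ge> 1\<close>.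
\<close>

definition Hz :: "real \<Rightarrow> (real \<Rightarrow> complex) set"
  where "Hz s =
    {f \<in> L2. (\<lambda>k. eigval k powr s * (cmod (inner_L2 f (eigfun k)))\<^sup>2) summable_on {1..}}"

definition norm_Hz :: "real \<Rightarrow> (real \<Rightarrow> complex) \<Rightarrow> real"
  where "norm_Hz s f =
    sqrt (\<Sum>\<^sub>\<infinity>k\<in>{1..}. eigval k powr s * (cmod (inner_L2 f (eigfun k)))\<^sup>2)"


subsection \<open>Strongly continuous semigroups\<close>

text \<open>
  \<open>X\<close> is a real vector space of functions, \<open>N\<close> a norm on its quotient by \<open>ae_eq\<close>. Operators act on
  representatives, so compatibility with \<open>ae_eq\<close> is part of the definition.
\<close>

definition bounded_operator_on ::
    "(real \<Rightarrow> complex) set \<Rightarrow> ((real \<Rightarrow> complex) \<Rightarrow> real) \<Rightarrow>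
     ((real \<Rightarrow> complex) \<Rightarrow> real \<Rightarrow> complex) \<Rightarrow> bool"
  where "bounded_operator_on X N T \<longleftrightarrow>
    (\<forall>f\<in>X. T f \<in> X) \<and>
    (\<forall>f\<in>X. \<forall>g\<in>X. ae_eq f g \<longrightarrow> ae_eq (T f) (T g)) \<and>
    (\<forall>f\<in>X. \<forall>g\<in>X. \<forall>a b :: real.
      ae_eq (T (\<lambda>x. a *\<^sub>R f x + b *\<^sub>R g x)) (\<lambda>x. a *\<^sub>R T f x + b *\<^sub>R T g x)) \<and>
    (\<exists>M. \<forall>f\<in>X. N (T f) \<le> M * N f)"

definition C0_semigroup_on ::
    "(real \<Rightarrow> complex) set \<Rightarrow> ((real \<Rightarrow> complex) \<Rightarrow> real) \<Rightarrow>
     (real \<Rightarrow> (real \<Rightarrow> complex) \<Rightarrow> real \<Rightarrow> complex) \<Rightarrow> bool"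
  where "C0_semigroup_on X N S \<longleftrightarrow>
    (\<forall>t\<ge>0. bounded_operator_on X N (S t)) \<and>
    (\<forall>f\<in>X. ae_eq (S 0 f) f) \<and>
    (\<forall>f\<in>X. \<forall>s\<ge>0. \<forall>t\<ge>0. ae_eq (S (s + t) f) (S s (S t f))) \<and>
    (\<forall>f\<in>X. \<forall>t\<ge>0. ((\<lambda>s. N (\<lambda>x. S s f x - S t f x)) \<longlongrightarrow> 0) (at t within {0..}))"

text \<open>\<open>generator_on X N S f g\<close>: \<open>f\<close> is in the domain of the generator of \<open>S\<close>, which maps it to \<open>g\<close>.\<close>

definition generator_on ::
    "(real \<Rightarrow> complex) set \<Rightarrow> ((real \<Rightarrow> complex) \<Rightarrow> real) \<Rightarrow>
     (real \<Rightarrow> (real \<Rightarrow> complex) \<Rightarrow> real \<Rightarrow> complex) \<Rightarrow>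
     (real \<Rightarrow> complex) \<Rightarrow> (real \<Rightarrow> complex) \<Rightarrow> bool"
  where "generator_on X N S f g \<longleftrightarrow> f \<in> X \<and> g \<in> X \<and>
    ((\<lambda>h. N (\<lambda>x. (S h f x - f x) /\<^sub>R h - g x)) \<longlongrightarrow> 0) (at_right 0)"


subsection \<open>Feedback laws and closed-loop solutions\<close>

definition feedback_dom :: "(real \<Rightarrow> complex) set"
  where "feedback_dom = {f \<in> Hz 3. im_part f \<in> Hz 4}"

definition control_profile :: "(real \<Rightarrow> real) \<Rightarrow> real \<Rightarrow> complex"
  where "control_profile \<mu> = (\<lambda>x. complex_of_real (\<mu> x) * eigfun 1 x)"

definition closed_loop_dom ::
    "(real \<Rightarrow> real) \<Rightarrow> ((real \<Rightarrow> complex) \<Rightarrow> real) \<Rightarrow> (real \<Rightarrow> complex) set"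
  where "closed_loop_dom \<mu> K =
    {f. re_part f \<in> sobolev 5 \<inter> Hz 3 \<and> im_part f \<in> Hz 5 \<and>
        (\<lambda>x. laplacian (re_part f) x + K f *\<^sub>R control_profile \<mu> x) \<in> Hz 3}"

definition closed_loop_op ::
    "(real \<Rightarrow> real) \<Rightarrow> ((real \<Rightarrow> complex) \<Rightarrow> real) \<Rightarrow> (real \<Rightarrow> complex) \<Rightarrow> real \<Rightarrow> complex"
  where "closed_loop_op \<mu> K f =
    (\<lambda>x. \<i> * laplacian f x + \<i> * complex_of_real (K f) * control_profile \<mu> x)"

definition closed_loop_semigroup ::
    "(real \<Rightarrow> real) \<Rightarrow> ((real \<Rightarrow> complex) \<Rightarrow> real) \<Rightarrow>
     (real \<Rightarrow> (real \<Rightarrow> complex) \<Rightarrow> real \<Rightarrow> complex) \<Rightarrow> bool"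
  where "closed_loop_semigroup \<mu> K S \<longleftrightarrow>
    C0_semigroup_on (Hz 3) (norm_Hz 3) S \<and>
    (\<forall>f g. generator_on (Hz 3) (norm_Hz 3) S f g \<longleftrightarrow>
      f \<in> closed_loop_dom \<mu> K \<and> g \<in> Hz 3 \<and> ae_eq g (closed_loop_op \<mu> K f))"

text \<open>
  The value of \<open>K\<close> outside \<open>feedback_dom\<close> is irrelevant: \<open>closed_loop_dom \<mu> K \<subseteq> feedback_dom\<close>.
\<close>

definition feedback_law :: "(real \<Rightarrow> real) \<Rightarrow> ((real \<Rightarrow> complex) \<Rightarrow> real) \<Rightarrow> bool"
  where "feedback_law \<mu> K \<longleftrightarrow>
    (\<forall>f\<in>feedback_dom. \<forall>g\<in>feedback_dom. ae_eq f g \<longrightarrow> K f = K g) \<and>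
    (\<forall>f\<in>feedback_dom. \<forall>g\<in>feedback_dom. \<forall>a b :: real.
      K (\<lambda>x. a *\<^sub>R f x + b *\<^sub>R g x) = a * K f + b * K g) \<and>
    (\<exists>S. closed_loop_semigroup \<mu> K S)"

definition closed_loop_solution ::
    "(real \<Rightarrow> real) \<Rightarrow> ((real \<Rightarrow> complex) \<Rightarrow> real) \<Rightarrow> (real \<Rightarrow> complex) \<Rightarrow>
     (real \<Rightarrow> real \<Rightarrow> complex) \<Rightarrow> bool"
  where "closed_loop_solution \<mu> K \<Psi>0 \<Psi> \<longleftrightarrow>
    (\<exists>S. closed_loop_semigroup \<mu> K S \<and> (\<forall>t\<ge>0. ae_eq (\<Psi> t) (S t \<Psi>0)))"

end

theory Submission
  imports Defs
begin

text \<open>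
  Rapid stabilization by a weighted Gramian, the method of Komornik and Urquiza. The weighted sine
  coefficients \<open>w\<^sub>n = (k \<pi>)\<^sup>3 \<langle>\<Psi>, \<phi>\<^sub>k\<rangle>\<close>, \<open>k = n + 1\<close>, identify \<open>Hz 3\<close> with the sequence space \<open>ell2\<close> and
  turn the equation into a family of oscillators with one common real control,
  \<open>w\<^sub>n' = - \<i> \<lambda>\<^sub>n w\<^sub>n + \<i> \<beta>\<^sub>n v\<close>, or \<open>w' = A w + B v\<close>. The real numbers \<open>\<beta>\<^sub>n\<close> are bounded below by the hypothesis on
  \<open>\<mu>\<close>, and they are bounded above since \<open>\<mu>\<close> has three derivatives
  (\<open>control_profile_coeff_bound\<close>).

  Let \<open>\<Lambda> = \<integral>\<^sub>0\<^sup>\<infinity> exp (- \<omega> t) exp (- t A) B B\<^sup>* exp (t A) dt\<close>. As \<open>A\<close> is skew-adjoint, \<open>\<Lambda>\<close> solves the Lyapunov equation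
  \<open>A \<Lambda> - B B\<^sup>* = \<Lambda> (A - \<omega>)\<close> (\<open>gram_commutator\<close>). Hence the feedback \<open>v = - B\<^sup>* \<Lambda>\<inverse> w\<close> makes the closed-loop
  operator equal to \<open>\<Lambda> (A - \<omega>) \<Lambda>\<inverse>\<close>, and the closed-loop semigroup is
  \<open>exp (- \<omega> t) \<Lambda> exp (t A) \<Lambda>\<inverse>\<close>. It decays with rate \<open>\<omega>\<close> as soon as \<open>\<Lambda>\<close> is bounded and boundedly invertible. The
  matrix of \<open>\<Lambda>\<close> has entries of size \<open>1 / (\<lambda>\<^sub>k - \<lambda>\<^sub>j)\<close> off the diagonal, and as the gaps of the
  frequencies grow, Schur's test shows that \<open>\<Lambda>\<close> is bounded. An inequality of Ingham type for
  trigonometric sums shows that it is coercive (\<open>gram_form_coercive\<close>, \<open>gram_coercive\<close>), and the theorem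
  of Lax and Milgram gives the inverse.

  Two points need care as \<open>B\<close> is unbounded. First, \<open>B\<^sup>* \<Lambda>\<inverse>\<close> is given by a convergent series only on the domain
  \<open>D\<close> of the generator, whereas the closed-loop domain consists of all states for which the closed-loop
  expression is in \<open>ell2\<close>. These form \<open>D\<close> again if the functional is extended linearly from \<open>D\<close> such that it
  vanishes at \<open>\<beta> / \<lambda>\<close>, the state that a constant control keeps at rest (\<open>exists_feedback\<close>). Second, the
  bound is claimed for every semigroup with the given generator; there is only one
  (\<open>closed_loop_unique\<close>).

  It remains to translate. The sine system is complete (\<open>sine_complete\<close>), square-summable coefficients
  belong to functions (\<open>riesz_fischer\<close>), weak derivatives of sine series are taken termwise and are unique
  (\<open>sine_series_weak_deriv\<close>, \<open>fundamental_lemma_calculus_of_variations\<close>). Thus the Sobolev and boundary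
  conditions in the closed-loop domain become conditions on coefficients (\<open>closed_loop_iff\<close>).
\<close>

section \<open>The real Hilbert space of square-summable complex sequences\<close>

text \<open>
  The sequences are complex, but the Hilbert space is real: the controls and the feedback are real,
  so the closed-loop operators are only real-linear.
\<close>

typedef ell2 = "{x :: nat \<Rightarrow> complex. summable (\<lambda>n. (cmod (x n))\<^sup>2)}"
  morphisms coord mk_ell2
  by (rule exI[of _ "\<lambda>n. 0"]) simp

setup_lifting type_definition_ell2

lemma summable_coord: "summable (\<lambda>n. (cmod (coord x n))\<^sup>2)"
  using coord[of x] by simp

lemma coord_mk_ell2: "summable (\<lambda>n. (cmod (x n))\<^sup>2) \<Longrightarrow> coord (mk_ell2 x) = x"
  by (simp add: mk_ell2_inverse)

lemma ell2_eqI: "(\<And>n. coord x n = coord y n) \<Longrightarrow> x = y"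
  by (metis coord_inject ext)

lemma square_summable_add:
  fixes x y :: "nat \<Rightarrow> complex"
  assumes "summable (\<lambda>n. (cmod (x n))\<^sup>2)" "summable (\<lambda>n. (cmod (y n))\<^sup>2)"
  shows "summable (\<lambda>n. (cmod (x n + y n))\<^sup>2)"
proof (rule summable_comparison_test')
  show "summable (\<lambda>n. 2 * (cmod (x n))\<^sup>2 + 2 * (cmod (y n))\<^sup>2)"
    using assms by (intro summable_add summable_mult)
  show "norm ((cmod (x n + y n))\<^sup>2) \<le> 2 * (cmod (x n))\<^sup>2 + 2 * (cmod (y n))\<^sup>2" for n
  proof -
    have "(cmod (x n + y n))\<^sup>2 \<le> (cmod (x n) + cmod (y n))\<^sup>2"
      by (simp add: norm_triangle_ineq power_mono)
    also have "\<dots> \<le> 2 * (cmod (x n))\<^sup>2 + 2 * (cmod (y n))\<^sup>2"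
      using sum_squares_bound[of "cmod (x n)" "cmod (y n)"] by (simp add: power2_sum)
    finally show ?thesis by simp
  qed
qed

lemma square_summable_comparison:
  fixes x y :: "nat \<Rightarrow> complex"
  assumes "summable (\<lambda>n. (cmod (x n))\<^sup>2)" "\<And>n. cmod (y n) \<le> M * cmod (x n)"
  shows "summable (\<lambda>n. (cmod (y n))\<^sup>2)"
proof (rule summable_comparison_test')
  show "summable (\<lambda>n. M\<^sup>2 * (cmod (x n))\<^sup>2)"
    using assms(1) by (intro summable_mult)
  show "norm ((cmod (y n))\<^sup>2) \<le> M\<^sup>2 * (cmod (x n))\<^sup>2" for n
    using power_mono[OF assms(2)[of n], of 2] by (simp add: power_mult_distrib)
qed

lemma summable_inner_coord: "summable (\<lambda>n. coord x n \<bullet> coord y n)"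
proof (rule summable_comparison_test')
  show "summable (\<lambda>n. (cmod (coord x n))\<^sup>2 + (cmod (coord y n))\<^sup>2)"
    by (intro summable_add summable_coord)
  show "norm (coord x n \<bullet> coord y n) \<le> (cmod (coord x n))\<^sup>2 + (cmod (coord y n))\<^sup>2" for n
    using Cauchy_Schwarz_ineq2[of "coord x n" "coord y n"]
      sum_squares_bound[of "cmod (coord x n)" "cmod (coord y n)"]
      zero_le_mult_iff[of "cmod (coord x n)" "cmod (coord y n)"] by (simp)
qed

instantiation ell2 :: real_inner
begin

lift_definition zero_ell2 :: ell2 is "\<lambda>n. 0" by simp

lift_definition plus_ell2 :: "ell2 \<Rightarrow> ell2 \<Rightarrow> ell2" is "\<lambda>x y n. x n + y n"
  by (rule square_summable_add)

lift_definition uminus_ell2 :: "ell2 \<Rightarrow> ell2" is "\<lambda>x n. - x n" by simp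

lift_definition minus_ell2 :: "ell2 \<Rightarrow> ell2 \<Rightarrow> ell2" is "\<lambda>x y n. x n - y n"
  using square_summable_add[of _ "\<lambda>n. - _ n"] by simp

lift_definition scaleR_ell2 :: "real \<Rightarrow> ell2 \<Rightarrow> ell2" is "\<lambda>c x n. c *\<^sub>R x n"
  subgoal for c x by (rule square_summable_comparison[of x _ "\<bar>c\<bar>"]) auto
  done

definition inner_ell2 :: "ell2 \<Rightarrow> ell2 \<Rightarrow> real"
  where "inner_ell2 x y = (\<Sum>n. coord x n \<bullet> coord y n)"

definition norm_ell2 :: "ell2 \<Rightarrow> real"
  where "norm_ell2 x = sqrt (x \<bullet> x)"

definition sgn_ell2 :: "ell2 \<Rightarrow> ell2"
  where "sgn_ell2 x = scaleR (inverse (norm x)) x"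

definition dist_ell2 :: "ell2 \<Rightarrow> ell2 \<Rightarrow> real"
  where "dist_ell2 x y = norm (x - y)"

definition uniformity_ell2 :: "(ell2 \<times> ell2) filter"
  where "uniformity_ell2 = (INF e\<in>{0 <..}. principal {(x, y). dist x y < e})"

definition open_ell2 :: "ell2 set \<Rightarrow> bool"
  where "open_ell2 U \<longleftrightarrow> (\<forall>x\<in>U. eventually (\<lambda>(x', y). x' = x \<longrightarrow> y \<in> U) uniformity)"

instance
proof
  fix x y z :: ell2 and r s :: real and U :: "ell2 set"
  show "dist x y = norm (x - y)" by (simp add: dist_ell2_def)
  show "x + y + z = x + (y + z)" "x + y = y + x" "0 + x = x" "- x + x = 0" "x - y = x + - y"
    "r *\<^sub>R (x + y) = r *\<^sub>R x + r *\<^sub>R y" "(r + s) *\<^sub>R x = r *\<^sub>R x + s *\<^sub>R x"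
    "r *\<^sub>R s *\<^sub>R x = (r * s) *\<^sub>R x" "1 *\<^sub>R x = x"
    by (rule ell2_eqI; simp add: zero_ell2.rep_eq plus_ell2.rep_eq uminus_ell2.rep_eq
        minus_ell2.rep_eq scaleR_ell2.rep_eq scaleR_right_distrib scaleR_left_distrib)+
  show "sgn x = inverse (norm x) *\<^sub>R x" by (simp add: sgn_ell2_def)
  show "(uniformity :: (ell2 \<times> ell2) filter) = (INF e\<in>{0 <..}. principal {(x, y). dist x y < (e::real)})"
    by (rule uniformity_ell2_def) 
  show "open U \<longleftrightarrow> (\<forall>x\<in>U. eventually (\<lambda>(x', y). x' = x \<longrightarrow> y \<in> U) uniformity)" for U :: "ell2 set"
    by (rule open_ell2_def)
  show "x \<bullet> y = y \<bullet> x" by (simp add: inner_ell2_def inner_commute)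
  show "(x + y) \<bullet> z = x \<bullet> z + y \<bullet> z"
    unfolding inner_ell2_def
    by (simp add: plus_ell2.rep_eq inner_add_left suminf_add summable_inner_coord)
  show "r *\<^sub>R x \<bullet> y = r * (x \<bullet> y)"
    unfolding inner_ell2_def
    by (simp add: scaleR_ell2.rep_eq suminf_mult summable_inner_coord)
  show "0 \<le> x \<bullet> x"
    unfolding inner_ell2_def by (intro suminf_nonneg summable_inner_coord) simp
  show "x \<bullet> x = 0 \<longleftrightarrow> x = 0"
  proof
    assume "x \<bullet> x = 0"
    then have "\<forall>n. coord x n \<bullet> coord x n = 0"
      unfolding inner_ell2_def by (subst (asm) suminf_eq_zero_iff) (auto intro: summable_inner_coord)
    then show "x = 0" by (intro ell2_eqI) (simp add: zero_ell2.rep_eq)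
  qed (simp add: inner_ell2_def zero_ell2.rep_eq)
  show "norm x = sqrt (x \<bullet> x)" by (rule norm_ell2_def)
qed

end

lemmas coord_simps [simp] =
  zero_ell2.rep_eq plus_ell2.rep_eq uminus_ell2.rep_eq minus_ell2.rep_eq scaleR_ell2.rep_eq

lemma norm_ell2_sq: "(norm x)\<^sup>2 = (\<Sum>n. (cmod (coord x n))\<^sup>2)"
  by (simp add: norm_ell2_def inner_ell2_def dot_square_norm
      suminf_nonneg[OF summable_coord])

lemma norm_ell2_sums: "(\<lambda>n. (cmod (coord x n))\<^sup>2) sums (norm x)\<^sup>2"
  unfolding norm_ell2_sq by (rule summable_sums[OF summable_coord])

lemma sum_coord_le: "(\<Sum>n<N. (cmod (coord x n))\<^sup>2) \<le> (norm x)\<^sup>2"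
  unfolding norm_ell2_sq by (rule sum_le_suminf[OF summable_coord]) auto

lemma norm_coord_le: "cmod (coord x n) \<le> norm x"
proof -
  have "(cmod (coord x n))\<^sup>2 \<le> (\<Sum>k<Suc n. (cmod (coord x k))\<^sup>2)"
    by (simp add: sum_nonneg)
  also have "\<dots> \<le> (norm x)\<^sup>2" by (rule sum_coord_le)
  finally show ?thesis by (rule power2_le_imp_le) simp
qed

text \<open>
  Membership and norm bounds are read off from uniform bounds on finite sections. All operators
  below are defined coordinatewise and are estimated in this way.
\<close>

lemma mk_ell2_bound:
  assumes "\<And>N. (\<Sum>n<N. (cmod (x n))\<^sup>2) \<le> M\<^sup>2" "M \<ge> 0"
  shows "summable (\<lambda>n. (cmod (x n))\<^sup>2)" and "norm (mk_ell2 x) \<le> M"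
proof -
  show s: "summable (\<lambda>n. (cmod (x n))\<^sup>2)"
    by (rule bounded_imp_summable[of _ "M\<^sup>2"]) (use assms(1)[of "Suc _"] in \<open>auto simp: lessThan_Suc_atMost\<close>)
  have "(norm (mk_ell2 x))\<^sup>2 \<le> M\<^sup>2"
    unfolding norm_ell2_sq coord_mk_ell2[OF s] by (intro suminf_le_const s assms)
  then show "norm (mk_ell2 x) \<le> M" using assms(2) by (rule power2_le_imp_le)
qed

lemma norm_ell2_leI:
  assumes "\<And>N. (\<Sum>n<N. (cmod (coord x n))\<^sup>2) \<le> M\<^sup>2" "M \<ge> 0"
  shows "norm x \<le> M"
  using mk_ell2_bound(2)[of "coord x", OF assms] by (simp add: coord_inverse)

lemma bounded_linear_coord: "bounded_linear (\<lambda>x. coord x n)"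
  by (rule bounded_linear_intro[where K = 1]) (simp_all add: norm_coord_le)

lemmas tendsto_coord = bounded_linear.tendsto[OF bounded_linear_coord]

instance ell2 :: complete_space
proof
  fix X :: "nat \<Rightarrow> ell2"
  assume C: "Cauchy X"
  have "Cauchy (\<lambda>i. coord (X i) n)" for n
    by (rule bounded_linear.Cauchy[OF bounded_linear_coord C])
  then have "\<forall>n. \<exists>l. (\<lambda>i. coord (X i) n) \<longlonglongrightarrow> l"
    by (simp add: Cauchy_convergent_iff convergent_def)
  then obtain l where l: "\<And>n. (\<lambda>i. coord (X i) n) \<longlonglongrightarrow> l n"
    by metis
  \<comment> \<open>the tail estimate passes to the coordinatewise limit, one finite section at a time\<close>
  have est: "(\<Sum>n<N. (cmod (coord (X i) n - l n))\<^sup>2) \<le> e\<^sup>2"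
    if "e > 0" and e: "\<And>i j. i \<ge> m \<Longrightarrow> j \<ge> m \<Longrightarrow> norm (X i - X j) < e" and "i \<ge> m" for e m i N
  proof (rule LIMSEQ_le_const2)
    show "(\<lambda>j. \<Sum>n<N. (cmod (coord (X i) n - coord (X j) n))\<^sup>2)
        \<longlonglongrightarrow> (\<Sum>n<N. (cmod (coord (X i) n - l n))\<^sup>2)"
      by (intro tendsto_intros l)
    have "(\<Sum>n<N. (cmod (coord (X i) n - coord (X j) n))\<^sup>2) \<le> e\<^sup>2" if "j \<ge> m" for j
    proof -
      have "(\<Sum>n<N. (cmod (coord (X i - X j) n))\<^sup>2) \<le> (norm (X i - X j))\<^sup>2"
        by (rule sum_coord_le)
      also have "\<dots> \<le> e\<^sup>2" using e[OF \<open>i \<ge> m\<close> that] by (intro power_mono) auto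
      finally show ?thesis by simp
    qed
    then show "\<exists>k. \<forall>j\<ge>k. (\<Sum>n<N. (cmod (coord (X i) n - coord (X j) n))\<^sup>2) \<le> e\<^sup>2" by blast
  qed
  have tail: "\<exists>m. \<forall>i\<ge>m. \<forall>j\<ge>m. norm (X i - X j) < e" if "e > 0" for e
    using CauchyD[OF C that] by blast
  obtain m where m: "\<forall>i\<ge>m. \<forall>j\<ge>m. norm (X i - X j) < 1" using tail[of 1] by auto
  have "summable (\<lambda>n. (cmod (coord (X m) n - l n))\<^sup>2)"
    by (rule mk_ell2_bound(1)[of _ 1]) (use est[of 1 m m] m in auto)
  then have "summable (\<lambda>n. (cmod (l n - coord (X m) n))\<^sup>2)"
    by (simp add: norm_minus_commute)
  from square_summable_add[OF this summable_coord[of "X m"]]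
  have sl: "summable (\<lambda>n. (cmod (l n))\<^sup>2)" by simp
  define L where "L = mk_ell2 l"
  have cL: "coord L = l" unfolding L_def by (rule coord_mk_ell2[OF sl])
  have "X \<longlonglongrightarrow> L"
  proof (rule LIMSEQ_I)
    fix r :: real assume "r > 0"
    then obtain m where m: "\<forall>i\<ge>m. \<forall>j\<ge>m. norm (X i - X j) < r/2" using tail[of "r/2"] by auto
    have "norm (X i - L) \<le> r/2" if "i \<ge> m" for i
      by (rule norm_ell2_leI) (use est[of "r/2" m i] m that \<open>r > 0\<close> cL in auto)
    then show "\<exists>m. \<forall>i\<ge>m. norm (X i - L) < r" using \<open>r > 0\<close> by (intro exI[of _ m]) force
  qed
  then show "convergent X" by (rule convergentI)
qed

section \<open>Truncations and diagonal operators\<close>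

definition trunc :: "nat \<Rightarrow> ell2 \<Rightarrow> ell2"
  where "trunc N w = mk_ell2 (\<lambda>n. if n < N then coord w n else 0)"

lemma coord_trunc [simp]: "coord (trunc N w) n = (if n < N then coord w n else 0)"
proof -
  have "summable (\<lambda>n. (cmod (if n < N then coord w n else 0))\<^sup>2)"
    by (rule square_summable_comparison[OF summable_coord[of w], where M = 1]) auto
  then show ?thesis by (simp add: trunc_def coord_mk_ell2)
qed

lemma norm_sub_trunc_sq: "(norm (w - trunc N w))\<^sup>2 = (norm w)\<^sup>2 - (\<Sum>n<N. (cmod (coord w n))\<^sup>2)"
proof -
  have "(\<lambda>n. (cmod (coord w n))\<^sup>2 - (if n \<in> {..<N} then (cmod (coord w n))\<^sup>2 else 0)) sums
      ((norm w)\<^sup>2 - (\<Sum>n<N. (cmod (coord w n))\<^sup>2))"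
    by (intro sums_diff norm_ell2_sums sums_If_finite_set) simp
  moreover have "(\<lambda>n. (cmod (coord w n))\<^sup>2 - (if n \<in> {..<N} then (cmod (coord w n))\<^sup>2 else 0))
      = (\<lambda>n. (cmod (coord (w - trunc N w) n))\<^sup>2)"
    by (auto simp: fun_eq_iff)
  ultimately show ?thesis using norm_ell2_sums[of "w - trunc N w"] sums_unique2 by metis
qed

lemma trunc_tendsto: "(\<lambda>N. trunc N w) \<longlonglongrightarrow> w"
proof -
  have "(\<lambda>N. (norm w)\<^sup>2 - (\<Sum>n<N. (cmod (coord w n))\<^sup>2)) \<longlonglongrightarrow> (norm w)\<^sup>2 - (norm w)\<^sup>2"
    by (intro tendsto_diff tendsto_const) (use norm_ell2_sums[of w] in \<open>simp add: sums_def\<close>)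
  then have "(\<lambda>N. (norm (w - trunc N w))\<^sup>2) \<longlonglongrightarrow> 0"
    by (simp add: norm_sub_trunc_sq)
  from tendsto_real_sqrt[OF this] have "(\<lambda>N. norm (w - trunc N w)) \<longlonglongrightarrow> 0" by simp
  then have "(\<lambda>N. dist (trunc N w) w) \<longlonglongrightarrow> 0"
    by (simp only: dist_norm norm_minus_commute[of "trunc _ w" w])
  then show ?thesis by (rule tendsto_dist_iff[THEN iffD2])
qed

definition diag_op :: "(nat \<Rightarrow> complex) \<Rightarrow> ell2 \<Rightarrow> ell2"
  where "diag_op s w = mk_ell2 (\<lambda>n. s n * coord w n)"

lemma
  assumes "\<And>n. cmod (s n) \<le> M"
  shows coord_diag_op: "coord (diag_op s w) n = s n * coord w n"
    and norm_diag_op_le: "norm (diag_op s w) \<le> M * norm w"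
    and bounded_linear_diag_op: "bounded_linear (diag_op s)"
proof -
  have M: "M \<ge> 0" using assms[of 0] norm_ge_zero order_trans by blast
  have s: "summable (\<lambda>n. (cmod (s n * coord w n))\<^sup>2)" for w
    by (rule square_summable_comparison[OF summable_coord[of w], where M = M])
      (simp add: norm_mult mult_right_mono assms)
  show c: "coord (diag_op s w) n = s n * coord w n" for w n
    by (simp add: diag_op_def coord_mk_ell2 s)
  show n: "norm (diag_op s w) \<le> M * norm w" for w
  proof (rule norm_ell2_leI)
    fix N
    have "(\<Sum>n<N. (cmod (coord (diag_op s w) n))\<^sup>2) \<le> (\<Sum>n<N. M\<^sup>2 * (cmod (coord w n))\<^sup>2)"
      by (intro sum_mono) (auto simp: c norm_mult power_mult_distrib intro!: mult_right_mono power_mono assms)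
    also have "\<dots> \<le> M\<^sup>2 * (norm w)\<^sup>2"
      by (simp add: sum_distrib_left[symmetric] mult_left_mono sum_coord_le)
    finally show "(\<Sum>n<N. (cmod (coord (diag_op s w) n))\<^sup>2) \<le> (M * norm w)\<^sup>2"
      by (simp add: power_mult_distrib)
  qed (use M in simp)
  show "bounded_linear (diag_op s)"
    by (rule bounded_linear_intro[where K = M])
      (auto intro!: ell2_eqI simp: c algebra_simps mult.commute[of _ M] n)
qed

section \<open>Kernels that decay off the diagonal\<close>

text \<open>
  The frequencies grow quadratically, so the gap between the modes \<open>k\<close> and \<open>j\<close> is at least
  \<open>(k - j)\<^sup>2\<close>. This kernel dominates all kernels that arise from oscillations with these frequencies.
\<close>

definition offdiag :: "nat \<Rightarrow> nat \<Rightarrow> real"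
  where "offdiag k j = 1 / (1 + (real k - real j)\<^sup>2)"

lemma offdiag_pos: "offdiag k j > 0"
  by (simp add: offdiag_def add_pos_nonneg)

lemma offdiag_sym: "offdiag k j = offdiag j k"
  by (simp add: offdiag_def power2_commute)

definition schur_bound :: real
  where "schur_bound = 2 * (\<Sum>d. 1 / (1 + (real d)\<^sup>2))"

lemma summable_inv_1_sq: "summable (\<lambda>d. 1 / (1 + (real d)\<^sup>2))"
proof (rule summable_comparison_test')
  show "summable (\<lambda>n. inverse ((real n)\<^sup>2))" by (rule inverse_power_summable) simp
  show "norm (1 / (1 + (real n)\<^sup>2)) \<le> inverse ((real n)\<^sup>2)" if "n \<ge> 1" for n
    using that by (simp add: inverse_eq_divide frac_le)
qed

lemma schur_bound_nonneg: "schur_bound \<ge> 0"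
  unfolding schur_bound_def by (intro mult_nonneg_nonneg suminf_nonneg summable_inv_1_sq) auto

lemma offdiag_sum_le: "(\<Sum>j<N. offdiag k j) \<le> schur_bound"
proof -
  let ?f = "\<lambda>d. 1 / (1 + (real d)\<^sup>2)"
  have le: "(\<Sum>j\<in>A. offdiag k j) \<le> (\<Sum>d. ?f d)" if "finite A" "inj_on g A" "\<And>j. j \<in> A \<Longrightarrow> (real k - real j)\<^sup>2 = (real (g j))\<^sup>2"
    for A and g :: "nat \<Rightarrow> nat"
  proof -
    have "(\<Sum>j\<in>A. offdiag k j) = (\<Sum>d\<in>g ` A. ?f d)"
      using that by (simp add: sum.reindex offdiag_def)
    also have "\<dots> \<le> (\<Sum>d. ?f d)"
      by (intro sum_le_suminf summable_inv_1_sq) (use that in auto)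
    finally show ?thesis .
  qed
  have "(\<Sum>j<N. offdiag k j) = (\<Sum>j\<in>{..<N} \<inter> {..<k}. offdiag k j) + (\<Sum>j\<in>{..<N} - {..<k}. offdiag k j)"
    by (subst sum.Int_Diff[of _ _ "{..<k}"]) auto
  also have "\<dots> \<le> (\<Sum>d. ?f d) + (\<Sum>d. ?f d)"
    by (intro add_mono le[where g = "\<lambda>j. k - j"] le[where g = "\<lambda>j. j - k"])
      (auto simp: inj_on_def of_nat_diff power2_commute)
  finally show ?thesis by (simp add: schur_bound_def)
qed

text \<open>
  Schur's test: Cauchy-Schwarz with the kernel itself as the weight, then the bound for the row
  sums, which are also the column sums.
\<close>

lemma schur_test:
  "(\<Sum>k<N. (\<Sum>j<J. offdiag k j * x j)\<^sup>2) \<le> schur_bound\<^sup>2 * (\<Sum>j<J. (x j)\<^sup>2)"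
proof -
  have cs: "(\<Sum>j<J. offdiag k j * x j)\<^sup>2 \<le> schur_bound * (\<Sum>j<J. offdiag k j * (x j)\<^sup>2)" for k
  proof -
    have "(\<Sum>j<J. offdiag k j * x j)\<^sup>2 = (\<Sum>j<J. sqrt (offdiag k j) * (sqrt (offdiag k j) * x j))\<^sup>2"
      using less_imp_le[OF offdiag_pos] by (simp add: mult.assoc[symmetric])
    also have "\<dots> \<le> (\<Sum>j<J. (sqrt (offdiag k j))\<^sup>2) * (\<Sum>j<J. (sqrt (offdiag k j) * x j)\<^sup>2)"
      by (rule Cauchy_Schwarz_ineq_sum)
    also have "\<dots> = (\<Sum>j<J. offdiag k j) * (\<Sum>j<J. offdiag k j * (x j)\<^sup>2)"
      using less_imp_le[OF offdiag_pos] by (simp add: power_mult_distrib)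
    also have "\<dots> \<le> schur_bound * (\<Sum>j<J. offdiag k j * (x j)\<^sup>2)"
      by (auto intro!: mult_right_mono offdiag_sum_le sum_nonneg simp: less_imp_le[OF offdiag_pos])
    finally show ?thesis .
  qed
  have "(\<Sum>k<N. (\<Sum>j<J. offdiag k j * x j)\<^sup>2) \<le> (\<Sum>k<N. schur_bound * (\<Sum>j<J. offdiag k j * (x j)\<^sup>2))"
    by (intro sum_mono cs)
  also have "\<dots> = schur_bound * (\<Sum>k<N. \<Sum>j<J. offdiag k j * (x j)\<^sup>2)"
    by (simp only: sum_distrib_left)
  also have "(\<Sum>k<N. \<Sum>j<J. offdiag k j * (x j)\<^sup>2) \<le> (\<Sum>j<J. (x j)\<^sup>2 * schur_bound)"
  proof -
    have "(\<Sum>k<N. \<Sum>j<J. offdiag k j * (x j)\<^sup>2) = (\<Sum>j<J. \<Sum>k<N. offdiag k j * (x j)\<^sup>2)"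
      by (rule sum.swap)
    also have "\<dots> = (\<Sum>j<J. (x j)\<^sup>2 * (\<Sum>k<N. offdiag j k))"
      by (intro sum.cong refl) (simp add: sum_distrib_left sum_distrib_right offdiag_sym mult.commute)
    also have "\<dots> \<le> (\<Sum>j<J. (x j)\<^sup>2 * schur_bound)"
      by (intro sum_mono mult_left_mono offdiag_sum_le) auto
    finally show ?thesis .
  qed
  finally have "(\<Sum>k<N. (\<Sum>j<J. offdiag k j * x j)\<^sup>2) \<le> schur_bound * (\<Sum>j<J. (x j)\<^sup>2 * schur_bound)"
    by (simp add: mult_left_mono schur_bound_nonneg)
  also have "schur_bound * (\<Sum>j<J. (x j)\<^sup>2 * schur_bound) = schur_bound\<^sup>2 * (\<Sum>j<J. (x j)\<^sup>2)"
    by (simp only: sum_distrib_right[symmetric]) (simp add: power2_eq_square)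
  finally show ?thesis .
qed

lemma schur_form:
  fixes x :: "nat \<Rightarrow> real"
  shows "(\<Sum>k<N. \<Sum>j<N. offdiag k j * (x k * x j)) \<le> schur_bound * (\<Sum>k<N. (x k)\<^sup>2)"
proof -
  have "(\<Sum>k<N. \<Sum>j<N. offdiag k j * (x k * x j)) \<le>
      (\<Sum>k<N. \<Sum>j<N. offdiag k j * ((x k)\<^sup>2 / 2 + (x j)\<^sup>2 / 2))"
  proof (intro sum_mono mult_left_mono less_imp_le[OF offdiag_pos])
    show "x k * x j \<le> (x k)\<^sup>2 / 2 + (x j)\<^sup>2 / 2" for k j
      using sum_squares_bound[of "x k" "x j"] by simp
  qed
  also have "\<dots> = (\<Sum>k<N. \<Sum>j<N. offdiag k j * ((x k)\<^sup>2 / 2)) + (\<Sum>k<N. \<Sum>j<N. offdiag k j * ((x j)\<^sup>2 / 2))"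
    by (simp add: distrib_left sum.distrib)
  also have "(\<Sum>k<N. \<Sum>j<N. offdiag k j * ((x j)\<^sup>2 / 2)) = (\<Sum>k<N. \<Sum>j<N. offdiag k j * ((x k)\<^sup>2 / 2))"
    by (subst sum.swap) (simp add: offdiag_sym)
  also have "(\<Sum>k<N. \<Sum>j<N. offdiag k j * ((x k)\<^sup>2 / 2)) = (\<Sum>k<N. (\<Sum>j<N. offdiag k j) * ((x k)\<^sup>2 / 2))"
    by (simp only: sum_distrib_right)
  also have "\<dots> \<le> (\<Sum>k<N. schur_bound * ((x k)\<^sup>2 / 2))"
    by (intro sum_mono mult_right_mono offdiag_sum_le) auto
  finally show ?thesis by (simp add: sum_distrib_left[symmetric] sum_divide_distrib[symmetric])
qed

lemma offdiag_kernel_bounded: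
  assumes t: "\<And>k j. cmod (t k j) \<le> M * offdiag k j * cmod (coord w j)"
  shows "summable (\<lambda>j. t k j)"
    and "summable (\<lambda>k. (cmod (\<Sum>j. t k j))\<^sup>2)"
    and "norm (mk_ell2 (\<lambda>k. \<Sum>j. t k j)) \<le> \<bar>M\<bar> * schur_bound * norm w"
proof -
  have "summable (\<lambda>j. offdiag k j * cmod (coord w j))" for k
  proof (rule summable_comparison_test')
    show "summable (\<lambda>j. (offdiag k j)\<^sup>2 + (cmod (coord w j))\<^sup>2)"
    proof (intro summable_add summable_coord)
      have "summable (\<lambda>j. offdiag k j)"
        by (rule bounded_imp_summable[of _ schur_bound])
          (use offdiag_sum_le[of k "Suc _"] less_imp_le[OF offdiag_pos] in \<open>auto simp: lessThan_Suc_atMost\<close>)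
      then show "summable (\<lambda>j. (offdiag k j)\<^sup>2)"
        by (rule summable_comparison_test'[where N = 0])
          (auto simp: offdiag_def power2_eq_square divide_simps add_pos_nonneg)
    qed
    show "norm (offdiag k j * cmod (coord w j)) \<le> (offdiag k j)\<^sup>2 + (cmod (coord w j))\<^sup>2" for j
    proof -
      have nn: "0 \<le> offdiag k j * cmod (coord w j)"
        using less_imp_le[OF offdiag_pos] by simp
      show ?thesis
        using sum_squares_bound[of "offdiag k j" "cmod (coord w j)"] nn
        unfolding real_norm_def abs_of_nonneg[OF nn] mult.assoc by linarith
    qed
  qed
  then have sw: "summable (\<lambda>j. \<bar>M\<bar> * (offdiag k j * cmod (coord w j)))" for k
    by (intro summable_mult)
  have t': "cmod (t k j) \<le> \<bar>M\<bar> * (offdiag k j * cmod (coord w j))" for k j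
  proof -
    have "M * (offdiag k j * cmod (coord w j)) \<le> \<bar>M\<bar> * (offdiag k j * cmod (coord w j))"
      using offdiag_pos[of k j] by (intro mult_right_mono) auto
    then show ?thesis using t[of k j] by (simp add: mult.assoc)
  qed
  show st: "summable (\<lambda>j. t k j)" for k
    by (rule summable_comparison_test'[OF sw[of k]]) (rule t')
  have fin: "(\<Sum>k<N. (cmod (\<Sum>j. t k j))\<^sup>2) \<le> (\<bar>M\<bar> * schur_bound * norm w)\<^sup>2" for N
  proof (rule LIMSEQ_le_const2)
    show "(\<lambda>J. \<Sum>k<N. (cmod (\<Sum>j<J. t k j))\<^sup>2) \<longlonglongrightarrow> (\<Sum>k<N. (cmod (\<Sum>j. t k j))\<^sup>2)"
      by (intro tendsto_intros summable_LIMSEQ st)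
    have "(\<Sum>k<N. (cmod (\<Sum>j<J. t k j))\<^sup>2) \<le> (\<bar>M\<bar> * schur_bound * norm w)\<^sup>2" for J
    proof -
      have "(\<Sum>k<N. (cmod (\<Sum>j<J. t k j))\<^sup>2) \<le> (\<Sum>k<N. (\<bar>M\<bar> * (\<Sum>j<J. offdiag k j * cmod (coord w j)))\<^sup>2)"
        unfolding sum_distrib_left
        by (intro sum_mono power_mono sum_norm_le t') auto
      also have "\<dots> = M\<^sup>2 * (\<Sum>k<N. (\<Sum>j<J. offdiag k j * cmod (coord w j))\<^sup>2)"
        by (simp only: power_mult_distrib power2_abs sum_distrib_left[symmetric])
      also have "\<dots> \<le> M\<^sup>2 * (schur_bound\<^sup>2 * (\<Sum>j<J. (cmod (coord w j))\<^sup>2))"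
        by (intro mult_left_mono schur_test) auto
      also have "\<dots> \<le> M\<^sup>2 * (schur_bound\<^sup>2 * (norm w)\<^sup>2)"
        by (intro mult_left_mono sum_coord_le) auto
      finally show ?thesis by (simp add: power_mult_distrib mult_ac)
    qed
    then show "\<exists>J0. \<forall>J\<ge>J0. (\<Sum>k<N. (cmod (\<Sum>j<J. t k j))\<^sup>2) \<le> (\<bar>M\<bar> * schur_bound * norm w)\<^sup>2" by blast
  qed
  show "summable (\<lambda>k. (cmod (\<Sum>j. t k j))\<^sup>2)" "norm (mk_ell2 (\<lambda>k. \<Sum>j. t k j)) \<le> \<bar>M\<bar> * schur_bound * norm w"
    using mk_ell2_bound[OF fin] schur_bound_nonneg by auto
qed

section \<open>The frequencies\<close>

definition freq :: "nat \<Rightarrow> real"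
  where "freq n = eigval (Suc n)"

lemma freq_pos: "freq n > 0"
  by (simp add: freq_def eigval_def)

lemma pi_sq_ge_1: "1 \<le> pi\<^sup>2"
proof -
  have "1 \<le> pi" using pi_gt3 by linarith
  then show ?thesis by (rule one_le_power)
qed

lemma freq_ge_1: "freq n \<ge> 1"
proof -
  have "1 * 1 \<le> (real (Suc n))\<^sup>2 * pi\<^sup>2" by (intro mult_mono pi_sq_ge_1 one_le_power) auto
  then show ?thesis by (simp add: freq_def eigval_def power_mult_distrib)
qed

lemma freq_diff: "(real k - real j)\<^sup>2 \<le> \<bar>freq k - freq j\<bar>"
proof -
  have "(real k - real j)\<^sup>2 = \<bar>real k - real j\<bar> * \<bar>real k - real j\<bar>" by (simp add: power2_eq_square)
  also have "\<dots> \<le> (\<bar>real k - real j\<bar> * (real (Suc k) + real (Suc j))) * 1"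
    by (simp only: mult_1_right, intro mult_left_mono) auto
  also have "\<dots> \<le> (\<bar>real k - real j\<bar> * (real (Suc k) + real (Suc j))) * pi\<^sup>2"
    by (intro mult_left_mono pi_sq_ge_1) auto
  also have "\<dots> = \<bar>(real k - real j) * (real (Suc k) + real (Suc j)) * pi\<^sup>2\<bar>"
    by (simp add: abs_mult)
  also have "(real k - real j) * (real (Suc k) + real (Suc j)) * pi\<^sup>2 = freq k - freq j"
    by (simp add: freq_def eigval_def power2_eq_square algebra_simps)
  finally show ?thesis .
qed

lemma freq_sum: "1 + (real k - real j)\<^sup>2 \<le> freq k + freq j"
proof -
  have "1 + (real k - real j)\<^sup>2 \<le> (real (Suc k))\<^sup>2 + (real (Suc j))\<^sup>2"
    by (simp add: power2_eq_square algebra_simps)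
  also have "\<dots> \<le> (real (Suc k))\<^sup>2 * pi\<^sup>2 + (real (Suc j))\<^sup>2 * pi\<^sup>2"
  proof -
    have "(real (Suc i))\<^sup>2 * 1 \<le> (real (Suc i))\<^sup>2 * pi\<^sup>2" for i
      by (intro mult_left_mono pi_sq_ge_1) auto
    from this[of k] this[of j] show ?thesis by linarith
  qed
  finally show ?thesis by (simp add: freq_def eigval_def power_mult_distrib)
qed

section \<open>Coercivity of trigonometric sums\<close>

lemma exp_has_vector_derivative:
  "((\<lambda>t. exp (\<nu> * complex_of_real t)) has_vector_derivative \<nu> * exp (\<nu> * of_real t)) (at t)"
proof -
  have "((\<lambda>z. exp (\<nu> * z)) has_field_derivative \<nu> * exp (\<nu> * of_real t)) (at (of_real t))"
    by (auto intro!: derivative_eq_intros)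
  from has_vector_derivative_real_field[OF this] show ?thesis by simp
qed

lemma Re_has_real_derivative:
  "(h has_vector_derivative h') (at t) \<Longrightarrow> ((\<lambda>t. Re (h t)) has_real_derivative Re h') (at t)"
  unfolding has_real_derivative_iff_has_vector_derivative
  by (rule bounded_linear.has_vector_derivative[OF bounded_linear_Re])

text \<open>
  A damped oscillation \<open>exp (- (\<alpha> - \<i> \<xi>) t)\<close> is minus the derivative of itself divided by \<open>\<alpha> - \<i> \<xi>\<close>.
  The entries of the Gramian are therefore values at time zero of integrals over \<open>[0, \<infinity>)\<close>; working with
  the primitives avoids improper integrals.
\<close>

lemma damped_primitive:
  assumes "\<alpha> > 0"
  shows "((\<lambda>t. Re (c * exp (\<i> * of_real \<xi> * of_real t) / (of_real \<alpha> - \<i> * of_real \<xi>)) * exp (- \<alpha> * t))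
     has_real_derivative - Re (c * exp (\<i> * of_real \<xi> * of_real t)) * exp (- \<alpha> * t)) (at t)"
proof -
  define \<nu> where "\<nu> = complex_of_real \<alpha> - \<i> * of_real \<xi>"
  have nz: "\<nu> \<noteq> 0" using assms by (auto simp: \<nu>_def complex_eq_iff)
  have split: "exp (- \<nu> * of_real s) = exp (\<i> * of_real \<xi> * of_real s) * of_real (exp (- \<alpha> * s))" for s
  proof -
    have "- \<nu> * of_real s = \<i> * of_real \<xi> * of_real s + of_real (- \<alpha> * s)"
      by (simp add: \<nu>_def algebra_simps)
    then show ?thesis by (simp only: exp_add exp_of_real)
  qed
  have "((\<lambda>t. c / \<nu> * exp (- \<nu> * of_real t)) has_vector_derivative c / \<nu> * (- \<nu> * exp (- \<nu> * of_real t))) (at t)"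
    by (rule has_vector_derivative_mult_right[OF exp_has_vector_derivative])
  moreover have "c / \<nu> * (- \<nu> * exp (- \<nu> * of_real t)) = - (c * exp (\<i> * of_real \<xi> * of_real t)) * of_real (exp (- \<alpha> * t))"
    using nz by (simp only: split) simp
  moreover have "(\<lambda>t. c / \<nu> * exp (- \<nu> * of_real t)) = (\<lambda>t. (c * exp (\<i> * of_real \<xi> * of_real t) / \<nu>) * of_real (exp (- \<alpha> * t)))"
    by (simp only: split) (simp add: mult_ac)
  ultimately have "((\<lambda>t. (c * exp (\<i> * of_real \<xi> * of_real t) / \<nu>) * of_real (exp (- \<alpha> * t))) has_vector_derivative
      - (c * exp (\<i> * of_real \<xi> * of_real t)) * of_real (exp (- \<alpha> * t))) (at t)"
    by simp
  note deriv = Re_has_real_derivative[OF this]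
  have Re_mult: "Re (z * of_real r) = Re z * r" for z r by simp
  show ?thesis
    using deriv unfolding \<nu>_def Re_mult uminus_complex.sel .
qed

text \<open>
  The integral of \<open>exp (\<i> \<xi> s)\<close> over \<open>0 \<le> s \<le> t\<close>.
\<close>

definition exp_primitive :: "real \<Rightarrow> real \<Rightarrow> complex"
  where "exp_primitive \<xi> t = (if \<xi> = 0 then of_real t else (exp (\<i> * of_real \<xi> * of_real t) - 1) / (\<i> * of_real \<xi>))"

lemma exp_primitive_deriv:
  "((\<lambda>t. Re (c * exp_primitive \<xi> t)) has_real_derivative Re (c * exp (\<i> * of_real \<xi> * of_real t))) (at t)"
proof (rule Re_has_real_derivative, cases "\<xi> = 0")
  case True
  have "((\<lambda>t. c * of_real t) has_vector_derivative c * 1) (at t)"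
    by (rule has_vector_derivative_mult_right)
      (use bounded_linear.has_vector_derivative[OF bounded_linear_of_real has_vector_derivative_id] in simp)
  then show "((\<lambda>t. c * exp_primitive \<xi> t) has_vector_derivative c * exp (\<i> * of_real \<xi> * of_real t)) (at t)"
    using True by (simp add: exp_primitive_def)
next
  case False
  have "((\<lambda>t. c * ((exp (\<i> * of_real \<xi> * of_real t) - 1) / (\<i> * of_real \<xi>))) has_vector_derivative
     c * ((\<i> * of_real \<xi> * exp (\<i> * of_real \<xi> * of_real t) - 0) / (\<i> * of_real \<xi>))) (at t)"
    by (intro has_vector_derivative_mult_right has_vector_derivative_divide has_vector_derivative_diff
        exp_has_vector_derivative has_vector_derivative_const)
  then show "((\<lambda>t. c * exp_primitive \<xi> t) has_vector_derivative c * exp (\<i> * of_real \<xi> * of_real t)) (at t)"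
    using False by (simp add: exp_primitive_def)
qed

lemma exp_primitive_0 [simp]: "exp_primitive \<xi> 0 = 0"
  by (simp add: exp_primitive_def)

lemma norm_exp_primitive: "\<xi> \<noteq> 0 \<Longrightarrow> cmod (exp_primitive \<xi> t) \<le> 2 / \<bar>\<xi>\<bar>"
  using norm_triangle_ineq4[of "exp (\<i> * of_real \<xi> * of_real t)" 1]
  by (auto simp: exp_primitive_def norm_divide norm_mult intro!: divide_right_mono)

text \<open>
  With \<open>U\<close> for the sum, \<open>2 (Im U)\<^sup>2 = Re (cnj U * U - cnj U * cnj U)\<close>: the square of the observed
  signal involves the differences and the sums of the frequencies.
\<close>

lemma Im_sum_square:
  fixes u :: "nat \<Rightarrow> complex"
  shows "(Im (\<Sum>j<N. exp (- \<i> * of_real (f j) * of_real t) * u j))\<^sup>2 =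
    (\<Sum>k<N. \<Sum>j<N. Re (cnj (u k) * u j * exp (\<i> * of_real (f k - f j) * of_real t)) -
       Re (cnj (u k) * cnj (u j) * exp (\<i> * of_real (f k + f j) * of_real t))) / 2"
proof -
  define U where "U = (\<Sum>j<N. exp (- \<i> * of_real (f j) * of_real t) * u j)"
  have cU: "cnj U = (\<Sum>j<N. exp (\<i> * of_real (f j) * of_real t) * cnj (u j))"
    unfolding U_def by (simp add: exp_cnj)
  have e1: "exp (\<i> * of_real (f k) * of_real t) * exp (- \<i> * of_real (f j) * of_real t) =
      exp (\<i> * of_real (f k - f j) * of_real t)" for k j
    by (simp add: exp_add[symmetric] algebra_simps)
  have e2: "exp (\<i> * of_real (f k) * of_real t) * exp (\<i> * of_real (f j) * of_real t) =
      exp (\<i> * of_real (f k + f j) * of_real t)" for k j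
    by (simp add: exp_add[symmetric] algebra_simps)
  have 1: "cnj U * U = (\<Sum>k<N. \<Sum>j<N. cnj (u k) * u j * exp (\<i> * of_real (f k - f j) * of_real t))"
    unfolding cU unfolding U_def sum_product by (intro sum.cong refl, subst e1[symmetric]) (simp only: mult_ac)
  have 2: "cnj U * cnj U = (\<Sum>k<N. \<Sum>j<N. cnj (u k) * cnj (u j) * exp (\<i> * of_real (f k + f j) * of_real t))"
    unfolding cU sum_product by (intro sum.cong refl, subst e2[symmetric]) (simp only: mult_ac)
  have "2 * (Im U)\<^sup>2 = Re (cnj U * U) - Re (cnj U * cnj U)"
    by (simp add: power2_eq_square)
  also have "\<dots> = (\<Sum>k<N. \<Sum>j<N. Re (cnj (u k) * u j * exp (\<i> * of_real (f k - f j) * of_real t)) -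
       Re (cnj (u k) * cnj (u j) * exp (\<i> * of_real (f k + f j) * of_real t)))"
    unfolding 1 2 Re_sum sum_subtractf ..
  finally show ?thesis unfolding U_def by simp
qed

text \<open>
  An inequality of Ingham type; the right-hand side is \<open>\<integral>\<^sub>0\<^sup>\<infinity> exp (- \<alpha> t) (g t)\<^sup>2 dt\<close> for the signal
  \<open>g t = Im (\<Sum>j<N. exp (- \<i> freq j t) * u j)\<close>. It dominates \<open>exp (- \<alpha> T)\<close> times the integral of \<open>g\<^sup>2\<close> over
  \<open>[0, T]\<close>. In the latter the diagonal terms grow linearly with \<open>T\<close>, while the sum of the others stays
  bounded, by Schur's test and the gaps between the frequencies. The choice of \<open>T\<close> makes the diagonal win.
\<close>

lemma gram_form_coercive:
  fixes u :: "nat \<Rightarrow> complex"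
  assumes "\<alpha> > 0"
  defines "T \<equiv> 6 * schur_bound + 2"
  shows "exp (- \<alpha> * T) * (\<Sum>k<N. (cmod (u k))\<^sup>2) \<le>
    (\<Sum>k<N. \<Sum>j<N. Re (cnj (u k) * u j / (of_real \<alpha> - \<i> * of_real (freq k - freq j))) -
       Re (cnj (u k) * cnj (u j) / (of_real \<alpha> - \<i> * of_real (freq k + freq j)))) / 2"
proof -
  define g where "g t = Im (\<Sum>j<N. exp (- \<i> * of_real (freq j) * of_real t) * u j)" for t
  define q where "q t = (\<Sum>k<N. \<Sum>j<N.
      Re (cnj (u k) * u j * exp (\<i> * of_real (freq k - freq j) * of_real t) / (of_real \<alpha> - \<i> * of_real (freq k - freq j))) * exp (- \<alpha> * t) -
      Re (cnj (u k) * cnj (u j) * exp (\<i> * of_real (freq k + freq j) * of_real t) / (of_real \<alpha> - \<i> * of_real (freq k + freq j))) * exp (- \<alpha> * t)) / 2" for t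
  define p where "p t = (\<Sum>k<N. \<Sum>j<N.
      Re (cnj (u k) * u j * exp_primitive (freq k - freq j) t) -
      Re (cnj (u k) * cnj (u j) * exp_primitive (freq k + freq j) t)) / 2" for t
  have T: "T > 0" using schur_bound_nonneg by (simp add: T_def)
  have dq: "(q has_real_derivative - (g t)\<^sup>2 * exp (- \<alpha> * t)) (at t)" for t
  proof -
    have "(q has_real_derivative (\<Sum>k<N. \<Sum>j<N.
      - Re (cnj (u k) * u j * exp (\<i> * of_real (freq k - freq j) * of_real t)) * exp (- \<alpha> * t) -
      - Re (cnj (u k) * cnj (u j) * exp (\<i> * of_real (freq k + freq j) * of_real t)) * exp (- \<alpha> * t)) / 2) (at t)"
      unfolding q_def by (intro DERIV_cdivide DERIV_sum DERIV_diff damped_primitive assms)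
    moreover have "(\<Sum>k<N. \<Sum>j<N.
      - Re (cnj (u k) * u j * exp (\<i> * of_real (freq k - freq j) * of_real t)) * exp (- \<alpha> * t) -
      - Re (cnj (u k) * cnj (u j) * exp (\<i> * of_real (freq k + freq j) * of_real t)) * exp (- \<alpha> * t)) / 2 = - (g t)\<^sup>2 * exp (- \<alpha> * t)"
    proof -
      have "- x * e - - y * e = (x - y) * - e" for x y e :: real
        by (simp add: algebra_simps)
      then show ?thesis
        unfolding g_def Im_sum_square by (simp only: sum_distrib_right[symmetric])
    qed
    ultimately show ?thesis by simp
  qed
  have dp: "(p has_real_derivative (g t)\<^sup>2) (at t)" for t
    unfolding p_def g_def Im_sum_square
    by (intro DERIV_cdivide DERIV_sum DERIV_diff exp_primitive_deriv)
  have q_le: "q t \<le> q s" if "s \<le> t" for s t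
    by (rule DERIV_nonpos_imp_nonincreasing[OF that]) (use dq in \<open>force\<close>)
  \<comment> \<open>\<open>q\<close> is the damped energy that remains after time \<open>t\<close>; it decreases to zero\<close>
  have "(q \<longlongrightarrow> 0) at_top"
  proof -
    have zero: "((\<lambda>t. Re (c * exp (\<i> * of_real \<xi> * of_real t) / d) * exp (- \<alpha> * t)) \<longlongrightarrow> 0) at_top" for c d \<xi>
    proof (rule Lim_null_comparison)
      show "\<forall>\<^sub>F t in at_top. norm (Re (c * exp (\<i> * of_real \<xi> * of_real t) / d) * exp (- \<alpha> * t)) \<le> cmod (c / d) * exp (- \<alpha> * t)"
      proof (intro always_eventually allI)
        fix t
        have "\<bar>Re (c * exp (\<i> * of_real \<xi> * of_real t) / d)\<bar> \<le> cmod (c * exp (\<i> * of_real \<xi> * of_real t) / d)"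
          by (rule abs_Re_le_cmod)
        then show "norm (Re (c * exp (\<i> * of_real \<xi> * of_real t) / d) * exp (- \<alpha> * t)) \<le> cmod (c / d) * exp (- \<alpha> * t)"
          using mult_right_mono[of _ "cmod (c / d)" "exp (- \<alpha> * t)"]
          by (simp add: abs_mult norm_mult norm_divide)
      qed
      have "filterlim (\<lambda>t. - \<alpha> * t) at_bot at_top"
        by (rule filterlim_tendsto_neg_mult_at_bot[OF tendsto_const _ filterlim_ident]) (use assms in simp)
      then have "((\<lambda>t. exp (- \<alpha> * t)) \<longlongrightarrow> 0) at_top"
        by (rule filterlim_compose[OF exp_at_bot])
      from tendsto_mult_right_zero[OF this] show "((\<lambda>t. cmod (c / d) * exp (- \<alpha> * t)) \<longlongrightarrow> 0) at_top" .
    qed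
    have "(q \<longlongrightarrow> (\<Sum>k<N. \<Sum>j<N. 0 - 0) / 2) at_top"
      unfolding q_def by (intro tendsto_intros zero) simp
    then show ?thesis by simp
  qed
  then have q_nonneg: "q t \<ge> 0" for t
    by (rule tendsto_upperbound) (auto intro!: eventually_mono[OF eventually_ge_at_top[of t]] q_le)
  \<comment> \<open>on \<open>[0, T]\<close> the damping factor is at least \<open>exp (- \<alpha> * T)\<close>\<close>
  have "q T + exp (- \<alpha> * T) * p T \<le> q 0 + exp (- \<alpha> * T) * p 0"
  proof (rule DERIV_nonpos_imp_nonincreasing[of 0 T "\<lambda>t. q t + exp (- \<alpha> * T) * p t"])
    fix t assume t: "0 \<le> t" "t \<le> T"
    have "((\<lambda>t. q t + exp (- \<alpha> * T) * p t) has_real_derivative - (g t)\<^sup>2 * exp (- \<alpha> * t) + exp (- \<alpha> * T) * (g t)\<^sup>2) (at t)"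
      by (intro DERIV_add DERIV_cmult dq dp)
    moreover have "- (g t)\<^sup>2 * exp (- \<alpha> * t) + exp (- \<alpha> * T) * (g t)\<^sup>2 \<le> 0"
    proof -
      have "exp (- \<alpha> * T) * (g t)\<^sup>2 \<le> exp (- \<alpha> * t) * (g t)\<^sup>2"
        using t assms(1) by (intro mult_right_mono) auto
      then show ?thesis by (simp add: mult.commute)
    qed
    ultimately show "\<exists>y. ((\<lambda>t. q t + exp (- \<alpha> * T) * p t) has_real_derivative y) (at t) \<and> y \<le> 0" by blast
  qed (use T in simp)
  moreover have "p 0 = 0" by (simp add: p_def)
  ultimately have "exp (- \<alpha> * T) * p T \<le> q 0" using q_nonneg[of T] by simp
  moreover have "(\<Sum>k<N. (cmod (u k))\<^sup>2) \<le> p T"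
  proof -
    have "2 * p T \<ge> (\<Sum>k<N. \<Sum>j<N. (if j = k then T * (cmod (u k))\<^sup>2 else 0) - 6 * (offdiag k j * (cmod (u k) * cmod (u j))))"
    proof -
      have "(if j = k then T * (cmod (u k))\<^sup>2 else 0) - 6 * (offdiag k j * (cmod (u k) * cmod (u j))) \<le>
        Re (cnj (u k) * u j * exp_primitive (freq k - freq j) T) - Re (cnj (u k) * cnj (u j) * exp_primitive (freq k + freq j) T)" for k j
      proof -
        let ?U = "cmod (u k) * cmod (u j)"
        have U: "?U \<ge> 0" by simp
        have "Re (cnj (u k) * cnj (u j) * exp_primitive (freq k + freq j) T) \<le> cmod (cnj (u k) * cnj (u j) * exp_primitive (freq k + freq j) T)"
          by (rule complex_Re_le_cmod)
        also have "\<dots> \<le> ?U * (2 / \<bar>freq k + freq j\<bar>)"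
          unfolding norm_mult complex_mod_cnj using freq_pos[of k] freq_pos[of j]
          by (intro mult_left_mono norm_exp_primitive U) simp
        also have "\<dots> \<le> ?U * (2 * offdiag k j)"
        proof (intro mult_left_mono U)
          have "2 / \<bar>freq k + freq j\<bar> \<le> 2 / (1 + (real k - real j)\<^sup>2)"
            using freq_sum[of k j] by (intro frac_le) (auto simp: add_pos_nonneg)
          then show "2 / \<bar>freq k + freq j\<bar> \<le> 2 * offdiag k j" by (simp add: offdiag_def)
        qed
        finally have plus: "Re (cnj (u k) * cnj (u j) * exp_primitive (freq k + freq j) T) \<le> 2 * (offdiag k j * ?U)"
          by (simp add: mult_ac)
        have minus: "(if j = k then T * (cmod (u k))\<^sup>2 else 0) - 4 * (offdiag k j * ?U) \<le> Re (cnj (u k) * u j * exp_primitive (freq k - freq j) T)"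
        proof (cases "j = k")
          case True
          have "cnj (u k) * u k * of_real T = of_real (T * (cmod (u k))\<^sup>2)"
            by (simp add: complex_norm_square del: of_real_power)
          then have "Re (cnj (u k) * u j * exp_primitive (freq k - freq j) T) = T * (cmod (u k))\<^sup>2"
            by (simp only: True exp_primitive_def diff_self simp_thms if_True Re_complex_of_real)
          moreover have "0 \<le> 4 * (offdiag k j * ?U)" using less_imp_le[OF offdiag_pos] by simp
          ultimately show ?thesis using True by simp
        next
          case False
          then have "1 \<le> \<bar>real k - real j\<bar>" by linarith
          then have one: "1 \<le> (real k - real j)\<^sup>2" by (metis one_le_power power2_abs)
          with freq_diff[of k j] have fd: "freq k - freq j \<noteq> 0" by auto
          have "- Re (cnj (u k) * u j * exp_primitive (freq k - freq j) T) \<le> cmod (cnj (u k) * u j * exp_primitive (freq k - freq j) T)"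
            using abs_Re_le_cmod[of "cnj (u k) * u j * exp_primitive (freq k - freq j) T"] by linarith
          also have "\<dots> \<le> ?U * (2 / \<bar>freq k - freq j\<bar>)"
            unfolding norm_mult complex_mod_cnj by (intro mult_left_mono norm_exp_primitive U fd)
          also have "\<dots> \<le> ?U * (4 * offdiag k j)"
          proof (intro mult_left_mono U)
            have "2 / \<bar>freq k - freq j\<bar> \<le> 2 / ((1 + (real k - real j)\<^sup>2) / 2)"
              using freq_diff[of k j] one by (intro frac_le) (auto simp: add_pos_nonneg)
            then show "2 / \<bar>freq k - freq j\<bar> \<le> 4 * offdiag k j" by (simp add: offdiag_def)
          qed
          finally show ?thesis using False by (simp add: mult_ac)
        qed
        show ?thesis using plus minus by linarith
      qed
      then show ?thesis unfolding p_def by (simp add: sum_mono)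
    qed
    moreover have "(\<Sum>k<N. \<Sum>j<N. (if j = k then T * (cmod (u k))\<^sup>2 else 0) - 6 * (offdiag k j * (cmod (u k) * cmod (u j))))
      = T * (\<Sum>k<N. (cmod (u k))\<^sup>2) - 6 * (\<Sum>k<N. \<Sum>j<N. offdiag k j * (cmod (u k) * cmod (u j)))"
      by (simp add: sum_subtractf sum_distrib_left sum.delta)
    ultimately have "2 * p T \<ge> T * (\<Sum>k<N. (cmod (u k))\<^sup>2) - 6 * (schur_bound * (\<Sum>k<N. (cmod (u k))\<^sup>2))"
      using schur_form[where x = "\<lambda>k. cmod (u k)" and N = N] by linarith
    then show ?thesis unfolding T_def by (simp add: algebra_simps)
  qed
  ultimately have "exp (- \<alpha> * T) * (\<Sum>k<N. (cmod (u k))\<^sup>2) \<le> q 0"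
    by (meson exp_ge_zero mult_left_mono order_trans)
  then show ?thesis by (simp add: q_def)
qed

section \<open>The Gramian\<close>

text \<open>
  In suitable coordinates the system is \<open>w\<^sub>k' = - \<i> freq k w\<^sub>k + \<i> \<beta> k v\<close> with a scalar real control
  \<open>v\<close>, and the task is to make the closed loop decay like \<open>exp (- \<alpha> t)\<close>. The control coefficients \<open>\<beta>\<close>
  are bounded above and below, but not square-summable: the control operator is unbounded.
\<close>

locale gramian =
  fixes \<alpha> :: real and \<beta> :: "nat \<Rightarrow> real" and bl bu :: real
  assumes alpha_pos: "0 < \<alpha>" and bl_pos: "0 < bl"
    and bl: "bl \<le> \<bar>\<beta> n\<bar>" and bu: "\<bar>\<beta> n\<bar> \<le> bu"
begin

definition kern :: "nat \<Rightarrow> nat \<Rightarrow> real \<Rightarrow> complex"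
  where "kern k j \<xi> = of_real (\<beta> k * \<beta> j / 2) / (of_real \<alpha> - \<i> * of_real \<xi>)"

definition gram_term :: "ell2 \<Rightarrow> nat \<Rightarrow> nat \<Rightarrow> complex"
  where "gram_term w k j =
    kern k j (freq k - freq j) * coord w j - kern k j (freq k + freq j) * cnj (coord w j)"

text \<open>
  Let \<open>B v = \<i> \<beta> v\<close> be the control operator, \<open>B\<^sup>* w = \<Sum>j. \<beta> j * Im w\<^sub>j\<close> its formal adjoint, and \<open>U(t)\<close> the free
  evolution, which multiplies \<open>w\<^sub>k\<close> by \<open>exp (- \<i> freq k t)\<close>. Formally, \<open>gram\<close> is the Gramian
  \<open>\<integral>\<^sub>0\<^sup>\<infinity> exp (- \<alpha> t) U(- t) B B\<^sup>* U(t) dt\<close>. Integration in \<open>t\<close> gives the entries; the conjugates come from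
  \<open>Im w = (w - cnj w) / (2 \<i>)\<close>.
\<close>

definition gram :: "ell2 \<Rightarrow> ell2"
  where "gram w = mk_ell2 (\<lambda>k. \<Sum>j. gram_term w k j)"

lemma bu_nonneg: "0 \<le> bu"
  using bu[of 0] by linarith

lemma denominator_nz [simp]: "complex_of_real \<alpha> - \<i> * of_real \<xi> \<noteq> 0"
  using alpha_pos by (auto simp: complex_eq_iff)

lemma kern_bound:
  assumes "(real k - real j)\<^sup>2 \<le> \<bar>\<xi>\<bar>"
  shows "cmod (kern k j \<xi>) \<le> bu\<^sup>2 / 2 * (1 / \<alpha> + 1) * offdiag k j"
proof -
  let ?d = "complex_of_real \<alpha> - \<i> * of_real \<xi>"
  have a: "\<alpha> \<le> cmod ?d" using complex_Re_le_cmod[of ?d] by simp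
  have b: "\<bar>\<xi>\<bar> \<le> cmod ?d" using abs_Im_le_cmod[of ?d] by simp
  have "1 + (real k - real j)\<^sup>2 \<le> cmod ?d / \<alpha> + cmod ?d"
    using a b assms alpha_pos by (intro add_mono) (auto simp: field_simps)
  also have "\<dots> = (1 / \<alpha> + 1) * cmod ?d" by (simp add: algebra_simps)
  finally have "1 / cmod ?d \<le> (1 / \<alpha> + 1) * offdiag k j"
    using a alpha_pos by (auto simp: offdiag_def divide_simps add_pos_nonneg mult_ac)
  moreover have "\<bar>\<beta> k * \<beta> j / 2\<bar> \<le> bu\<^sup>2 / 2"
    using mult_mono[OF bu[of k] bu[of j]] bu_nonneg by (simp add: abs_mult power2_eq_square)
  ultimately have "\<bar>\<beta> k * \<beta> j / 2\<bar> * (1 / cmod ?d) \<le> (bu\<^sup>2 / 2) * ((1 / \<alpha> + 1) * offdiag k j)"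
    by (intro mult_mono) auto
  moreover have "cmod (kern k j \<xi>) = \<bar>\<beta> k * \<beta> j / 2\<bar> * (1 / cmod ?d)"
    by (simp only: kern_def norm_divide norm_of_real times_divide_eq_right mult_1_right)
  ultimately show ?thesis by (simp only: mult.assoc)
qed

lemma gram_term_bound:
  "cmod (gram_term w k j) \<le> bu\<^sup>2 * (1 / \<alpha> + 1) * offdiag k j * cmod (coord w j)"
proof -
  let ?B = "bu\<^sup>2 / 2 * (1 / \<alpha> + 1) * offdiag k j"
  have "(real k - real j)\<^sup>2 \<le> \<bar>freq k + freq j\<bar>" using freq_sum[of k j] by linarith
  note bounds = mult_right_mono[OF kern_bound[OF freq_diff[of k j]] norm_ge_zero[of "coord w j"]]
    mult_right_mono[OF kern_bound[OF this] norm_ge_zero[of "coord w j"]]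
  have "cmod (gram_term w k j) \<le> cmod (kern k j (freq k - freq j)) * cmod (coord w j)
      + cmod (kern k j (freq k + freq j)) * cmod (coord w j)"
    unfolding gram_term_def using norm_triangle_ineq4 by (metis complex_mod_cnj norm_mult)
  also have "\<dots> \<le> ?B * cmod (coord w j) + ?B * cmod (coord w j)"
    by (intro add_mono bounds)
  finally show ?thesis by (simp add: algebra_simps)
qed

lemma summable_gram_term: "summable (gram_term w k)"
  by (rule offdiag_kernel_bounded(1)[OF gram_term_bound])

lemma coord_gram: "coord (gram w) k = (\<Sum>j. gram_term w k j)"
  unfolding gram_def by (subst coord_mk_ell2[OF offdiag_kernel_bounded(2)[OF gram_term_bound]]) simp

lemma bounded_linear_gram: "bounded_linear gram"
proof (rule bounded_linear_intro)
  show "gram (x + y) = gram x + gram y" for x y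
  proof (rule ell2_eqI)
    fix k
    have "gram_term (x + y) k = (\<lambda>j. gram_term x k j + gram_term y k j)"
      by (auto simp: gram_term_def algebra_simps)
    then show "coord (gram (x + y)) k = coord (gram x + gram y) k"
      by (simp add: coord_gram suminf_add summable_gram_term)
  qed
  show "gram (r *\<^sub>R x) = r *\<^sub>R gram x" for r x
  proof (rule ell2_eqI)
    fix k
    have "gram_term (r *\<^sub>R x) k = (\<lambda>j. r *\<^sub>R gram_term x k j)"
      by (auto simp: gram_term_def algebra_simps scaleR_conv_of_real)
    then show "coord (gram (r *\<^sub>R x)) k = coord (r *\<^sub>R gram x) k"
      by (simp add: coord_gram suminf_scaleR_right summable_gram_term)
  qed
  show "norm (gram x) \<le> norm x * (\<bar>bu\<^sup>2 * (1 / \<alpha> + 1)\<bar> * schur_bound)" for x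
    using offdiag_kernel_bounded(3)[OF gram_term_bound, of x] by (simp add: gram_def mult_ac)
qed

interpretation gram: bounded_linear gram by (rule bounded_linear_gram)

definition coercivity :: real
  where "coercivity = exp (- \<alpha> * (6 * schur_bound + 2)) * bl\<^sup>2"

lemma coercivity_pos: "coercivity > 0"
  using bl_pos by (simp add: coercivity_def)

text \<open>
  For finite sections this is the inequality for trigonometric sums, with coefficients \<open>\<beta> j w\<^sub>j\<close>;
  the constant does not depend on the section.
\<close>

lemma gram_coercive: "coercivity * (norm w)\<^sup>2 \<le> gram w \<bullet> w"
proof -
  have fin: "coercivity * (norm (trunc N w))\<^sup>2 \<le> gram (trunc N w) \<bullet> trunc N w" for N
  proof -
    define u where "u j = of_real (\<beta> j) * coord w j" for j
    let ?E = "exp (- \<alpha> * (6 * schur_bound + 2))"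
    have "(\<lambda>k. if k \<in> {..<N} then (cmod (coord w k))\<^sup>2 else 0) sums (\<Sum>k<N. (cmod (coord w k))\<^sup>2)"
      by (rule sums_If_finite_set) simp
    then have n: "(norm (trunc N w))\<^sup>2 = (\<Sum>k<N. (cmod (coord w k))\<^sup>2)"
    proof (rule sums_unique2[rotated])
      have "(\<lambda>k. (cmod (coord (trunc N w) k))\<^sup>2) = (\<lambda>k. if k \<in> {..<N} then (cmod (coord w k))\<^sup>2 else 0)"
        by (auto simp: fun_eq_iff)
      then show "(\<lambda>k. if k \<in> {..<N} then (cmod (coord w k))\<^sup>2 else 0) sums (norm (trunc N w))\<^sup>2"
        using norm_ell2_sums[of "trunc N w"] by simp
    qed
    have "bl\<^sup>2 * (cmod (coord w k))\<^sup>2 \<le> (cmod (u k))\<^sup>2" for k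
      using bl[of k] bl_pos unfolding u_def norm_mult power_mult_distrib
      by (intro mult_right_mono power_mono) auto
    then have "coercivity * (norm (trunc N w))\<^sup>2 \<le> ?E * (\<Sum>k<N. (cmod (u k))\<^sup>2)"
      unfolding n coercivity_def mult.assoc sum_distrib_left by (intro sum_mono mult_left_mono) auto
    also have "\<dots> \<le> (\<Sum>k<N. \<Sum>j<N. Re (cnj (u k) * u j / (of_real \<alpha> - \<i> * of_real (freq k - freq j))) -
       Re (cnj (u k) * cnj (u j) / (of_real \<alpha> - \<i> * of_real (freq k + freq j)))) / 2"
      by (rule gram_form_coercive[OF alpha_pos])
    also have "\<dots> = (\<Sum>k<N. \<Sum>j<N. Re (cnj (coord w k) * gram_term w k j))"
    proof -
      have "(Re (cnj (u k) * u j / d) - Re (cnj (u k) * cnj (u j) / e)) / 2 =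
         Re (cnj (coord w k) * (of_real (\<beta> k * \<beta> j / 2) / d * coord w j - of_real (\<beta> k * \<beta> j / 2) / e * cnj (coord w j)))" for k j d e
      proof -
        have "cnj (coord w k) * (of_real (\<beta> k * \<beta> j / 2) / d * coord w j - of_real (\<beta> k * \<beta> j / 2) / e * cnj (coord w j))
          = (cnj (u k) * u j / d - cnj (u k) * cnj (u j) / e) / of_real 2"
          by (simp add: u_def field_simps diff_divide_distrib)
        then show ?thesis by (simp only: Re_divide_of_real minus_complex.sel)
      qed
      then show ?thesis
        by (simp only: sum_divide_distrib gram_term_def kern_def)
    qed
    also have "\<dots> = gram (trunc N w) \<bullet> trunc N w"
    proof -
      have t: "gram_term (trunc N w) k = (\<lambda>j. if j \<in> {..<N} then gram_term w k j else 0)" for k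
        by (auto simp: gram_term_def)
      have g: "coord (gram (trunc N w)) k = (\<Sum>j<N. gram_term w k j)" for k
        unfolding coord_gram t by (intro sums_unique[symmetric] sums_If_finite_set) simp
      have "(\<lambda>k. coord (gram (trunc N w)) k \<bullet> coord (trunc N w) k) =
          (\<lambda>k. if k \<in> {..<N} then (\<Sum>j<N. Re (cnj (coord w k) * gram_term w k j)) else 0)"
      proof
        fix k
        have "a \<bullet> b = Re (cnj b * a)" for a b :: complex by (simp add: inner_complex_def mult_ac)
        then show "coord (gram (trunc N w)) k \<bullet> coord (trunc N w) k =
          (if k \<in> {..<N} then (\<Sum>j<N. Re (cnj (coord w k) * gram_term w k j)) else 0)"
          by (simp only: g) (simp only: coord_trunc lessThan_iff split: if_split, simp add: sum_distrib_left)
      qed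
      then show ?thesis
        unfolding inner_ell2_def by (simp only:) (intro sums_unique sums_If_finite_set finite_lessThan)
    qed
    finally show ?thesis .
  qed
  show ?thesis
  proof (rule LIMSEQ_le)
    show "(\<lambda>N. coercivity * (norm (trunc N w))\<^sup>2) \<longlonglongrightarrow> coercivity * (norm w)\<^sup>2"
      by (intro tendsto_intros trunc_tendsto)
    show "(\<lambda>N. gram (trunc N w) \<bullet> trunc N w) \<longlonglongrightarrow> gram w \<bullet> w"
      by (intro tendsto_intros trunc_tendsto gram.tendsto)
    show "\<exists>N. \<forall>n\<ge>N. coercivity * (norm (trunc n w))\<^sup>2 \<le> gram (trunc n w) \<bullet> trunc n w"
      using fin by blast
  qed
qed

end

lemma coercive_norm_ge:
  fixes f :: "'a::real_inner \<Rightarrow> 'a"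
  assumes "c > 0" "c * (norm x)\<^sup>2 \<le> f x \<bullet> x"
  shows "c * norm x \<le> norm (f x)"
proof (cases "x = 0")
  case False
  have "c * (norm x)\<^sup>2 \<le> norm (f x) * norm x"
    using assms(2) norm_cauchy_schwarz[of "f x" x] by linarith
  then show ?thesis using False by (simp add: power2_eq_square)
qed simp

text \<open>The theorem of Lax and Milgram: \<open>x \<mapsto> x - \<rho> (f x - y)\<close> is a contraction for small \<open>\<rho>\<close>.\<close>

lemma coercive_surj:
  fixes f :: "'a::{real_inner, complete_space} \<Rightarrow> 'a"
  assumes "bounded_linear f" "c > 0" and co: "\<And>x. c * (norm x)\<^sup>2 \<le> f x \<bullet> x"
  shows "\<exists>x. f x = y"
proof -
  interpret bounded_linear f by fact
  obtain M where M: "M > 0" "\<And>x. norm (f x) \<le> norm x * M" using pos_bounded by blast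
  define \<rho> where "\<rho> = c / M\<^sup>2"
  define \<theta> where "\<theta> = sqrt (max 0 (1 - c\<^sup>2 / M\<^sup>2))"
  have \<rho>: "\<rho> > 0" using assms(2) M by (simp add: \<rho>_def)
  have \<theta>: "0 \<le> \<theta>" "\<theta> < 1" using assms(2) M by (simp_all add: \<theta>_def)
  have contr: "norm (x - \<rho> *\<^sub>R f x) \<le> \<theta> * norm x" for x
  proof (rule power2_le_imp_le)
    have "(norm (x - \<rho> *\<^sub>R f x))\<^sup>2 = (norm x)\<^sup>2 - 2 * \<rho> * (f x \<bullet> x) + \<rho>\<^sup>2 * (norm (f x))\<^sup>2"
      using dot_norm_neg[of x "\<rho> *\<^sub>R f x"] by (simp add: power_mult_distrib inner_commute algebra_simps)
    also have "\<dots> \<le> (norm x)\<^sup>2 - 2 * \<rho> * (c * (norm x)\<^sup>2) + \<rho>\<^sup>2 * (norm x * M)\<^sup>2"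
      using \<rho> by (intro add_mono diff_mono mult_left_mono co power_mono M) auto
    also have "\<dots> = (1 - c\<^sup>2 / M\<^sup>2) * (norm x)\<^sup>2"
      using M by (simp add: \<rho>_def field_simps power2_eq_square)
    also have "\<dots> \<le> max 0 (1 - c\<^sup>2 / M\<^sup>2) * (norm x)\<^sup>2"
      by (intro mult_right_mono) auto
    also have "\<dots> = (\<theta> * norm x)\<^sup>2" by (simp add: \<theta>_def power_mult_distrib)
    finally show "(norm (x - \<rho> *\<^sub>R f x))\<^sup>2 \<le> (\<theta> * norm x)\<^sup>2" .
  qed (use \<theta> in simp)
  have "\<exists>!x. x - \<rho> *\<^sub>R (f x - y) = x"
  proof (rule banach_fix_type[OF \<theta>], intro allI)
    fix x z
    have "(x - \<rho> *\<^sub>R (f x - y)) - (z - \<rho> *\<^sub>R (f z - y)) = (x - z) - \<rho> *\<^sub>R f (x - z)"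
      by (simp add: diff algebra_simps)
    then show "dist (x - \<rho> *\<^sub>R (f x - y)) (z - \<rho> *\<^sub>R (f z - y)) \<le> \<theta> * dist x z"
      by (simp only: dist_norm contr)
  qed
  then obtain x where "x - \<rho> *\<^sub>R (f x - y) = x" by blast
  then have "f x = y" using \<rho> by simp
  then show ?thesis by blast
qed

context gramian
begin

interpretation gram: bounded_linear gram by (rule bounded_linear_gram)

lemma gram_norm_ge: "coercivity * norm w \<le> norm (gram w)"
  by (rule coercive_norm_ge[OF coercivity_pos gram_coercive])

lemma bij_gram: "bij gram"
proof (rule bijI)
  show "surj gram"
    using coercive_surj[OF bounded_linear_gram coercivity_pos gram_coercive] by (metis surjI)
  show "inj gram"
  proof (rule injI)
    fix x y assume "gram x = gram y"
    then have "gram (x - y) = 0" by (simp add: gram.diff)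
    then have "coercivity * norm (x - y) \<le> 0" using gram_norm_ge[of "x - y"] by simp
    then show "x = y" using coercivity_pos by (simp add: mult_le_0_iff)
  qed
qed

definition gram_inv :: "ell2 \<Rightarrow> ell2"
  where "gram_inv = inv gram"

lemma gram_inv_gram [simp]: "gram_inv (gram w) = w"
  by (simp add: gram_inv_def bij_is_inj[OF bij_gram])

lemma gram_gram_inv [simp]: "gram (gram_inv w) = w"
  by (simp add: gram_inv_def bij_is_surj[OF bij_gram] surj_f_inv_f)

lemma bounded_linear_gram_inv: "bounded_linear gram_inv"
proof (rule bounded_linear_intro)
  show "gram_inv (x + y) = gram_inv x + gram_inv y" for x y
    by (metis gram.add gram_gram_inv gram_inv_gram)
  show "gram_inv (r *\<^sub>R x) = r *\<^sub>R gram_inv x" for r x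
    by (metis gram.scale gram_gram_inv gram_inv_gram)
  show "norm (gram_inv x) \<le> norm x * (1 / coercivity)" for x
    using gram_norm_ge[of "gram_inv x"] coercivity_pos by (simp add: field_simps)
qed

end

section \<open>The closed-loop semigroup on sequences\<close>

text \<open>
  Dominated convergence in \<open>ell2\<close>: outside a finite section the uniform bound makes the operators
  small, and inside it finitely many multipliers tend to zero.
\<close>

lemma diag_op_strong_zero:
  assumes M: "\<And>h n. h \<in> H \<Longrightarrow> cmod (s h n) \<le> M" and H: "\<forall>\<^sub>F h in F. h \<in> H"
    and lim: "\<And>n. ((\<lambda>h. s h n) \<longlongrightarrow> 0) F"
  shows "((\<lambda>h. diag_op (s h) w) \<longlongrightarrow> 0) F"
proof (rule tendstoI)
  fix e :: real assume "e > 0"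
  define M' where "M' = \<bar>M\<bar> + 1"
  have M': "cmod (s h n) \<le> M'" if "h \<in> H" for h n using M[OF that, of n] by (simp add: M'_def)
  have "M' > 0" by (simp add: M'_def)
  have "\<forall>\<^sub>F N in sequentially. dist (trunc N w) w < e / (2 * M')"
    using tendstoD[OF trunc_tendsto, of "e / (2 * M')" w] \<open>e > 0\<close> \<open>M' > 0\<close> by simp
  then obtain N where N: "norm (w - trunc N w) < e / (2 * M')"
    by (auto simp: eventually_sequentially dist_norm norm_minus_commute)
  have "((\<lambda>h. \<Sum>n<N. (cmod (s h n * coord w n))\<^sup>2) \<longlongrightarrow> (\<Sum>n<N. (cmod (0 * coord w n))\<^sup>2)) F"
    by (intro tendsto_intros lim)
  then have "((\<lambda>h. \<Sum>n<N. (cmod (s h n * coord w n))\<^sup>2) \<longlongrightarrow> 0) F" by simp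
  then have "\<forall>\<^sub>F h in F. (\<Sum>n<N. (cmod (s h n * coord w n))\<^sup>2) < (e / 2)\<^sup>2"
    using \<open>e > 0\<close> by (intro order_tendstoD(2)) auto
  with H show "\<forall>\<^sub>F h in F. dist (diag_op (s h) w) 0 < e"
  proof eventually_elim
    case (elim h)
    note b = M'[OF elim(1)]
    let ?x = "diag_op (s h) w"
    have "?x - trunc N ?x = diag_op (s h) (w - trunc N w)"
      by (rule ell2_eqI) (simp add: coord_diag_op[OF b])
    then have "norm (?x - trunc N ?x) \<le> M' * norm (w - trunc N w)"
      by (simp add: norm_diag_op_le[OF b])
    also have "\<dots> < e / 2" using N \<open>M' > 0\<close> by (simp add: field_simps)
    finally have "(norm (?x - trunc N ?x))\<^sup>2 < (e / 2)\<^sup>2" by (intro power_strict_mono) auto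
    then have "(norm ?x)\<^sup>2 < (e / 2)\<^sup>2 + (e / 2)\<^sup>2"
      using elim(2) by (simp add: norm_sub_trunc_sq coord_diag_op[OF b])
    also have "\<dots> \<le> e\<^sup>2" by (simp add: power2_eq_square field_simps)
    finally show ?case using \<open>e > 0\<close> by (simp add: power2_less_imp_less)
  qed
qed

lemma norm_exp_minus_one_le:
  assumes "Re z \<le> 0"
  shows "cmod (exp z - 1) \<le> cmod z"
proof -
  have "cmod (exp z - exp 0) \<le> 1 * cmod (z - 0)"
  proof (rule field_differentiable_bound[where S = "{z. Re z \<le> 0}" and f' = exp])
    show "convex {z. Re z \<le> 0}" by (rule convex_halfspace_Re_le)
    show "(exp has_field_derivative exp x) (at x within {z. Re z \<le> 0})" for x
      by (rule DERIV_subset[OF DERIV_exp]) simp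
  qed (use assms in auto)
  then show ?thesis by simp
qed

lemma exp_difference_quotient:
  fixes \<nu> :: complex
  shows "((\<lambda>h. (exp (\<nu> * of_real h) - 1) /\<^sub>R h) \<longlongrightarrow> \<nu>) (at_right 0)"
proof -
  have "((\<lambda>z. exp (\<nu> * z)) has_field_derivative \<nu>) (at 0)"
    by (auto intro!: derivative_eq_intros)
  then have "((\<lambda>z. (exp (\<nu> * z) - 1) / z) \<longlongrightarrow> \<nu>) (at 0)"
    by (simp add: DERIV_def)
  moreover have "filterlim complex_of_real (at 0) (at_right 0)"
    unfolding filterlim_at
    by (auto intro!: tendsto_eq_intros eventually_at_right_less[THEN eventually_mono])
  ultimately have "((\<lambda>h. (exp (\<nu> * of_real h) - 1) / complex_of_real h) \<longlongrightarrow> \<nu>) (at_right 0)"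
    by (rule filterlim_compose)
  then show ?thesis by (simp add: scaleR_conv_of_real divide_inverse mult.commute)
qed

text \<open>
  A generator gives derivatives from the right only. For \<open>e > 0\<close>, the set of times up to which \<open>f\<close>
  moves away from \<open>f 0\<close> with speed at most \<open>e\<close> is closed by continuity, and it extends to the right of
  each of its points by the hypothesis on the derivative.
\<close>

lemma right_derivative_zero_imp_const:
  fixes f :: "real \<Rightarrow> 'a::real_normed_vector"
  assumes cont: "continuous_on {0..} f" and "0 \<le> t"
    and rd: "\<And>s. 0 \<le> s \<Longrightarrow> ((\<lambda>h. (f (s + h) - f s) /\<^sub>R h) \<longlongrightarrow> 0) (at_right 0)"
  shows "f t = f 0"
proof -
  have small: "norm (f t - f 0) \<le> e * t" if "e > 0" for e
  proof -
    define A where "A = {s \<in> {0..t}. \<forall>r\<in>{0..s}. norm (f r - f 0) \<le> e * r}"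
    have "0 \<in> A" using \<open>0 \<le> t\<close> by (auto simp: A_def)
    have bdd: "bdd_above A" by (rule bdd_aboveI[of _ t]) (auto simp: A_def)
    define s where "s = Sup A"
    have s: "0 \<le> s" "s \<le> t"
    proof -
      show "0 \<le> s" unfolding s_def by (rule cSup_upper[OF \<open>0 \<in> A\<close> bdd])
      show "s \<le> t" unfolding s_def by (rule cSup_least) (use \<open>0 \<in> A\<close> in \<open>auto simp: A_def\<close>)
    qed
    have below: "norm (f r - f 0) \<le> e * r" if r: "0 \<le> r" "r < s" for r
    proof -
      obtain a where "a \<in> A" "r < a" using r(2) \<open>0 \<in> A\<close> bdd less_cSup_iff[of A r] unfolding s_def by auto
      then show ?thesis using r(1) by (auto simp: A_def)
    qed
    have at_s: "norm (f s - f 0) \<le> e * s"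
    proof (cases "s = 0")
      case False
      with s have "s > 0" by simp
      have "isCont f s"
        by (rule continuous_on_interior[OF cont]) (use \<open>s > 0\<close> in simp)
      then have "(f \<longlongrightarrow> f s) (at_left s)" by (simp add: isCont_def filterlim_at_split)
      then have "((\<lambda>r. e * r - norm (f r - f 0)) \<longlongrightarrow> e * s - norm (f s - f 0)) (at_left s)"
        by (intro tendsto_intros)
      moreover have "\<forall>\<^sub>F r in at_left s. 0 \<le> e * r - norm (f r - f 0)"
        using eventually_at_left_real[OF \<open>s > 0\<close>] by eventually_elim (use below in auto)
      ultimately show ?thesis using tendsto_lowerbound[of _ _ "at_left s" 0] by force
    qed simp
    have "s = t"
    proof (rule ccontr)
      assume "s \<noteq> t"
      with s have "s < t" by simp
      have "\<forall>\<^sub>F h in at_right 0. norm ((f (s + h) - f s) /\<^sub>R h) < e"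
        using tendstoD[OF rd[OF s(1)] \<open>e > 0\<close>] by simp
      then obtain d where d: "d > 0" "\<And>h. 0 < h \<Longrightarrow> h < d \<Longrightarrow> norm ((f (s + h) - f s) /\<^sub>R h) < e"
        unfolding eventually_at_right_field by auto
      define k where "k = min (d / 2) (t - s)"
      have k: "0 < k" "k < d" "s + k \<le> t" using d \<open>s < t\<close> by (auto simp: k_def)
      have "norm (f r - f 0) \<le> e * r" if "r \<in> {0..s + k}" for r
      proof (cases "r \<le> s")
        case True
        then show ?thesis using below[of r] at_s that by (cases "r = s") auto
      next
        case False
        then have "norm ((f (s + (r - s)) - f s) /\<^sub>R (r - s)) < e"
          using that k by (intro d) auto
        moreover have "s + (r - s) = r" by simp
        ultimately have "\<bar>inverse (r - s)\<bar> * norm (f r - f s) < e"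
          by (simp only: norm_scaleR)
        then have "norm (f r - f s) / (r - s) < e"
          using False by (simp add: divide_inverse mult.commute)
        then have "norm (f r - f s) \<le> e * (r - s)" using False by (simp add: pos_divide_less_eq)
        moreover have "norm (f r - f 0) \<le> norm (f r - f s) + norm (f s - f 0)"
          using norm_triangle_ineq[of "f r - f s" "f s - f 0"] by simp
        ultimately show ?thesis using at_s by (simp add: algebra_simps)
      qed
      then have "s + k \<in> A" using k s by (auto simp: A_def)
      then have "s + k \<le> s" unfolding s_def using bdd by (rule cSup_upper)
      then show False using k by simp
    qed
    then show ?thesis using at_s by simp
  qed
  have "norm (f t - f 0) \<le> 0"
  proof (rule field_le_epsilon)
    fix e :: real assume "0 < e"
    have "e / (t + 1) * t \<le> e" using \<open>0 < e\<close> \<open>0 \<le> t\<close> by (simp add: field_simps)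
    then show "norm (f t - f 0) \<le> 0 + e"
      using small[of "e / (t + 1)"] \<open>0 < e\<close> \<open>0 \<le> t\<close> by simp
  qed
  then show ?thesis by simp
qed

definition seq_semigroup :: "(real \<Rightarrow> ell2 \<Rightarrow> ell2) \<Rightarrow> bool"
  where "seq_semigroup T \<longleftrightarrow> (\<forall>t\<ge>0. bounded_linear (T t)) \<and> (\<forall>w. T 0 w = w) \<and>
    (\<forall>s\<ge>0. \<forall>t\<ge>0. \<forall>w. T (s + t) w = T s (T t w)) \<and>
    (\<forall>t\<ge>0. \<forall>w. ((\<lambda>s. T s w) \<longlongrightarrow> T t w) (at t within {0..}))"

definition seq_generator :: "(real \<Rightarrow> ell2 \<Rightarrow> ell2) \<Rightarrow> ell2 \<Rightarrow> ell2 \<Rightarrow> bool"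
  where "seq_generator T z p \<longleftrightarrow> ((\<lambda>h. (T h z - z) /\<^sub>R h) \<longlongrightarrow> p) (at_right 0)"

context gramian
begin

interpretation gram: bounded_linear gram by (rule bounded_linear_gram)
interpretation gram_inv: bounded_linear gram_inv by (rule bounded_linear_gram_inv)

definition rate :: "nat \<Rightarrow> complex"
  where "rate n = of_real \<alpha> + \<i> * of_real (freq n)"

lemma rate_nz [simp]: "rate n \<noteq> 0"
  using alpha_pos by (auto simp: rate_def complex_eq_iff)

lemma rate_bounds: "freq n \<le> cmod (rate n)" "cmod (rate n) \<le> (\<alpha> + 1) * freq n"
proof -
  show "freq n \<le> cmod (rate n)" using abs_Im_le_cmod[of "rate n"] by (simp add: rate_def)
  have "cmod (rate n) \<le> \<alpha> + freq n"
    using norm_triangle_ineq[of "complex_of_real \<alpha>" "\<i> * of_real (freq n)"] alpha_pos freq_pos[of n]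
    by (simp add: rate_def norm_mult)
  also have "\<dots> \<le> (\<alpha> + 1) * freq n" using alpha_pos freq_ge_1[of n] by (simp add: algebra_simps)
  finally show "cmod (rate n) \<le> (\<alpha> + 1) * freq n" .
qed

text \<open>
  The damped free evolution \<open>exp (- \<alpha> t) U(t)\<close>, to which the closed loop is conjugate.
\<close>

definition flow :: "real \<Rightarrow> ell2 \<Rightarrow> ell2"
  where "flow t = diag_op (\<lambda>n. exp (- rate n * of_real t))"

lemma norm_exp_rate: "cmod (exp (- rate n * of_real t)) = exp (- \<alpha> * t)"
  by (simp add: norm_exp_eq_Re rate_def)

lemma coord_flow: "coord (flow t w) n = exp (- rate n * of_real t) * coord w n"
  and norm_flow: "norm (flow t w) \<le> exp (- \<alpha> * t) * norm w"
  and bounded_linear_flow: "bounded_linear (flow t)"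
proof -
  have b: "cmod (exp (- rate n * of_real t)) \<le> exp (- \<alpha> * t)" for n by (simp only: norm_exp_rate)
  show "coord (flow t w) n = exp (- rate n * of_real t) * coord w n"
    unfolding flow_def by (rule coord_diag_op[OF b])
  show "norm (flow t w) \<le> exp (- \<alpha> * t) * norm w"
    unfolding flow_def by (rule norm_diag_op_le[OF b])
  show "bounded_linear (flow t)"
    unfolding flow_def by (rule bounded_linear_diag_op[OF b])
qed

lemma flow_continuous:
  assumes "t \<ge> 0"
  shows "((\<lambda>s. flow s w) \<longlongrightarrow> flow t w) (at t within {0..})"
proof -
  let ?s = "\<lambda>s n. exp (- rate n * of_real s) - exp (- rate n * of_real t)"
  have b: "cmod (?s s n) \<le> 2" if "s \<in> {0..}" for s n
  proof -
    have "cmod (?s s n) \<le> exp (- \<alpha> * s) + exp (- \<alpha> * t)"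
      by (rule norm_triangle_ineq4[THEN order_trans]) (simp only: norm_exp_rate)
    also have "\<dots> \<le> 1 + 1" using that assms alpha_pos by (intro add_mono) auto
    finally show ?thesis by simp
  qed
  have "((\<lambda>s. diag_op (?s s) w) \<longlongrightarrow> 0) (at t within {0..})"
  proof (rule diag_op_strong_zero[OF b])
    show "\<forall>\<^sub>F s in at t within {0..}. s \<in> {0..}" by (auto simp: eventually_at_filter)
    show "((\<lambda>s. ?s s n) \<longlongrightarrow> 0) (at t within {0..})" for n
      by (auto intro!: tendsto_eq_intros)
  qed
  then have "((\<lambda>s. flow s w - flow t w) \<longlongrightarrow> 0) (at t within {0..})"
  proof (rule Lim_transform_eventually)
    show "\<forall>\<^sub>F s in at t within {0..}. diag_op (?s s) w = flow s w - flow t w"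
      unfolding eventually_at_filter
    proof (intro always_eventually allI impI ell2_eqI)
      fix s :: real and n assume s: "s \<in> {0..}"
      show "coord (diag_op (?s s) w) n = coord (flow s w - flow t w) n"
        unfolding coord_diag_op[OF b[OF s]] by (simp add: coord_flow algebra_simps)
    qed
  qed
  then show ?thesis by (rule Lim_null[THEN iffD2])
qed

definition closed_loop :: "real \<Rightarrow> ell2 \<Rightarrow> ell2"
  where "closed_loop t w = gram (flow t (gram_inv w))"

lemma seq_semigroup_closed_loop: "seq_semigroup closed_loop"
  unfolding seq_semigroup_def
proof (intro conjI allI impI)
  show "bounded_linear (closed_loop t)" for t
    unfolding closed_loop_def
    by (intro bounded_linear_compose[OF bounded_linear_gram] bounded_linear_compose[OF bounded_linear_flow] bounded_linear_gram_inv)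
  have "flow 0 w = w" for w by (rule ell2_eqI) (simp add: coord_flow)
  then show "closed_loop 0 w = w" for w by (simp add: closed_loop_def)
  have "flow (s + t) w = flow s (flow t w)" for s t w
    by (rule ell2_eqI) (simp add: coord_flow algebra_simps exp_add[symmetric])
  then show "closed_loop (s + t) w = closed_loop s (closed_loop t w)" for s t w
    by (simp add: closed_loop_def)
  show "((\<lambda>s. closed_loop s w) \<longlongrightarrow> closed_loop t w) (at t within {0..})" if "t \<ge> 0" for t w
    unfolding closed_loop_def by (intro gram.tendsto flow_continuous that)
qed

lemma closed_loop_decay: "\<exists>C>0. \<forall>t w. norm (closed_loop t w) \<le> C * exp (- \<alpha> * t) * norm w"
proof -
  obtain A where A: "A > 0" "\<And>w. norm (gram w) \<le> norm w * A" using gram.pos_bounded by blast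
  obtain B where B: "B > 0" "\<And>w. norm (gram_inv w) \<le> norm w * B" using gram_inv.pos_bounded by blast
  have "norm (closed_loop t w) \<le> (A * B) * exp (- \<alpha> * t) * norm w" for t w
  proof -
    have "norm (closed_loop t w) \<le> norm (flow t (gram_inv w)) * A" unfolding closed_loop_def by (rule A)
    also have "\<dots> \<le> (exp (- \<alpha> * t) * (norm w * B)) * A"
      using A(1) by (intro mult_right_mono order_trans[OF norm_flow] mult_left_mono B) auto
    finally show ?thesis by (simp add: mult_ac)
  qed
  then show ?thesis using A(1) B(1) by (intro exI[of _ "A * B"]) auto
qed

text \<open>
  The graph of the closed-loop generator. It is the conjugate under \<open>gram\<close> of the multiplication by
  \<open>- rate\<close> on its maximal domain; a square-summable image \<open>p\<close> encodes that \<open>z\<close> is in the domain.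
\<close>

definition gen_rel :: "ell2 \<Rightarrow> ell2 \<Rightarrow> bool"
  where "gen_rel z p \<longleftrightarrow> (\<forall>n. coord (gram_inv p) n = - rate n * coord (gram_inv z) n)"

text \<open>
  If the difference quotients converge, they do so in each coordinate, which gives the equation.
  Conversely, if \<open>q = - rate * y\<close> is square-summable, then the quotients are \<open>q\<close> times multipliers that
  are bounded by 1 and tend to 1.
\<close>

lemma seq_generator_flow:
  "seq_generator flow y q \<longleftrightarrow> (\<forall>n. coord q n = - rate n * coord y n)"
proof
  assume "seq_generator flow y q"
  then have lim: "((\<lambda>h. coord ((flow h y - y) /\<^sub>R h) n) \<longlongrightarrow> coord q n) (at_right 0)" for n
    unfolding seq_generator_def by (rule tendsto_coord)
  show "\<forall>n. coord q n = - rate n * coord y n"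
  proof
    fix n
    have quotient: "coord ((flow h y - y) /\<^sub>R h) n = (exp (- rate n * of_real h) - 1) /\<^sub>R h * coord y n" for h
      by (simp add: coord_flow algebra_simps)
    have "((\<lambda>h. (exp (- rate n * of_real h) - 1) /\<^sub>R h * coord y n) \<longlongrightarrow> coord q n) (at_right 0)"
      using lim[of n] unfolding quotient .
    moreover have "((\<lambda>h. (exp (- rate n * of_real h) - 1) /\<^sub>R h * coord y n) \<longlongrightarrow> - rate n * coord y n) (at_right 0)"
      by (intro tendsto_mult_right exp_difference_quotient)
    ultimately show "coord q n = - rate n * coord y n"
      by (rule tendsto_unique[OF trivial_limit_at_right_real])
  qed
next
  assume q: "\<forall>n. coord q n = - rate n * coord y n"
  let ?s = "\<lambda>h n. (exp (- rate n * of_real h) - 1) /\<^sub>R h / (- rate n) - 1"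
  have b: "cmod (?s h n) \<le> 2" if "h \<in> {0<..}" for h n
  proof -
    have "cmod ((exp (- rate n * of_real h) - 1) /\<^sub>R h / (- rate n)) \<le> 1"
    proof -
      have "cmod (exp (- rate n * of_real h) - 1) \<le> cmod (- rate n * of_real h)"
        using that alpha_pos by (intro norm_exp_minus_one_le) (simp add: rate_def)
      then have "cmod (exp (- rate n * of_real h) - 1) / (h * cmod (rate n)) \<le> 1"
        using that by (simp add: norm_mult mult.commute)
      moreover have "cmod ((exp (- rate n * of_real h) - 1) /\<^sub>R h / (- rate n))
          = cmod (exp (- rate n * of_real h) - 1) / (h * cmod (rate n))"
        using that by (simp only: norm_divide norm_scaleR norm_minus_cancel) (simp add: divide_inverse)
      ultimately show ?thesis by simp
    qed
    then show ?thesis using norm_triangle_ineq4[of "(exp (- rate n * of_real h) - 1) /\<^sub>R h / (- rate n)" 1] by simp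
  qed
  have "((\<lambda>h. diag_op (?s h) q) \<longlongrightarrow> 0) (at_right 0)"
  proof (rule diag_op_strong_zero[OF b])
    show "\<forall>\<^sub>F h in at_right 0. h \<in> {0::real<..}" by (auto simp: eventually_at_filter)
    have "((\<lambda>h. ?s h n) \<longlongrightarrow> - rate n / (- rate n) - 1) (at_right 0)" for n
      by (intro tendsto_diff tendsto_divide exp_difference_quotient tendsto_const) simp
    then show "((\<lambda>h. ?s h n) \<longlongrightarrow> 0) (at_right 0)" for n by simp
  qed
  then have "((\<lambda>h. (flow h y - y) /\<^sub>R h - q) \<longlongrightarrow> 0) (at_right 0)"
  proof (rule Lim_transform_eventually)
    show "\<forall>\<^sub>F h in at_right 0. diag_op (?s h) q = (flow h y - y) /\<^sub>R h - q"
      unfolding eventually_at_filter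
    proof (intro always_eventually allI impI ell2_eqI)
      fix h :: real and n assume h: "h \<in> {0<..}"
      have 1: "(x / (- r) - 1) * (- r * w) = x * w - (- r * w)" if "r \<noteq> 0" for x r w :: complex
        using that by (simp add: left_diff_distrib)
      have 2: "(e - 1) /\<^sub>R h * w = (e * w - w) /\<^sub>R h" for e w :: complex
        by (simp add: algebra_simps)
      have "coord (diag_op (?s h) q) n = ?s h n * (- rate n * coord y n)"
        unfolding coord_diag_op[OF b[OF h]] using q by simp
      also have "\<dots> = (exp (- rate n * of_real h) * coord y n - coord y n) /\<^sub>R h - (- rate n * coord y n)"
        unfolding 1[OF rate_nz] 2 ..
      also have "\<dots> = coord ((flow h y - y) /\<^sub>R h - q) n"
        using q by (simp add: coord_flow)
      finally show "coord (diag_op (?s h) q) n = coord ((flow h y - y) /\<^sub>R h - q) n" .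
    qed
  qed
  then show "seq_generator flow y q" unfolding seq_generator_def by (rule Lim_null[THEN iffD2])
qed

lemma seq_generator_closed_loop: "seq_generator closed_loop z p \<longleftrightarrow> gen_rel z p"
proof -
  have "seq_generator closed_loop z p \<longleftrightarrow> seq_generator flow (gram_inv z) (gram_inv p)"
  proof
    assume "seq_generator closed_loop z p"
    from gram_inv.tendsto[OF this[unfolded seq_generator_def]]
    show "seq_generator flow (gram_inv z) (gram_inv p)"
      by (simp add: seq_generator_def closed_loop_def gram_inv.scale gram_inv.diff)
  next
    assume "seq_generator flow (gram_inv z) (gram_inv p)"
    from gram.tendsto[OF this[unfolded seq_generator_def]]
    show "seq_generator closed_loop z p"
      by (simp add: seq_generator_def closed_loop_def gram.scale gram.diff)
  qed
  then show ?thesis by (simp add: seq_generator_flow gen_rel_def)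
qed

text \<open>
  A semigroup is determined by its generator: along an orbit that starts in the domain, each coordinate of \<open>gram_inv (T t z)\<close> solves a scalar linear
  differential equation from the right, and the domain is dense.
\<close>

lemma closed_loop_unique:
  assumes T: "seq_semigroup T" and gen: "\<And>z p. seq_generator T z p \<longleftrightarrow> gen_rel z p" and "0 \<le> t"
  shows "T t w = closed_loop t w"
proof -
  have T_bl: "bounded_linear (T s)" if "s \<ge> 0" for s using T that by (simp add: seq_semigroup_def)
  have T_0: "T 0 w = w" for w using T by (simp add: seq_semigroup_def)
  have T_add: "T (r + s) w = T r (T s w)" if "r \<ge> 0" "s \<ge> 0" for r s w
    using T that by (simp add: seq_semigroup_def)
  have T_cont: "((\<lambda>s. T s w) \<longlongrightarrow> T s w) (at s within {0..})" if "s \<ge> 0" for s w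
    using T that by (simp add: seq_semigroup_def)
  have invar: "gen_rel (T s z) (T s p)" if "gen_rel z p" "s \<ge> 0" for s z p
  proof -
    interpret Ts: bounded_linear "T s" by (rule T_bl[OF \<open>s \<ge> 0\<close>])
    have "((\<lambda>h. T s ((T h z - z) /\<^sub>R h)) \<longlongrightarrow> T s p) (at_right 0)"
      using that(1) gen[of z p] unfolding seq_generator_def by (intro Ts.tendsto) simp
    then have "((\<lambda>h. (T h (T s z) - T s z) /\<^sub>R h) \<longlongrightarrow> T s p) (at_right 0)"
    proof (rule Lim_transform_eventually)
      show "\<forall>\<^sub>F h in at_right 0. T s ((T h z - z) /\<^sub>R h) = (T h (T s z) - T s z) /\<^sub>R h"
        unfolding eventually_at_filter
      proof (intro always_eventually allI impI)
        fix h :: real assume "h \<in> {0<..}"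
        then show "T s ((T h z - z) /\<^sub>R h) = (T h (T s z) - T s z) /\<^sub>R h"
          using T_add[of s h z] T_add[of h s z] \<open>s \<ge> 0\<close> by (simp add: Ts.scale Ts.diff add.commute)
      qed
    qed
    then show ?thesis using gen by (simp add: seq_generator_def)
  qed
  have on_dom: "T t z = closed_loop t z" if "gen_rel z p" for z p
  proof -
    have "coord (gram_inv (T t z)) n = coord (flow t (gram_inv z)) n" for n
    proof -
      define v where "v s = coord (gram_inv (T s z)) n" for s
      define f where "f s = exp (rate n * of_real s) * v s" for s
      have v_cont: "(v \<longlongrightarrow> v s) (at s within {0..})" if "s \<ge> 0" for s
        unfolding v_def by (intro tendsto_coord gram_inv.tendsto T_cont that)
      have "f t = f 0"
      proof (rule right_derivative_zero_imp_const[OF _ \<open>0 \<le> t\<close>])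
        show "continuous_on {0..} f"
          unfolding continuous_on_def f_def by (intro ballI tendsto_intros v_cont) auto
        fix s :: real assume s: "0 \<le> s"
        have "seq_generator T (T s z) (T s p)" using invar[OF that s] gen by simp
        then have "((\<lambda>h. coord (gram_inv ((T h (T s z) - T s z) /\<^sub>R h)) n) \<longlongrightarrow> coord (gram_inv (T s p)) n) (at_right 0)"
          unfolding seq_generator_def by (intro tendsto_coord gram_inv.tendsto)
        moreover have "coord (gram_inv (T s p)) n = - rate n * v s"
          using invar[OF that s] by (simp add: gen_rel_def v_def)
        ultimately have lim1: "((\<lambda>h. coord (gram_inv ((T h (T s z) - T s z) /\<^sub>R h)) n) \<longlongrightarrow> - rate n * v s) (at_right 0)"
          by simp
        have lim2: "((\<lambda>h. v (s + h)) \<longlongrightarrow> v s) (at_right 0)"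
        proof -
          have "(v \<longlongrightarrow> v s) (at_right s)"
            using v_cont[OF s] by (rule tendsto_within_subset) (use s in auto)
          then show ?thesis by (subst (asm) at_right_to_0) (simp add: filterlim_filtermap add.commute)
        qed
        have "((\<lambda>h. exp (rate n * of_real s) * ((exp (rate n * of_real h) - 1) /\<^sub>R h * v (s + h)
            + coord (gram_inv ((T h (T s z) - T s z) /\<^sub>R h)) n)) \<longlongrightarrow>
            exp (rate n * of_real s) * (rate n * v s + - rate n * v s)) (at_right 0)"
          by (intro tendsto_mult tendsto_add tendsto_const exp_difference_quotient lim1 lim2)
        then have lim3: "((\<lambda>h. exp (rate n * of_real s) * ((exp (rate n * of_real h) - 1) /\<^sub>R h * v (s + h)
            + coord (gram_inv ((T h (T s z) - T s z) /\<^sub>R h)) n)) \<longlongrightarrow> 0) (at_right 0)"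
          by simp
        show "((\<lambda>h. (f (s + h) - f s) /\<^sub>R h) \<longlongrightarrow> 0) (at_right 0)"
        proof (rule Lim_transform_eventually[OF lim3])
          show "\<forall>\<^sub>F h in at_right 0. exp (rate n * of_real s) * ((exp (rate n * of_real h) - 1) /\<^sub>R h * v (s + h)
            + coord (gram_inv ((T h (T s z) - T s z) /\<^sub>R h)) n) = (f (s + h) - f s) /\<^sub>R h"
            unfolding eventually_at_filter
          proof (intro always_eventually allI impI)
            fix h :: real assume "h \<in> {0<..}"
            then have quotient: "coord (gram_inv ((T h (T s z) - T s z) /\<^sub>R h)) n = (v (s + h) - v s) /\<^sub>R h"
              using T_add[of h s z] s by (simp add: gram_inv.scale gram_inv.diff v_def add.commute)
            show "exp (rate n * of_real s) * ((exp (rate n * of_real h) - 1) /\<^sub>R h * v (s + h)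
              + coord (gram_inv ((T h (T s z) - T s z) /\<^sub>R h)) n) = (f (s + h) - f s) /\<^sub>R h"
              unfolding quotient by (simp add: f_def scaleR_conv_of_real algebra_simps exp_add)
          qed
        qed
      qed
      then have "exp (- rate n * of_real t) * (exp (rate n * of_real t) * v t) = exp (- rate n * of_real t) * v 0"
        by (simp add: f_def)
      then have "v t = exp (- rate n * of_real t) * v 0"
        by (simp add: mult.assoc[symmetric] exp_minus)
      then show ?thesis by (simp add: v_def coord_flow T_0)
    qed
    then have "gram_inv (T t z) = flow t (gram_inv z)" by (rule ell2_eqI)
    then show ?thesis unfolding closed_loop_def by (metis gram_gram_inv)
  qed
  define z where "z N = gram (trunc N (gram_inv w))" for N
  have z_dom: "\<exists>p. gen_rel (z N) p" for N
  proof -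
    have "\<exists>q. \<forall>n. coord q n = - rate n * coord (trunc N (gram_inv w)) n"
    proof (intro exI allI)
      fix n
      let ?x = "\<lambda>n. - rate n * coord (trunc N (gram_inv w)) n"
      have "summable (\<lambda>n. (cmod (?x n))\<^sup>2)"
        by (rule summable_finite[of "{..<N}"]) auto
      then show "coord (mk_ell2 ?x) n = - rate n * coord (trunc N (gram_inv w)) n"
        by (simp add: coord_mk_ell2)
    qed
    then obtain q where "\<forall>n. coord q n = - rate n * coord (trunc N (gram_inv w)) n" by blast
    then have "gen_rel (z N) (gram q)" by (simp add: gen_rel_def z_def)
    then show ?thesis by blast
  qed
  have "z \<longlonglongrightarrow> gram (gram_inv w)" unfolding z_def by (intro gram.tendsto trunc_tendsto)
  then have zw: "z \<longlonglongrightarrow> w" by simp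
  have "(\<lambda>N. T t (z N)) \<longlonglongrightarrow> T t w" by (rule bounded_linear.tendsto[OF T_bl[OF \<open>0 \<le> t\<close>] zw])
  moreover have "(\<lambda>N. T t (z N)) \<longlonglongrightarrow> closed_loop t w"
  proof -
    have "bounded_linear (closed_loop t)" using seq_semigroup_closed_loop \<open>0 \<le> t\<close> by (simp add: seq_semigroup_def)
    from bounded_linear.tendsto[OF this zw] have "(\<lambda>N. closed_loop t (z N)) \<longlonglongrightarrow> closed_loop t w" .
    moreover have "T t (z N) = closed_loop t (z N)" for N using z_dom on_dom by blast
    ultimately show ?thesis by simp
  qed
  ultimately show ?thesis by (rule LIMSEQ_unique)
qed

end

section \<open>The feedback on sequences\<close>

lemma inv_freq_le: "1 / freq n \<le> 1 / (1 + (real n)\<^sup>2)"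
proof (rule divide_left_mono)
  have "1 + (real n)\<^sup>2 \<le> (real (Suc n))\<^sup>2 * 1" by (simp add: power2_eq_square algebra_simps)
  also have "\<dots> \<le> (real (Suc n))\<^sup>2 * pi\<^sup>2" by (intro mult_left_mono pi_sq_ge_1) auto
  finally show "1 + (real n)\<^sup>2 \<le> freq n" by (simp add: freq_def eigval_def power_mult_distrib)
qed (auto intro!: mult_pos_pos simp: freq_pos add_pos_nonneg)

lemma summable_inv_freq: "summable (\<lambda>n. 1 / freq n)"
  by (rule summable_comparison_test'[OF summable_inv_1_sq])
    (use inv_freq_le less_imp_le[OF freq_pos] in simp)

lemma summable_inv_freq_sq: "summable (\<lambda>n. (1 / freq n)\<^sup>2)"
proof (rule summable_comparison_test'[OF summable_inv_freq])
  fix n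
  have "(1 / freq n) * (1 / freq n) \<le> 1 / freq n * 1"
    using freq_pos[of n] freq_ge_1[of n] by (intro mult_left_mono) auto
  then show "norm ((1 / freq n)\<^sup>2) \<le> 1 / freq n" by (simp add: power2_eq_square)
qed

context gramian
begin

interpretation gram: bounded_linear gram by (rule bounded_linear_gram)
interpretation gram_inv: bounded_linear gram_inv by (rule bounded_linear_gram_inv)

text \<open>
  The feedback \<open>- B\<^sup>* y\<close>, as a function of \<open>y = gram_inv z\<close> for the state \<open>z\<close>. The series need not converge
  for all \<open>y\<close> in \<open>ell2\<close>; it does when \<open>rate * y\<close> is square-summable.
\<close>

definition control :: "ell2 \<Rightarrow> real"
  where "control y = - (\<Sum>j. \<beta> j * Im (coord y j))"

lemma summable_control:
  assumes q: "\<And>n. coord q n = - rate n * coord y n"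
  shows "summable (\<lambda>j. \<beta> j * Im (coord y j))"
proof (rule summable_comparison_test')
  show "summable (\<lambda>n. bu * ((1 / freq n)\<^sup>2 + (cmod (coord q n))\<^sup>2))"
    by (intro summable_mult summable_add summable_inv_freq_sq summable_coord)
  fix n
  have "cmod (coord y n) = (1 / cmod (rate n)) * cmod (coord q n)"
    by (simp add: q norm_mult)
  also have "\<dots> \<le> (1 / freq n) * cmod (coord q n)"
    using rate_bounds(1)[of n] freq_pos[of n] by (intro mult_right_mono divide_left_mono) auto
  also have "\<dots> \<le> (1 / freq n)\<^sup>2 + (cmod (coord q n))\<^sup>2"
  proof -
    have "0 \<le> (1 / freq n) * cmod (coord q n)" using freq_pos[of n] by simp
    then show ?thesis using sum_squares_bound[of "1 / freq n" "cmod (coord q n)"] by linarith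
  qed
  finally have "\<bar>Im (coord y n)\<bar> \<le> (1 / freq n)\<^sup>2 + (cmod (coord q n))\<^sup>2"
    using abs_Im_le_cmod order_trans by blast
  then show "norm (\<beta> n * Im (coord y n)) \<le> bu * ((1 / freq n)\<^sup>2 + (cmod (coord q n))\<^sup>2)"
    using bu[of n] bu_nonneg by (simp only: real_norm_def abs_mult) (intro mult_mono; simp)
qed

text \<open>
  The Lyapunov equation of the Gramian, \<open>A gram - gram (A - \<alpha>) = B B\<^sup>*\<close> with \<open>A = - \<i> freq\<close>. Each entry of
  \<open>gram\<close> is a quotient whose denominator is exactly the factor by which the two sides differ. It says
  that the feedback \<open>- B\<^sup>* gram_inv\<close> conjugates the closed loop to \<open>A - \<alpha>\<close>.
\<close>

lemma gram_commutator:
  assumes q: "\<And>n. coord q n = - rate n * coord y n"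
  shows "coord (gram q) k = - \<i> * of_real (freq k) * coord (gram y) k + \<i> * of_real (\<beta> k) * of_real (control y)"
proof -
  have "gram_term q k j = - \<i> * of_real (freq k) * gram_term y k j
      - \<i> * of_real (\<beta> k) * of_real (\<beta> j * Im (coord y j))" for j
  proof -
    let ?d = "complex_of_real \<alpha> - \<i> * of_real (freq k - freq j)"
    let ?e = "complex_of_real \<alpha> - \<i> * of_real (freq k + freq j)"
    let ?b = "complex_of_real (\<beta> k * \<beta> j / 2)"
    have r: "rate j = ?d + \<i> * of_real (freq k)" "cnj (rate j) = ?e + \<i> * of_real (freq k)"
      by (simp_all add: rate_def algebra_simps)
    have "gram_term q k j = - (?b / ?d * ?d * coord y j) + ?b / ?e * ?e * cnj (coord y j)
        - \<i> * of_real (freq k) * gram_term y k j"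
    proof -
      have "P * (- (d + F) * y) - Q * (- (e + F) * z) = - (P * d * y) + Q * e * z - F * (P * y - Q * z)"
        for P Q d e F y z :: complex by (simp add: algebra_simps)
      then show ?thesis
        unfolding gram_term_def kern_def q complex_cnj_mult complex_cnj_minus r(2) unfolding r(1) .
    qed
    also have "?b / ?d * ?d = ?b" by (metis denominator_nz nonzero_divide_eq_eq)
    also have "?b / ?e * ?e = ?b" by (metis denominator_nz nonzero_divide_eq_eq)
    also have "- (?b * coord y j) + ?b * cnj (coord y j) = - (?b * (coord y j - cnj (coord y j)))"
      by (simp only: right_diff_distrib minus_diff_eq uminus_add_conv_diff)
    also have "coord y j - cnj (coord y j) = 2 * \<i> * of_real (Im (coord y j))"
      by (simp add: complex_eq_iff)
    also have "- (?b * (2 * \<i> * of_real (Im (coord y j)))) - \<i> * of_real (freq k) * gram_term y k j =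
        - \<i> * of_real (freq k) * gram_term y k j - \<i> * of_real (\<beta> k) * of_real (\<beta> j * Im (coord y j))"
      by (simp add: algebra_simps)
    finally show ?thesis .
  qed
  then have "coord (gram q) k = (\<Sum>j. - \<i> * of_real (freq k) * gram_term y k j
      - \<i> * of_real (\<beta> k) * of_real (\<beta> j * Im (coord y j)))"
    by (simp add: coord_gram)
  also have "\<dots> = (\<Sum>j. - \<i> * of_real (freq k) * gram_term y k j)
      - (\<Sum>j. \<i> * of_real (\<beta> k) * of_real (\<beta> j * Im (coord y j)))"
    by (intro suminf_diff[symmetric] summable_mult summable_gram_term summable_of_real summable_control[OF q])
  also have "(\<Sum>j. - \<i> * of_real (freq k) * gram_term y k j) = - \<i> * of_real (freq k) * coord (gram y) k"
    unfolding coord_gram by (rule suminf_mult[OF summable_gram_term])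
  also have "(\<Sum>j. \<i> * of_real (\<beta> k) * of_real (\<beta> j * Im (coord y j))) = \<i> * of_real (\<beta> k) * of_real (\<Sum>j. \<beta> j * Im (coord y j))"
    by (subst suminf_mult[OF summable_of_real[OF summable_control[OF q]]])
      (simp only: suminf_of_real[OF summable_control[OF q]])
  finally show ?thesis by (simp add: control_def)
qed

text \<open>
  The state that is kept at rest by the constant control \<open>v = 1\<close>.
\<close>

definition static :: ell2
  where "static = mk_ell2 (\<lambda>n. of_real (\<beta> n / freq n))"

lemma coord_static: "coord static n = of_real (\<beta> n / freq n)"
proof -
  have "summable (\<lambda>n. (cmod (of_real (\<beta> n / freq n)))\<^sup>2)"
  proof (rule square_summable_comparison)
    show "summable (\<lambda>n. (cmod (of_real (1 / freq n)))\<^sup>2)"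
      using summable_inv_freq_sq by (simp only: norm_of_real power2_abs)
    show "cmod (of_real (\<beta> n / freq n)) \<le> bu * cmod (of_real (1 / freq n))" for n
      using bu[of n] freq_pos[of n]
      by (simp only: norm_of_real abs_divide) (simp add: divide_right_mono)
  qed
  then show ?thesis by (simp only: static_def coord_mk_ell2)
qed

text \<open>
  The range of the control operator meets \<open>ell2\<close> only in 0, as \<open>\<beta>\<close> is bounded below. Hence a state
  admits at most one control value for which the equation makes sense in \<open>ell2\<close>.
\<close>

lemma const_times_beta_square_summable:
  assumes "summable (\<lambda>n. (cmod (c * of_real (\<beta> n)))\<^sup>2)"
  shows "c = 0"
proof -
  have lim: "(\<lambda>n. (cmod (c * of_real (\<beta> n)))\<^sup>2) \<longlonglongrightarrow> 0" by (rule summable_LIMSEQ_zero[OF assms])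
  have "(cmod c * bl)\<^sup>2 \<le> (cmod (c * of_real (\<beta> n)))\<^sup>2" for n
    using bl[of n] bl_pos by (intro power_mono) (auto simp: norm_mult intro: mult_left_mono)
  then have "(cmod c * bl)\<^sup>2 \<le> 0" by (intro LIMSEQ_le_const[OF lim]) blast
  then show ?thesis using bl_pos by simp
qed

text \<open>
  At \<open>static\<close> the only possible control value is 1, for which the closed-loop operator vanishes there;
  but the closed-loop generator is injective.
\<close>

lemma static_not_in_domain: "\<not> gen_rel static p"
proof
  assume "gen_rel static p"
  then have q: "coord (gram_inv p) n = - rate n * coord (gram_inv static) n" for n
    by (simp add: gen_rel_def)
  let ?c = "\<i> * (of_real (control (gram_inv static)) - 1)"
  have p: "coord p n = ?c * of_real (\<beta> n)" for n
    using gram_commutator[OF q, of n] freq_pos[of n] by (simp add: coord_static field_simps)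
  have "summable (\<lambda>n. (cmod (?c * of_real (\<beta> n)))\<^sup>2)"
    using summable_coord[of p] unfolding p .
  then have "?c = 0" by (rule const_times_beta_square_summable)
  then have "p = 0" using p by (intro ell2_eqI) simp
  then have "gram_inv static = 0" using q by (intro ell2_eqI) (simp add: gram_inv.zero)
  then have "static = 0" by (metis gram.zero gram_gram_inv)
  then have "coord static 0 = 0" by simp
  then show False using bl[of 0] bl_pos freq_pos[of 0] by (simp add: coord_static)
qed

lemma gen_rel_add: "gen_rel x p \<Longrightarrow> gen_rel y q \<Longrightarrow> gen_rel (x + y) (p + q)"
  by (simp add: gen_rel_def gram_inv.add algebra_simps)

lemma gen_rel_scale: "gen_rel x p \<Longrightarrow> gen_rel (r *\<^sub>R x) (r *\<^sub>R p)"
  by (simp add: gen_rel_def gram_inv.scale)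

lemma gen_rel_zero: "gen_rel 0 0"
  by (simp add: gen_rel_def gram_inv.zero)

lemma control_add:
  assumes "gen_rel x p" "gen_rel y q"
  shows "control (gram_inv (x + y)) = control (gram_inv x) + control (gram_inv y)"
  using summable_control[of "gram_inv p" "gram_inv x"] summable_control[of "gram_inv q" "gram_inv y"] assms
  by (simp add: control_def gram_inv.add gen_rel_def suminf_add[symmetric] algebra_simps)

lemma control_scale:
  assumes "gen_rel x p"
  shows "control (gram_inv (r *\<^sub>R x)) = r * control (gram_inv x)"
  using suminf_mult[OF summable_control[of "gram_inv p" "gram_inv x"], of r] assms
  by (simp add: control_def gram_inv.scale gen_rel_def algebra_simps)

lemma gen_rel_surj: "\<exists>z. gen_rel z p"
proof -
  have b: "cmod (- (1 / rate n)) \<le> 1" for n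
    using rate_bounds(1)[of n] freq_ge_1[of n] by (simp add: norm_divide)
  have "gen_rel (gram (diag_op (\<lambda>n. - (1 / rate n)) (gram_inv p))) p"
    by (simp add: gen_rel_def coord_diag_op[OF b])
  then show ?thesis ..
qed

text \<open>
  The feedback is prescribed on the domain \<open>D\<close> of the generator. Outside \<open>D\<close> it has to be chosen such that
  the closed-loop expression is not square-summable, since otherwise the closed-loop domain would be
  larger than \<open>D\<close>. If the expression for \<open>z\<close> has a square-summable value \<open>p\<close>, then the generator takes
  the value \<open>p\<close> at some \<open>z'\<close> in \<open>D\<close>, and \<open>z - z'\<close> is \<open>\<kappa> (z - z')\<close> times \<open>static\<close>. With \<open>\<kappa> static = 0\<close> this
  forces \<open>z = z'\<close>. As \<open>static\<close> is not in \<open>D\<close>, a linear extension with this value exists.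
\<close>

lemma exists_feedback:
  "\<exists>\<kappa> :: ell2 \<Rightarrow> real. linear \<kappa> \<and>
     (\<forall>z p. gen_rel z p \<longleftrightarrow>
       (\<forall>n. coord p n = - \<i> * of_real (freq n) * coord z n + \<i> * of_real (\<beta> n) * of_real (\<kappa> z)))"
proof -
  define D where "D = {z. \<exists>p. gen_rel z p}"
  have sub: "subspace D"
    unfolding subspace_def D_def using gen_rel_add gen_rel_scale gen_rel_zero by blast
  obtain B where B: "B \<subseteq> D" "independent B" "D \<subseteq> span B"
    by (rule maximal_independent_subset)
  have span_B: "span B = D" using B(1,3) span_minimal[OF B(1) sub] by blast
  have "static \<notin> D" using static_not_in_domain by (simp add: D_def)
  then have ind: "independent (insert static B)" using B(2) span_B by (intro independent_insertI) auto
  have "\<exists>g. linear g \<and> (\<forall>x\<in>insert static B. g x = (if x = static then 0 else control (gram_inv x)))"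
    by (rule linear_independent_extend[OF ind])
  then obtain \<kappa> :: "ell2 \<Rightarrow> real" where lin: "linear \<kappa>"
    and \<kappa>: "\<And>x. x \<in> insert static B \<Longrightarrow> \<kappa> x = (if x = static then 0 else control (gram_inv x))"
    by blast
  interpret \<kappa>: linear \<kappa> by (rule lin)
  have \<kappa>_static: "\<kappa> static = 0" using \<kappa> by simp
  have \<kappa>_D: "\<kappa> z = control (gram_inv z)" if "z \<in> D" for z
  proof -
    have "subspace {z \<in> D. \<kappa> z = control (gram_inv z)}"
    proof (rule subspaceI)
      show "0 \<in> {z \<in> D. \<kappa> z = control (gram_inv z)}"
        using subspace_0[OF sub] control_scale[OF gen_rel_zero, of 0] by (simp add: \<kappa>.zero)
      fix x assume x: "x \<in> {z \<in> D. \<kappa> z = control (gram_inv z)}"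
      then obtain p where p: "gen_rel x p" by (auto simp: D_def)
      show "r *\<^sub>R x \<in> {z \<in> D. \<kappa> z = control (gram_inv z)}" for r
        using x subspace_scale[OF sub] control_scale[OF p] by (simp add: \<kappa>.scale)
      fix y assume y: "y \<in> {z \<in> D. \<kappa> z = control (gram_inv z)}"
      then obtain q where q: "gen_rel y q" by (auto simp: D_def)
      show "x + y \<in> {z \<in> D. \<kappa> z = control (gram_inv z)}"
        using x y subspace_add[OF sub] control_add[OF p q] by (simp add: \<kappa>.add)
    qed
    moreover have "B \<subseteq> {z \<in> D. \<kappa> z = control (gram_inv z)}"
      using B(1) \<kappa> \<open>static \<notin> D\<close> by auto
    ultimately have "span B \<subseteq> {z \<in> D. \<kappa> z = control (gram_inv z)}" by (rule span_minimal[rotated])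
    then show ?thesis using that span_B by auto
  qed
  have fwd: "coord p n = - \<i> * of_real (freq n) * coord z n + \<i> * of_real (\<beta> n) * of_real (\<kappa> z)"
    if "gen_rel z p" for z p n
  proof -
    have q: "coord (gram_inv p) n = - rate n * coord (gram_inv z) n" for n
      using that by (simp add: gen_rel_def)
    have "z \<in> D" using that by (auto simp: D_def)
    then show ?thesis using gram_commutator[OF q, of n] by (simp add: \<kappa>_D)
  qed
  have "gen_rel z p"
    if zp: "\<forall>n. coord p n = - \<i> * of_real (freq n) * coord z n + \<i> * of_real (\<beta> n) * of_real (\<kappa> z)" for z p
  proof -
    obtain z' where z': "gen_rel z' p" using gen_rel_surj by blast
    \<comment> \<open>both \<open>z\<close> and \<open>z'\<close> have the image \<open>p\<close>, so their difference is at rest under a constant control\<close>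
    have "z - z' = (\<kappa> z - \<kappa> z') *\<^sub>R static"
    proof (rule ell2_eqI)
      fix n
      have "\<i> * (of_real (freq n) * (coord z n - coord z' n)) = \<i> * (of_real (\<beta> n) * of_real (\<kappa> z - \<kappa> z'))"
        using zp[rule_format, of n] fwd[OF z', of n] by (simp add: algebra_simps)
      then have "of_real (freq n) * (coord z n - coord z' n) = complex_of_real (\<beta> n * (\<kappa> z - \<kappa> z'))"
        by simp
      then show "coord (z - z') n = coord ((\<kappa> z - \<kappa> z') *\<^sub>R static) n"
        using freq_pos[of n] by (simp add: coord_static scaleR_conv_of_real field_simps)
    qed
    moreover from this have "\<kappa> z - \<kappa> z' = 0"
      by (metis \<kappa>.diff \<kappa>.scale \<kappa>_static scale_zero_right)
    ultimately have "z = z'" by simp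
    then show ?thesis using z' by simp
  qed
  with fwd lin show ?thesis by blast
qed

end

section \<open>Square-integrable functions on the unit interval\<close>

interpretation leb01: finite_measure leb01
  by (rule finite_measure_lebesgue_on) simp

lemma borel_measurable_leb01: "f \<in> borel_measurable borel \<Longrightarrow> f \<in> borel_measurable leb01"
  by (intro measurable_restrict_space1 measurable_completion) simp

lemma continuous_measurable_leb01:
  fixes f :: "real \<Rightarrow> 'a::topological_space"
  shows "continuous_on UNIV f \<Longrightarrow> f \<in> borel_measurable leb01"
  by (intro borel_measurable_leb01 borel_measurable_continuous_onI)

lemma AE_leb01: "(AE x in lborel. P x) \<Longrightarrow> (AE x in leb01. P x)"
  by (auto dest: AE_completion simp: AE_restrict_space_iff)

lemma AE_leb01I: "(\<And>x. 0 < x \<Longrightarrow> x < 1 \<Longrightarrow> P x) \<Longrightarrow> (AE x in leb01. P x)"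
  by (intro AE_I2) auto

lemma bounded_integrable_leb01:
  fixes u :: "real \<Rightarrow> 'a::{banach, second_countable_topology}"
  assumes "u \<in> borel_measurable leb01" "\<And>x. 0 < x \<Longrightarrow> x < 1 \<Longrightarrow> norm (u x) \<le> B"
  shows "integrable leb01 u"
  by (rule leb01.integrable_const_bound[OF _ assms(1), of B]) (rule AE_leb01I[OF assms(2)])

lemma measure_leb01: "measure leb01 {0<..<1} = 1"
  by (simp add: measure_restrict_space)

lemma leb01_FTC:
  fixes F :: "real \<Rightarrow> 'a::euclidean_space"
  assumes F: "\<And>x. (F has_vector_derivative f x) (at x)" and f: "continuous_on UNIV f"
  shows "(LINT x|leb01. f x) = F 1 - F 0"
proof -
  have "(f has_integral F 1 - F 0) {0..1}"
    by (rule fundamental_theorem_of_calculus) (auto intro: has_vector_derivative_at_within F)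
  then have "(f has_integral F 1 - F 0) {0<..<1}" by (simp add: has_integral_Icc_iff_Ioo)
  moreover have "integrable leb01 f"
  proof -
    have "bounded (f ` {0..1})"
      by (intro compact_imp_bounded compact_continuous_image continuous_on_subset[OF f]) auto
    then obtain B where "\<forall>x\<in>{0..1}. norm (f x) \<le> B" by (auto simp: bounded_iff)
    then show ?thesis by (intro bounded_integrable_leb01[of _ B] continuous_measurable_leb01 f) auto
  qed
  then have "(LINT x|leb01. f x) = integral {0<..<1} f" by (intro lebesgue_integral_eq_integral) auto
  ultimately show ?thesis by (simp add: integral_unique)
qed

lemma sums_indicator_disjoint:
  assumes "disjoint_family F"
  shows "(\<lambda>i::nat. indicator (F i) x :: real) sums indicator (\<Union>i. F i) x"
proof (cases "\<exists>i. x \<in> F i")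
  case True
  then obtain i where i: "x \<in> F i" by blast
  then have "(\<lambda>k. indicator (F k) x :: real) = (\<lambda>k. if k = i then 1 else 0)"
    using assms by (fastforce simp: disjoint_family_on_def indicator_def fun_eq_iff)
  then show ?thesis using sums_single[of i "\<lambda>_. 1 :: real"] i by (auto simp: indicator_def)
qed (simp add: indicator_def)

text \<open>
  The intervals generate the Borel sets, and the sets with vanishing integral are closed under
  complements and countable disjoint unions.
\<close>

lemma zero_interval_integrals_imp_zero_borel_integrals:
  fixes f :: "real \<Rightarrow> real"
  assumes int: "integrable leb01 f"
    and zero: "\<And>a b. 0 < a \<Longrightarrow> a < b \<Longrightarrow> b < 1 \<Longrightarrow> (LINT x|leb01. indicator {a<..<b} x * f x) = 0"
    and A: "A \<in> sets borel"
  shows "(LINT x|leb01. indicator A x * f x) = 0"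
proof -
  have ind: "indicator B \<in> borel_measurable leb01" if "B \<in> sets borel" for B :: "real set"
    using that by (intro borel_measurable_leb01) simp
  have fm: "f \<in> borel_measurable leb01" using int by (rule borel_measurable_integrable)
  have inti: "integrable leb01 (\<lambda>x. indicator B x * f x)" if "B \<in> sets borel" for B
    using ind[OF that]
    by (intro Bochner_Integration.integrable_bound[OF int] borel_measurable_times fm ind that)
      (auto simp: indicator_def)
  have interval: "(LINT x|leb01. indicator {a..b} x * f x) = 0" for a b :: real
  proof (rule LIMSEQ_unique)
    \<comment> \<open>the hypothesis covers only intervals whose closure lies inside the unit interval\<close>
    let ?a = "\<lambda>n. max a (1 / real (n + 3))" and ?b = "\<lambda>n. min b (1 - 1 / real (n + 3))"
    have inv: "(\<lambda>n. 1 / real (n + 3)) \<longlonglongrightarrow> 0"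
      by (rule LIMSEQ_ignore_initial_segment[OF lim_inverse_n'])
    have pos: "0 < 1 / real (n + 3)" "1 / real (n + 3) < 1" for n by auto
    have "(LINT x|leb01. indicator {?a n<..<?b n} x * f x) = 0" for n
    proof (cases "?a n < ?b n")
      case True
      moreover have "0 < ?a n" "?b n < 1" using pos[of n] by linarith+
      ultimately show ?thesis by (intro zero)
    next
      case False
      then have empty: "{?a n<..<?b n} = {}" by (simp only: greaterThanLessThan_empty_iff not_less)
      show ?thesis unfolding empty by simp
    qed
    then show "(\<lambda>n. LINT x|leb01. indicator {?a n<..<?b n} x * f x) \<longlonglongrightarrow> 0" by simp
    show "(\<lambda>n. LINT x|leb01. indicator {?a n<..<?b n} x * f x) \<longlonglongrightarrow> (LINT x|leb01. indicator {a..b} x * f x)"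
    proof (rule integral_dominated_convergence[where w = "\<lambda>x. norm (f x)"])
      have "AE x in leb01. x \<noteq> a \<and> x \<noteq> b"
        by (rule AE_leb01) (use AE_lborel_singleton[of a] AE_lborel_singleton[of b] in eventually_elim, auto)
      moreover have "AE x in leb01. 0 < x \<and> x < 1" by (rule AE_leb01I) auto
      ultimately show "AE x in leb01. (\<lambda>n. indicator {?a n<..<?b n} x * f x) \<longlonglongrightarrow> indicator {a..b} x * f x"
      proof eventually_elim
        case (elim x)
        have l1: "?a \<longlonglongrightarrow> max a 0" by (intro tendsto_max tendsto_const inv)
        have "?b \<longlonglongrightarrow> min b (1 - 0)" by (intro tendsto_min tendsto_diff tendsto_const inv)
        then have l2: "?b \<longlonglongrightarrow> min b 1" by simp
        have "\<forall>\<^sub>F n in sequentially. (indicator {?a n<..<?b n} x :: real) = indicator {a..b} x"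
        proof (cases "a < x \<and> x < b")
          case True
          have "\<forall>\<^sub>F n in sequentially. ?a n < x" using l1 by (rule order_tendstoD) (use True elim in auto)
          moreover have "\<forall>\<^sub>F n in sequentially. x < ?b n" using l2 by (rule order_tendstoD) (use True elim in auto)
          ultimately show ?thesis by eventually_elim (use True in \<open>auto simp: indicator_def\<close>)
        next
          case False
          then show ?thesis using elim by (intro always_eventually) (auto simp: indicator_def)
        qed
        then show ?case by (intro tendsto_mult_right tendsto_eventually)
      qed
      show "(\<lambda>x. indicator {a..b} x * f x) \<in> borel_measurable leb01"
        by (intro borel_measurable_times fm ind) simp
      show "(\<lambda>x. indicator {?a n<..<?b n} x * f x) \<in> borel_measurable leb01" for n
        by (intro borel_measurable_times fm ind) simp
    qed (use int in \<open>auto simp: indicator_def\<close>)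
  qed
  have whole: "(LINT x|leb01. f x) = 0"
  proof -
    have "(LINT x|leb01. f x) = (LINT x|leb01. indicator {0..1} x * f x)"
      by (intro Bochner_Integration.integral_cong) (auto simp: indicator_def)
    then show ?thesis using interval by simp
  qed
  from A show ?thesis
  proof (induction rule: borel_set_induct)
    case (compl A)
    have "(LINT x|leb01. indicator (- A) x * f x) = (LINT x|leb01. f x - indicator A x * f x)"
      by (intro Bochner_Integration.integral_cong) (auto simp: indicator_def)
    then show ?case using compl whole int inti by simp
  next
    case (union F)
    have "(\<lambda>i. LINT x|leb01. indicator (F i) x * f x) sums (LINT x|leb01. (\<Sum>i. indicator (F i) x * f x))"
    proof (rule sums_integral)
      show "integrable leb01 (\<lambda>x. indicator (F i) x * f x)" for i using inti union by auto
      have s: "summable (\<lambda>i. indicator (F i) x * norm (f x))" for x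
        using sums_indicator_disjoint[OF union(1)] by (intro summable_mult2) (auto simp: sums_iff)
      then show "AE x in leb01. summable (\<lambda>i. norm (indicator (F i) x * f x))"
        by (simp add: abs_mult)
      show "summable (\<lambda>i. LINT x|leb01. norm (indicator (F i) x * f x))"
      proof (rule bounded_imp_summable)
        fix n
        have "(\<Sum>i\<le>n. LINT x|leb01. norm (indicator (F i) x * f x)) = (LINT x|leb01. (\<Sum>i\<le>n. norm (indicator (F i) x * f x)))"
          by (subst Bochner_Integration.integral_sum) (use inti union in \<open>auto intro!: integrable_norm\<close>)
        also have "\<dots> \<le> (LINT x|leb01. norm (f x))"
        proof (rule integral_mono)
          show "integrable leb01 (\<lambda>x. \<Sum>i\<le>n. norm (indicator (F i) x * f x))"
            using inti union by (intro Bochner_Integration.integrable_sum integrable_norm) auto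
          show "integrable leb01 (\<lambda>x. norm (f x))" using int by simp
          fix x
          have "(\<Sum>i\<le>n. norm (indicator (F i) x * f x)) = (\<Sum>i\<le>n. indicator (F i) x) * norm (f x)"
            by (simp add: abs_mult sum_distrib_right)
          also have "(\<Sum>i\<le>n. indicator (F i) x) \<le> (\<Sum>i. indicator (F i) x :: real)"
            using sums_indicator_disjoint[OF union(1), of x] by (intro sum_le_suminf) (auto simp: sums_iff)
          also have "\<dots> \<le> 1" using sums_indicator_disjoint[OF union(1), of x] by (auto simp: sums_iff indicator_def)
          finally show "(\<Sum>i\<le>n. norm (indicator (F i) x * f x)) \<le> norm (f x)"
            by (simp add: mult_left_le_one_le mult_right_mono sum_nonneg)
        qed
        finally show "(\<Sum>i\<le>n. LINT x|leb01. norm (indicator (F i) x * f x)) \<le> (LINT x|leb01. norm (f x))" .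
      qed auto
    qed
    moreover have "(\<Sum>i. indicator (F i) x * f x) = indicator (\<Union>i. F i) x * f x" for x
      using sums_mult2[OF sums_indicator_disjoint[OF union(1), of x], of "f x"] by (simp add: sums_iff)
    ultimately show ?case using union by (simp add: sums_iff)
  qed (use interval in auto)
qed

text \<open>
  Each Lebesgue set differs from a Borel set by a null set, so the integrals over all measurable sets
  vanish.
\<close>

lemma AE_zero_if_interval_integrals_zero:
  fixes f :: "real \<Rightarrow> complex"
  assumes int: "integrable leb01 f"
    and zero: "\<And>a b. 0 < a \<Longrightarrow> a < b \<Longrightarrow> b < 1 \<Longrightarrow> (LINT x|leb01. indicator {a<..<b} x *\<^sub>R f x) = 0"
  shows "AE x in leb01. f x = 0"
proof -
  have real: "AE x in leb01. h x = 0"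
    if h: "integrable leb01 h"
      and z: "\<And>a b. 0 < a \<Longrightarrow> a < b \<Longrightarrow> b < 1 \<Longrightarrow> (LINT x|leb01. indicator {a<..<b} x * h x) = 0"
    for h :: "real \<Rightarrow> real"
  proof (rule density_unique_real[OF h, of "\<lambda>x. 0"])
    fix A assume A: "A \<in> sets leb01"
    then have A': "A \<in> sets lebesgue" by (auto simp: sets_restrict_space_iff)
    have "(LINT x:A|leb01. h x) = (LINT x|leb01. indicator (main_part lborel A) x * h x)"
      unfolding set_lebesgue_integral_def
    proof (rule integral_cong_AE)
      have "AE x in leb01. x \<in> main_part lborel A \<longleftrightarrow> x \<in> A"
        by (rule AE_leb01[OF AE_in_main_part[OF A']])
      then show "AE x in leb01. indicator A x *\<^sub>R h x = indicator (main_part lborel A) x * h x"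
        by eventually_elim (auto simp: indicator_def)
      show "(\<lambda>x. indicator A x *\<^sub>R h x) \<in> borel_measurable leb01"
        using A h by (intro borel_measurable_scaleR) auto
      have "main_part lborel A \<in> sets borel" using main_part_sets[OF A'] by simp
      then show "(\<lambda>x. indicator (main_part lborel A) x * h x) \<in> borel_measurable leb01"
        by (intro borel_measurable_times borel_measurable_leb01 borel_measurable_integrable[OF h]) simp
    qed
    also have "\<dots> = 0"
      using main_part_sets[OF A'] by (intro zero_interval_integrals_imp_zero_borel_integrals[OF h z]) auto
    finally show "(LINT x:A|leb01. h x) = (LINT x:A|leb01. 0)" by simp
  qed simp
  have ii: "integrable leb01 (\<lambda>x. indicator {a<..<b} x *\<^sub>R f x)" for a b :: real
    by (rule Bochner_Integration.integrable_bound[OF int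
          borel_measurable_scaleR[OF borel_measurable_leb01 borel_measurable_integrable[OF int]]])
      (auto simp: indicator_def)
  have "AE x in leb01. Re (f x) = 0"
  proof (rule real)
    show "(LINT x|leb01. indicator {a<..<b} x * Re (f x)) = 0" if "0 < a" "a < b" "b < 1" for a b :: real
      using arg_cong[OF zero[OF that], of Re] integral_Re[OF ii[of a b]] by simp
  qed (use int in simp)
  moreover have "AE x in leb01. Im (f x) = 0"
  proof (rule real)
    show "(LINT x|leb01. indicator {a<..<b} x * Im (f x)) = 0" if "0 < a" "a < b" "b < 1" for a b :: real
      using arg_cong[OF zero[OF that], of Im] integral_Im[OF ii[of a b]] by simp
  qed (use int in simp)
  ultimately show ?thesis by eventually_elim (simp add: complex_eq_iff)
qed

lemma L2_measurable: "f \<in> L2 \<Longrightarrow> f \<in> borel_measurable leb01"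
  by (simp add: L2_def)

lemma L2_sq_integrable: "f \<in> L2 \<Longrightarrow> integrable leb01 (\<lambda>x. (cmod (f x))\<^sup>2)"
  by (simp add: L2_def)

lemma L2_I:
  assumes "f \<in> borel_measurable leb01" "integrable leb01 g" "\<And>x. 0 < x \<Longrightarrow> x < 1 \<Longrightarrow> (cmod (f x))\<^sup>2 \<le> g x"
  shows "f \<in> L2"
  unfolding L2_def
proof (safe intro!: assms(1))
  show "integrable leb01 (\<lambda>x. (cmod (f x))\<^sup>2)"
    by (rule Bochner_Integration.integrable_bound[OF assms(2)])
      (use assms in \<open>auto intro!: AE_leb01I intro: order_trans[OF _ abs_ge_self]\<close>)
qed

lemma L2_mult_bounded:
  assumes "f \<in> L2" "u \<in> borel_measurable leb01" "\<And>x. 0 < x \<Longrightarrow> x < 1 \<Longrightarrow> cmod (u x) \<le> B"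
  shows "(\<lambda>x. u x * f x) \<in> L2"
proof (rule L2_I)
  show "(\<lambda>x. u x * f x) \<in> borel_measurable leb01"
    using assms(2) L2_measurable[OF assms(1)] by (rule borel_measurable_times)
  show "integrable leb01 (\<lambda>x. B\<^sup>2 * (cmod (f x))\<^sup>2)" using L2_sq_integrable[OF assms(1)] by simp
  show "(cmod (u x * f x))\<^sup>2 \<le> B\<^sup>2 * (cmod (f x))\<^sup>2" if "0 < x" "x < 1" for x
    using assms(3)[OF that] by (simp add: norm_mult power_mult_distrib mult_right_mono power_mono)
qed

lemma L2_bounded:
  assumes "u \<in> borel_measurable leb01" "\<And>x. 0 < x \<Longrightarrow> x < 1 \<Longrightarrow> cmod (u x) \<le> B"
  shows "u \<in> L2"
  by (rule L2_I[OF assms(1), of "\<lambda>x. B\<^sup>2"]) (auto intro!: power_mono assms(2))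

lemma L2_add: "f \<in> L2 \<Longrightarrow> g \<in> L2 \<Longrightarrow> (\<lambda>x. f x + g x) \<in> L2"
proof (rule L2_I)
  assume fg: "f \<in> L2" "g \<in> L2"
  show "(\<lambda>x. f x + g x) \<in> borel_measurable leb01" using fg by (intro borel_measurable_add L2_measurable)
  show "integrable leb01 (\<lambda>x. 2 * (cmod (f x))\<^sup>2 + 2 * (cmod (g x))\<^sup>2)"
    using fg by (simp add: L2_sq_integrable)
  show "(cmod (f x + g x))\<^sup>2 \<le> 2 * (cmod (f x))\<^sup>2 + 2 * (cmod (g x))\<^sup>2" for x
  proof -
    have "(cmod (f x + g x))\<^sup>2 \<le> (cmod (f x) + cmod (g x))\<^sup>2"
      by (simp add: norm_triangle_ineq power_mono)
    also have "\<dots> \<le> 2 * (cmod (f x))\<^sup>2 + 2 * (cmod (g x))\<^sup>2"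
      using sum_squares_bound[of "cmod (f x)" "cmod (g x)"] by (simp add: power2_sum)
    finally show ?thesis .
  qed
qed

lemma L2_cmult: "f \<in> L2 \<Longrightarrow> (\<lambda>x. c * f x) \<in> L2"
  by (rule L2_mult_bounded[where B = "cmod c"]) auto

lemma L2_scaleR: "f \<in> L2 \<Longrightarrow> (\<lambda>x. r *\<^sub>R f x) \<in> L2"
  using L2_cmult[of f "of_real r"] by (simp add: scaleR_conv_of_real)

lemma L2_diff: "f \<in> L2 \<Longrightarrow> g \<in> L2 \<Longrightarrow> (\<lambda>x. f x - g x) \<in> L2"
  using L2_add[of f "\<lambda>x. - 1 * g x"] L2_cmult[of g "- 1"] by simp

lemma L2_re_part: "f \<in> L2 \<Longrightarrow> re_part f \<in> L2"
  unfolding re_part_def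
  by (rule L2_I[OF _ L2_sq_integrable[of f]])
    (auto intro!: borel_measurable_of_real borel_measurable_Re dest: L2_measurable simp: cmod_power2)

lemma L2_im_part: "f \<in> L2 \<Longrightarrow> im_part f \<in> L2"
  unfolding im_part_def
  by (rule L2_I[OF _ L2_sq_integrable[of f]])
    (auto intro!: borel_measurable_of_real borel_measurable_Im dest: L2_measurable simp: cmod_power2)

lemma L2_sum: "(\<And>i. i \<in> A \<Longrightarrow> f i \<in> L2) \<Longrightarrow> (\<lambda>x. \<Sum>i\<in>A. f i x) \<in> L2"
proof (induction A rule: infinite_finite_induct)
  case (insert a A)
  then show ?case using L2_add[of "f a" "\<lambda>x. \<Sum>i\<in>A. f i x"] by simp
qed (auto intro: L2_bounded[of _ 0])

lemma L2_mult_integrable: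
  assumes "f \<in> L2" "g \<in> L2"
  shows "integrable leb01 (\<lambda>x. f x * g x)"
proof (rule Bochner_Integration.integrable_bound)
  show "integrable leb01 (\<lambda>x. (cmod (f x))\<^sup>2 + (cmod (g x))\<^sup>2)"
    using assms by (simp add: L2_sq_integrable)
  show "(\<lambda>x. f x * g x) \<in> borel_measurable leb01" using assms by (intro borel_measurable_times L2_measurable)
  have "cmod (f x * g x) \<le> (cmod (f x))\<^sup>2 + (cmod (g x))\<^sup>2" for x
  proof -
    have "0 \<le> cmod (f x) * cmod (g x)" by simp
    then show ?thesis using sum_squares_bound[of "cmod (f x)" "cmod (g x)"] unfolding norm_mult by linarith
  qed
  then show "AE x in leb01. norm (f x * g x) \<le> norm ((cmod (f x))\<^sup>2 + (cmod (g x))\<^sup>2)"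
    by (intro AE_I2) simp
qed

lemma L2_integrable: "f \<in> L2 \<Longrightarrow> integrable leb01 f"
  using L2_mult_integrable[of f "\<lambda>x. 1"] L2_bounded[of "\<lambda>x. 1" 1] by simp

lemma ae_eq_refl [simp]: "ae_eq f f" by (simp add: ae_eq_def)

section \<open>Sines and cosines\<close>

text \<open>
  The phase makes differentiation an index shift, and it turns sines into cosines up to sign. For each
  \<open>j\<close> the functions with \<open>k \<ge> 1\<close> are orthonormal on the unit interval.
\<close>

definition trig :: "nat \<Rightarrow> nat \<Rightarrow> real \<Rightarrow> real"
  where "trig j k x = sqrt 2 * sin (real k * pi * x + real j * (pi / 2))"

lemma eigfun_trig: "eigfun k = (\<lambda>x. of_real (trig 0 k x))"
  by (simp add: eigfun_def trig_def)

lemma continuous_trig: "continuous_on A (trig j k)"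
  unfolding trig_def by (intro continuous_intros)

lemma measurable_trig: "(\<lambda>x. complex_of_real (trig j k x)) \<in> borel_measurable leb01"
  by (intro continuous_measurable_leb01 continuous_on_of_real continuous_trig)

lemma trig_bound: "\<bar>trig j k x\<bar> \<le> 2"
proof -
  have "sqrt 2 * \<bar>sin (real k * pi * x + real j * (pi / 2))\<bar> \<le> 2 * 1"
    by (intro mult_mono) (auto simp: real_le_lsqrt sqrt2_less_2 less_imp_le)
  then show ?thesis by (simp add: trig_def abs_mult)
qed

lemma L2_trig: "(\<lambda>x. complex_of_real (trig j k x)) \<in> L2"
  by (rule L2_bounded[OF measurable_trig, of _ _ 2]) (use trig_bound in simp)

lemma trig_deriv: "(trig j k has_real_derivative real k * pi * trig (Suc j) k x) (at x)"
proof -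
  have "(trig j k has_real_derivative sqrt 2 * (cos (real k * pi * x + real j * (pi / 2)) * (real k * pi))) (at x)"
    unfolding trig_def by (auto intro!: derivative_eq_intros)
  moreover have "cos (real k * pi * x + real j * (pi / 2)) = sin (real k * pi * x + real (Suc j) * (pi / 2))"
    by (simp add: cos_sin_eq algebra_simps sin_add cos_add add_divide_distrib)
  ultimately show ?thesis by (simp add: trig_def mult_ac)
qed

lemma integral_cos: "(LINT x|leb01. cos (of_int n * pi * x)) = (if n = 0 then 1 else 0)"
proof (cases "n = 0")
  case False
  have "(LINT x|leb01. cos (of_int n * pi * x)) =
      sin (of_int n * pi * 1) / (of_int n * pi) - sin (of_int n * pi * 0) / (of_int n * pi)"
  proof (rule leb01_FTC)
    show "((\<lambda>x. sin (of_int n * pi * x) / (of_int n * pi)) has_vector_derivative cos (of_int n * pi * x)) (at x)" for x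
      unfolding has_real_derivative_iff_has_vector_derivative[symmetric]
      using False by (auto intro!: derivative_eq_intros)
  qed (intro continuous_intros)
  then show ?thesis using False sin_npi_int[of n] by (simp add: mult.commute)
qed (simp add: measure_leb01)

lemma trig_prod:
  "trig j k x * trig j l x = cos (of_int (int k - int l) * pi * x) - (- 1) ^ j * cos (of_int (int k + int l) * pi * x)"
proof -
  have "trig j k x * trig j l x = 2 * (sin (real k * pi * x + real j * (pi / 2)) * sin (real l * pi * x + real j * (pi / 2)))"
    by (simp add: trig_def algebra_simps)
  also have "\<dots> = cos ((real k * pi * x + real j * (pi / 2)) - (real l * pi * x + real j * (pi / 2)))
      - cos ((real k * pi * x + real j * (pi / 2)) + (real l * pi * x + real j * (pi / 2)))"
    by (simp add: sin_times_sin)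
  also have "(real k * pi * x + real j * (pi / 2)) + (real l * pi * x + real j * (pi / 2)) = of_int (int k + int l) * pi * x + real j * pi"
    by (simp add: algebra_simps)
  also have "cos (of_int (int k + int l) * pi * x + real j * pi) = (- 1) ^ j * cos (of_int (int k + int l) * pi * x)"
    by (simp add: cos_add)
  finally show ?thesis by (simp add: algebra_simps)
qed

lemma trig_orthonormal: "(LINT x|leb01. trig j (Suc m) x * trig j (Suc n) x) = (if m = n then 1 else 0)"
proof -
  have i: "integrable leb01 (\<lambda>x. cos (of_int n * pi * x))" for n
    by (rule bounded_integrable_leb01[where B = 1]) (auto intro!: continuous_measurable_leb01 continuous_intros)
  show ?thesis
    unfolding trig_prod by (subst Bochner_Integration.integral_diff) (auto simp: i integral_cos simp del: of_int_diff of_int_add)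
qed

lemma norm_trig_sum:
  assumes "finite A"
  shows "(LINT x|leb01. (cmod (\<Sum>n\<in>A. a n * of_real (trig j (Suc n) x)))\<^sup>2) = (\<Sum>n\<in>A. (cmod (a n))\<^sup>2)"
proof -
  have "complex_of_real (LINT x|leb01. (cmod (\<Sum>n\<in>A. a n * of_real (trig j (Suc n) x)))\<^sup>2) =
     (LINT x|leb01. (\<Sum>m\<in>A. \<Sum>n\<in>A. a m * cnj (a n) * of_real (trig j (Suc m) x * trig j (Suc n) x)))"
  proof -
    have sq: "complex_of_real ((cmod (\<Sum>n\<in>A. a n * of_real (trig j (Suc n) x)))\<^sup>2) =
        (\<Sum>m\<in>A. \<Sum>n\<in>A. a m * cnj (a n) * of_real (trig j (Suc m) x * trig j (Suc n) x))" for x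
      unfolding complex_norm_square cnj_sum sum_product
      by (intro sum.cong refl) (simp add: mult_ac)
    show ?thesis unfolding sq[symmetric] 
      by (rule integral_of_real[symmetric], rule L2_sq_integrable) (intro L2_sum L2_cmult L2_trig)
  qed
  also have "\<dots> = (\<Sum>m\<in>A. \<Sum>n\<in>A. a m * cnj (a n) * of_real (LINT x|leb01. trig j (Suc m) x * trig j (Suc n) x))"
  proof -
    have "integrable leb01 (\<lambda>x. complex_of_real (trig j (Suc m) x * trig j (Suc n) x))" for m n
      using L2_mult_integrable[OF L2_trig L2_trig] by simp
    then show ?thesis
      by (simp add: Bochner_Integration.integral_sum del: of_real_mult)
  qed
  also have "\<dots> = (\<Sum>m\<in>A. a m * cnj (a m))"
    unfolding trig_orthonormal using assms by (simp add: if_distrib sum.delta cong: if_cong)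
  also have "\<dots> = complex_of_real (\<Sum>n\<in>A. (cmod (a n))\<^sup>2)"
    by (simp only: of_real_sum complex_norm_square)
  finally show ?thesis by (simp only: of_real_eq_iff)
qed

definition trig_coeff :: "nat \<Rightarrow> (real \<Rightarrow> complex) \<Rightarrow> nat \<Rightarrow> complex"
  where "trig_coeff j f n = (LINT x|leb01. f x * of_real (trig j (Suc n) x))"

lemma inner_L2_eigfun: "inner_L2 f (eigfun (Suc n)) = trig_coeff 0 f n"
  by (simp add: inner_L2_def eigfun_trig trig_coeff_def)

lemma L2_cnj: "f \<in> L2 \<Longrightarrow> (\<lambda>x. cnj (f x)) \<in> L2"
proof (rule L2_I[OF _ L2_sq_integrable])
  assume "f \<in> L2"
  moreover have "cnj \<in> borel_measurable borel"
    by (intro borel_measurable_continuous_onI continuous_intros)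
  ultimately show "(\<lambda>x. cnj (f x)) \<in> borel_measurable leb01"
    by (intro measurable_compose[OF L2_measurable])
qed auto

lemma trig_coeff_integrable: "f \<in> L2 \<Longrightarrow> integrable leb01 (\<lambda>x. f x * of_real (trig j k x))"
  by (intro L2_mult_integrable L2_trig)

lemma bessel:
  assumes "f \<in> L2"
  shows "(\<Sum>n<N. (cmod (trig_coeff j f n))\<^sup>2) \<le> (LINT x|leb01. (cmod (f x))\<^sup>2)"
proof -
  define p where "p x = (\<Sum>n<N. trig_coeff j f n * of_real (trig j (Suc n) x))" for x
  let ?s = "\<Sum>n<N. (cmod (trig_coeff j f n))\<^sup>2"
  have p: "p \<in> L2" unfolding p_def by (intro L2_sum L2_cmult L2_trig)
  have cp: "(\<lambda>x. cnj (p x)) \<in> L2"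
    by (rule L2_cnj[OF p])
  have "(LINT x|leb01. f x * cnj (p x)) = (LINT x|leb01. (\<Sum>n<N. cnj (trig_coeff j f n) * (f x * of_real (trig j (Suc n) x))))"
    by (simp add: p_def sum_distrib_left mult_ac)
  also have "\<dots> = (\<Sum>n<N. cnj (trig_coeff j f n) * trig_coeff j f n)"
    by (simp add: Bochner_Integration.integral_sum trig_coeff_integrable[OF assms] trig_coeff_def)
  also have "\<dots> = of_real ?s"
    by (simp only: of_real_sum complex_norm_square mult.commute)
  finally have fp: "(LINT x|leb01. Re (f x * cnj (p x))) = ?s"
    by (simp only: integral_Re[OF L2_mult_integrable[OF assms cp]] Re_complex_of_real)
  have "0 \<le> (LINT x|leb01. (cmod (f x - p x))\<^sup>2)" by simp
  also have "\<dots> = (LINT x|leb01. (cmod (f x))\<^sup>2 - 2 * Re (f x * cnj (p x)) + (cmod (p x))\<^sup>2)"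
  proof -
    have "(cmod (z - w))\<^sup>2 = (cmod z)\<^sup>2 - 2 * Re (z * cnj w) + (cmod w)\<^sup>2" for z w
      unfolding cmod_power2 by (simp add: power2_eq_square algebra_simps)
    then show ?thesis by (simp only:)
  qed
  also have "\<dots> = (LINT x|leb01. (cmod (f x))\<^sup>2) - 2 * ?s + (LINT x|leb01. (cmod (p x))\<^sup>2)"
    unfolding fp[symmetric]
  proof -
    have "(LINT x|leb01. a x - 2 * b x + c x) = (LINT x|leb01. a x) - 2 * (LINT x|leb01. b x) + (LINT x|leb01. c x)"
      if "integrable leb01 a" "integrable leb01 b" "integrable leb01 c" for a b c :: "real \<Rightarrow> real"
      using that by simp
    note lin = this
    show "(LINT x|leb01. (cmod (f x))\<^sup>2 - 2 * Re (f x * cnj (p x)) + (cmod (p x))\<^sup>2) =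
        (LINT x|leb01. (cmod (f x))\<^sup>2) - 2 * (LINT x|leb01. Re (f x * cnj (p x))) + (LINT x|leb01. (cmod (p x))\<^sup>2)"
      by (rule lin[OF L2_sq_integrable[OF assms] integrable_Re[OF L2_mult_integrable[OF assms cp]] L2_sq_integrable[OF p]])
  qed
  also have "(LINT x|leb01. (cmod (p x))\<^sup>2) = ?s" unfolding p_def by (rule norm_trig_sum) simp
  finally show ?thesis by simp
qed

lemma summable_trig_coeff: "f \<in> L2 \<Longrightarrow> summable (\<lambda>n. (cmod (trig_coeff j f n))\<^sup>2)"
  by (rule bounded_imp_summable[of _ "LINT x|leb01. (cmod (f x))\<^sup>2"])
    (use bessel[of f j "Suc _"] in \<open>auto simp: lessThan_Suc_atMost\<close>)

lemma summable_product:
  fixes a b :: "nat \<Rightarrow> complex"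
  assumes "summable (\<lambda>n. (cmod (a n))\<^sup>2)" "summable (\<lambda>n. (cmod (b n))\<^sup>2)"
  shows "summable (\<lambda>n. a n * b n)"
proof (rule summable_comparison_test')
  show "summable (\<lambda>n. (cmod (a n))\<^sup>2 + (cmod (b n))\<^sup>2)" using assms by (rule summable_add)
  show "norm (a n * b n) \<le> (cmod (a n))\<^sup>2 + (cmod (b n))\<^sup>2" for n
    using sum_squares_bound[of "cmod (a n)" "cmod (b n)"] mult_nonneg_nonneg[OF norm_ge_zero[of "a n"] norm_ge_zero[of "b n"]]
    unfolding norm_mult mult.assoc by linarith
qed

text \<open>
  A subsequence of the partial sums with geometrically decreasing increments converges almost
  everywhere and in \<open>L\<^sup>1\<close>, and its limit is square-integrable by Fatou's lemma. The conclusion is stated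
  against bounded functions, which is what test functions need.
\<close>

lemma riesz_fischer:
  fixes c :: "nat \<Rightarrow> complex"
  assumes c: "summable (\<lambda>n. (cmod (c n))\<^sup>2)"
  shows "\<exists>g\<in>L2. \<forall>u\<in>borel_measurable leb01. (\<exists>B. \<forall>x. cmod (u x) \<le> B) \<longrightarrow>
    (\<lambda>n. c n * trig_coeff j u n) sums (LINT x|leb01. u x * g x)"
proof -
  define S where "S N x = (\<Sum>n<N. c n * of_real (trig j (Suc n) x))" for N x
  have S_L2: "S N \<in> L2" for N unfolding S_def by (intro L2_sum L2_cmult L2_trig)
  \<comment> \<open>a subsequence of the partial sums with geometrically decreasing increments\<close>
  let ?P = "\<lambda>i N. i \<le> N \<and> (\<forall>M\<ge>N. (\<Sum>n=N..<M. (cmod (c n))\<^sup>2) \<le> (1 / 4) ^ i)"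
  have tail: "\<exists>N0. \<forall>N\<ge>N0. ?P i N" for i
  proof -
    have "(0::real) < (1 / 4) ^ i" by simp
    then obtain N0 where N0: "\<And>m n. m \<ge> N0 \<Longrightarrow> norm (\<Sum>k=m..<n. (cmod (c k))\<^sup>2) < (1 / 4) ^ i"
      using c unfolding summable_Cauchy by blast
    have "?P i N" if "N \<ge> max N0 i" for N
      using that N0[of N] by (auto intro!: less_imp_le) (smt (verit) real_norm_def)
    then show ?thesis by blast
  qed
  have "\<exists>r. \<forall>i. ?P i (r i) \<and> r i \<le> r (Suc i)"
  proof (rule dependent_nat_choice)
    show "\<exists>N. ?P 0 N" using tail[of 0] by blast
    show "\<exists>y. ?P (Suc i) y \<and> N \<le> y" for N i
      using tail[of "Suc i"] by (meson nat_le_linear)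
  qed
  then obtain r where r: "\<And>i. ?P i (r i)" "\<And>i. r i \<le> r (Suc i)" by blast
  define d where "d i x = S (r (Suc i)) x - S (r i) x" for i x
  have d_L2: "d i \<in> L2" for i unfolding d_def by (intro L2_diff S_L2)
  have d_eq: "d i x = (\<Sum>n=r i..<r (Suc i). c n * of_real (trig j (Suc n) x))" for i x
    unfolding d_def S_def lessThan_atLeast0 using r(2)[of i] by (intro sum_diff_nat_ivl) auto
  have d_sq: "(LINT x|leb01. (cmod (d i x))\<^sup>2) \<le> (1 / 4) ^ i" for i
    unfolding d_eq using r(1)[of i] r(2)[of i] by (subst norm_trig_sum) auto
  have d_abs: "(LINT x|leb01. cmod (d i x)) \<le> (1 / 2) ^ i" for i
  proof -
    \<comment> \<open>Cauchy-Schwarz in the form \<open>2 t \<le> 2 ^ i * t\<^sup>2 + (1 / 2) ^ i\<close>\<close>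
    have "(LINT x|leb01. cmod (d i x)) \<le> (LINT x|leb01. (2 ^ i * (cmod (d i x))\<^sup>2 + (1 / 2) ^ i) / 2)"
    proof (rule integral_mono)
      show "integrable leb01 (\<lambda>x. cmod (d i x))" using L2_integrable[OF d_L2] by simp
      show "integrable leb01 (\<lambda>x. (2 ^ i * (cmod (d i x))\<^sup>2 + (1 / 2) ^ i) / 2)" using L2_sq_integrable[OF d_L2] by simp
      fix x
      have "0 \<le> 2 ^ i * (cmod (d i x) - (1 / 2) ^ i)\<^sup>2" by simp
      also have "\<dots> = 2 ^ i * (cmod (d i x))\<^sup>2 - 2 * cmod (d i x) + (1 / 2) ^ i"
        by (simp add: power2_diff algebra_simps power2_eq_square power_divide)
      finally show "cmod (d i x) \<le> (2 ^ i * (cmod (d i x))\<^sup>2 + (1 / 2) ^ i) / 2" by simp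
    qed
    also have "\<dots> = (2 ^ i * (LINT x|leb01. (cmod (d i x))\<^sup>2) + (1 / 2) ^ i) / 2"
      using L2_sq_integrable[OF d_L2] by (simp add: measure_leb01)
    also have "\<dots> \<le> (2 ^ i * (1 / 4) ^ i + (1 / 2) ^ i) / 2"
      by (intro divide_right_mono add_right_mono mult_left_mono d_sq) auto
    also have "\<dots> = (1 / 2) ^ i" by (simp add: power_mult_distrib[symmetric])
    finally show ?thesis .
  qed
  have sum_d: "summable (\<lambda>i. LINT x|leb01. cmod (d i x))"
    by (rule summable_comparison_test'[OF summable_geometric[of "1 / 2"]]) (use d_abs in auto)
  have AE_sum: "AE x in leb01. summable (\<lambda>i. cmod (d i x))"
  proof -
    have m: "(\<lambda>x. ennreal (cmod (d i x))) \<in> borel_measurable leb01" for i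
      using L2_measurable[OF d_L2[of i]] by simp
    have "(\<integral>\<^sup>+ x. (\<Sum>i. ennreal (cmod (d i x))) \<partial>leb01) = (\<Sum>i. \<integral>\<^sup>+ x. ennreal (cmod (d i x)) \<partial>leb01)"
      using m by (rule nn_integral_suminf)
    also have "\<dots> = (\<Sum>i. ennreal (LINT x|leb01. cmod (d i x)))"
      using L2_integrable[OF d_L2] by (subst nn_integral_eq_integral) auto
    also have "\<dots> \<noteq> \<infinity>" using sum_d by (simp add: ennreal_suminf_neq_top)
    finally have "AE x in leb01. (\<Sum>i. ennreal (cmod (d i x))) \<noteq> \<infinity>"
      using m by (intro nn_integral_noteq_infinite borel_measurable_suminf_order) auto
    then show ?thesis by eventually_elim (auto intro: summable_suminf_not_top)
  qed
  define g where "g x = S (r 0) x + (\<Sum>i. d i x)" for x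
  have int_sum: "integrable leb01 (\<lambda>x. \<Sum>i. d i x)"
    by (rule integrable_suminf[OF L2_integrable[OF d_L2] AE_sum sum_d])
  have g_meas: "g \<in> borel_measurable leb01"
    unfolding g_def using L2_measurable[OF S_L2] borel_measurable_integrable[OF int_sum] by (rule borel_measurable_add)
  have S_tel: "S (r 0) x + (\<Sum>i<k. d i x) = S (r k) x" for k x
  proof (induction k)
    case (Suc k)
    have "S (r 0) x + (\<Sum>i<Suc k. d i x) = S (r k) x + d k x"
      unfolding sum.lessThan_Suc Suc[symmetric] by (simp only: add.assoc)
    then show ?case unfolding d_def by (simp only: add_diff_cancel_left' add_diff_eq)
  qed simp
  have lim: "AE x in leb01. (\<lambda>k. S (r k) x) \<longlonglongrightarrow> g x"
    using AE_sum
  proof eventually_elim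
    case (elim x)
    have "(\<lambda>k. S (r 0) x + (\<Sum>i<k. d i x)) \<longlonglongrightarrow> g x"
      unfolding g_def by (rule tendsto_add[OF tendsto_const summable_LIMSEQ[OF summable_norm_cancel[OF elim]]])
    then show ?case by (simp only: S_tel)
  qed
  have "integrable leb01 (\<lambda>x. (cmod (g x))\<^sup>2)"
  proof (rule integrableI_bounded)
    show "(\<lambda>x. (cmod (g x))\<^sup>2) \<in> borel_measurable leb01" using g_meas by simp
    have "(\<integral>\<^sup>+ x. ennreal ((cmod (g x))\<^sup>2) \<partial>leb01) \<le> (\<integral>\<^sup>+ x. liminf (\<lambda>k. ennreal ((cmod (S (r k) x))\<^sup>2)) \<partial>leb01)"
    proof (rule nn_integral_mono_AE)
      show "AE x in leb01. ennreal ((cmod (g x))\<^sup>2) \<le> liminf (\<lambda>k. ennreal ((cmod (S (r k) x))\<^sup>2))"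
        using lim
      proof eventually_elim
        case (elim x)
        then have "(\<lambda>k. ennreal ((cmod (S (r k) x))\<^sup>2)) \<longlonglongrightarrow> ennreal ((cmod (g x))\<^sup>2)"
          by (intro tendsto_intros)
        from lim_imp_Liminf[OF sequentially_bot this] show ?case by (simp only: order_refl)
      qed
    qed
    also have "\<dots> \<le> liminf (\<lambda>k. \<integral>\<^sup>+ x. ennreal ((cmod (S (r k) x))\<^sup>2) \<partial>leb01)"
      using L2_measurable[OF S_L2] by (intro nn_integral_liminf) simp
    also have "\<dots> \<le> ennreal (\<Sum>n. (cmod (c n))\<^sup>2)"
    proof (rule Liminf_le)
      show "\<forall>\<^sub>F k in sequentially. (\<integral>\<^sup>+ x. ennreal ((cmod (S (r k) x))\<^sup>2) \<partial>leb01) \<le> ennreal (\<Sum>n. (cmod (c n))\<^sup>2)"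
      proof (intro always_eventually allI)
        fix k
        have "(\<integral>\<^sup>+ x. ennreal ((cmod (S (r k) x))\<^sup>2) \<partial>leb01) = ennreal (\<Sum>n<r k. (cmod (c n))\<^sup>2)"
          using L2_sq_integrable[OF S_L2[of "r k"]] norm_trig_sum[of "{..<r k}" c j]
          by (subst nn_integral_eq_integral) (auto simp: S_def)
        also have "\<dots> \<le> ennreal (\<Sum>n. (cmod (c n))\<^sup>2)"
          by (intro ennreal_leI sum_le_suminf c) auto
        finally show "(\<integral>\<^sup>+ x. ennreal ((cmod (S (r k) x))\<^sup>2) \<partial>leb01) \<le> ennreal (\<Sum>n. (cmod (c n))\<^sup>2)" .
      qed
    qed simp
    finally show "(\<integral>\<^sup>+ x. ennreal (norm ((cmod (g x))\<^sup>2)) \<partial>leb01) < \<infinity>"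
      by (simp add: le_less_trans)
  qed
  then have g_L2: "g \<in> L2" using g_meas by (simp add: L2_def)
  have "(\<lambda>n. c n * trig_coeff j u n) sums (LINT x|leb01. u x * g x)"
    if u: "u \<in> borel_measurable leb01" and B: "\<And>x. cmod (u x) \<le> B" for u B
  proof -
    have u_L2: "u \<in> L2" using u B by (rule L2_bounded)
    have B0: "B \<ge> 0" using B[of 0] norm_ge_zero order_trans by blast
    have uS: "(LINT x|leb01. u x * S N x) = (\<Sum>n<N. c n * trig_coeff j u n)" for N
    proof -
      have "(LINT x|leb01. u x * S N x) = (LINT x|leb01. (\<Sum>n<N. c n * (u x * of_real (trig j (Suc n) x))))"
        by (simp add: S_def sum_distrib_left mult_ac)
      then show ?thesis
        by (simp add: Bochner_Integration.integral_sum trig_coeff_integrable[OF u_L2] trig_coeff_def)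
    qed
    have ui: "integrable leb01 (\<lambda>x. u x * d i x)" for i by (intro L2_mult_integrable u_L2 d_L2)
    have le: "cmod (u x * d i x) \<le> B * cmod (d i x)" for i x
      unfolding norm_mult by (intro mult_right_mono B) auto
    have "(\<lambda>i. LINT x|leb01. u x * d i x) sums (LINT x|leb01. (\<Sum>i. u x * d i x))"
    proof (rule sums_integral[OF ui])
      show "AE x in leb01. summable (\<lambda>i. norm (u x * d i x))"
        using AE_sum
      proof eventually_elim
        case (elim x)
        show ?case by (rule summable_comparison_test'[OF summable_mult[OF elim, of B]]) (use le in auto)
      qed
      show "summable (\<lambda>i. LINT x|leb01. norm (u x * d i x))"
      proof (rule summable_comparison_test'[OF summable_mult[OF sum_d, of B]])
        fix i
        have "(LINT x|leb01. norm (u x * d i x)) \<le> (LINT x|leb01. B * cmod (d i x))"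
          using ui[of i] L2_integrable[OF d_L2[of i]] by (intro integral_mono le) auto
        then show "norm (LINT x|leb01. norm (u x * d i x)) \<le> B * (LINT x|leb01. cmod (d i x))"
          by simp
      qed
    qed
    moreover have "(LINT x|leb01. (\<Sum>i. u x * d i x)) = (LINT x|leb01. u x * (\<Sum>i. d i x))"
    proof (rule integral_cong_AE)
      show "AE x in leb01. (\<Sum>i. u x * d i x) = u x * (\<Sum>i. d i x)"
        using AE_sum by eventually_elim (rule suminf_mult[OF summable_norm_cancel])
      show "(\<lambda>x. \<Sum>i. u x * d i x) \<in> borel_measurable leb01"
        by (intro borel_measurable_suminf borel_measurable_integrable[OF ui])
      show "(\<lambda>x. u x * (\<Sum>i. d i x)) \<in> borel_measurable leb01"
        by (intro borel_measurable_times u borel_measurable_integrable[OF int_sum])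
    qed
    ultimately have "(\<lambda>k. (LINT x|leb01. u x * S (r 0) x) + (\<Sum>i<k. LINT x|leb01. u x * d i x)) \<longlonglongrightarrow>
        (LINT x|leb01. u x * S (r 0) x) + (LINT x|leb01. u x * (\<Sum>i. d i x))"
      unfolding sums_def by (intro tendsto_intros) simp
    moreover have "(LINT x|leb01. u x * S (r 0) x) + (\<Sum>i<k. LINT x|leb01. u x * d i x) = (LINT x|leb01. u x * S (r k) x)" for k
    proof -
      have "(LINT x|leb01. u x * S (r 0) x) + (\<Sum>i<k. LINT x|leb01. u x * d i x) = (LINT x|leb01. u x * S (r 0) x + (\<Sum>i<k. u x * d i x))"
        using ui L2_mult_integrable[OF u_L2 S_L2] by (simp add: Bochner_Integration.integral_sum)
      also have "\<dots> = (LINT x|leb01. u x * S (r k) x)"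
        by (simp only: sum_distrib_left[symmetric] distrib_left[symmetric] S_tel)
      finally show ?thesis .
    qed
    moreover have "(LINT x|leb01. u x * S (r 0) x) + (LINT x|leb01. u x * (\<Sum>i. d i x)) = (LINT x|leb01. u x * g x)"
    proof -
      have "integrable leb01 (\<lambda>x. u x * (\<Sum>i. d i x))"
      proof (rule Bochner_Integration.integrable_bound[of _ "\<lambda>x. B * cmod (\<Sum>i. d i x)"])
        show "integrable leb01 (\<lambda>x. B * cmod (\<Sum>i. d i x))" using int_sum by simp
        show "(\<lambda>x. u x * (\<Sum>i. d i x)) \<in> borel_measurable leb01"
          by (intro borel_measurable_times u borel_measurable_integrable[OF int_sum])
        show "AE x in leb01. norm (u x * (\<Sum>i. d i x)) \<le> norm (B * cmod (\<Sum>i. d i x))"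
          using B B0 by (intro AE_I2) (auto simp: norm_mult intro!: mult_right_mono)
      qed
      then show ?thesis
        using L2_mult_integrable[OF u_L2 S_L2[of "r 0"]] by (simp add: g_def distrib_left)
    qed
    ultimately have sub: "(\<lambda>k. \<Sum>n<r k. c n * trig_coeff j u n) \<longlonglongrightarrow> (LINT x|leb01. u x * g x)"
      by (simp add: uS)
    have "summable (\<lambda>n. c n * trig_coeff j u n)" by (rule summable_product[OF c summable_trig_coeff[OF u_L2]])
    then have full: "(\<lambda>N. \<Sum>n<N. c n * trig_coeff j u n) \<longlonglongrightarrow> (\<Sum>n. c n * trig_coeff j u n)"
      by (rule summable_LIMSEQ)
    have "filterlim r at_top sequentially"
      by (rule filterlim_at_top_mono[OF filterlim_ident]) (use r(1) in auto)
    from filterlim_compose[OF full this] sub have "(\<Sum>n. c n * trig_coeff j u n) = (LINT x|leb01. u x * g x)"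
      by (rule LIMSEQ_unique)
    with full show ?thesis by (simp add: sums_def)
  qed
  with g_L2 show ?thesis by blast
qed

section \<open>Completeness of the sine system\<close>

lemma continuous_L2:
  fixes u :: "real \<Rightarrow> complex"
  assumes "continuous_on UNIV u"
  shows "u \<in> L2"
proof -
  have "bounded (u ` {0..1})"
    by (intro compact_imp_bounded compact_continuous_image continuous_on_subset[OF assms]) auto
  then obtain B where "\<forall>x\<in>{0..1}. norm (u x) \<le> B" by (auto simp: bounded_iff)
  then show ?thesis by (intro L2_bounded[of _ B] continuous_measurable_leb01 assms) auto
qed

lemma L2_mult_continuous_integrable:
  assumes "f \<in> L2" "continuous_on UNIV u"
  shows "integrable leb01 (\<lambda>x. f x * complex_of_real (u x))"
  by (intro L2_mult_integrable assms continuous_L2 continuous_on_of_real)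

text \<open>
  By \<open>2 sin (k y) cos y = sin ((k + 1) y) + sin ((k - 1) y)\<close>, powers of the cosine can be absorbed one by
  one.
\<close>

lemma sine_orthogonal_imp_polynomial_orthogonal:
  assumes f: "f \<in> L2" and zero: "\<And>n. trig_coeff 0 f n = 0"
  shows "(LINT x|leb01. f x * of_real (sin (real k * pi * x) * cos (pi * x) ^ n)) = 0"
proof (induction n arbitrary: k)
  case 0
  show ?case
  proof (cases k)
    case (Suc l)
    have "trig_coeff 0 f l = (LINT x|leb01. of_real (sqrt 2) * (f x * of_real (sin (real k * pi * x) * cos (pi * x) ^ 0)))"
      by (simp add: trig_coeff_def trig_def Suc mult_ac)
    then show ?thesis using zero[of l] by simp
  qed simp
next
  case (Suc n)
  show ?case
  proof (cases k)
    case (Suc l)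
    have "sin (real k * pi * x) * cos (pi * x) ^ Suc n =
        (sin (real (k + 1) * pi * x) * cos (pi * x) ^ n + sin (real l * pi * x) * cos (pi * x) ^ n) / 2" for x
    proof -
      have "sin (real k * pi * x) * cos (pi * x) = (sin (real (k + 1) * pi * x) + sin (real l * pi * x)) / 2"
        unfolding sin_times_cos by (simp add: Suc algebra_simps)
      then show ?thesis by (simp add: mult.assoc[symmetric] distrib_right add_divide_distrib)
    qed
    then have "(LINT x|leb01. f x * of_real (sin (real k * pi * x) * cos (pi * x) ^ Suc n)) =
      (LINT x|leb01. (f x * of_real (sin (real (k + 1) * pi * x) * cos (pi * x) ^ n) +
        f x * of_real (sin (real l * pi * x) * cos (pi * x) ^ n)) / 2)"
      by (simp add: distrib_left add_divide_distrib del: power_Suc)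
    also have "\<dots> = ((LINT x|leb01. f x * of_real (sin (real (k + 1) * pi * x) * cos (pi * x) ^ n)) +
        (LINT x|leb01. f x * of_real (sin (real l * pi * x) * cos (pi * x) ^ n))) / 2"
    proof -
      have i: "integrable leb01 (\<lambda>x. f x * of_real (sin (real m * pi * x) * cos (pi * x) ^ n))" for m
        by (intro L2_mult_continuous_integrable f continuous_intros)
      show ?thesis using Bochner_Integration.integral_add[OF i[of "k + 1"] i[of l]] by simp
    qed
    finally show ?thesis by (simp only: Suc.IH) simp
  qed simp
qed

text \<open>
  Weierstrass approximation of \<open>G\<close> on \<open>[-1, 1]\<close> by polynomials.
\<close>

lemma sine_orthogonal_imp_continuous_orthogonal:
  assumes f: "f \<in> L2" and zero: "\<And>n. trig_coeff 0 f n = 0" and G: "continuous_on UNIV (G :: real \<Rightarrow> real)"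
  shows "(LINT x|leb01. f x * of_real (sin (pi * x) * G (cos (pi * x)))) = 0" (is "?I G = 0")
proof -
  have int: "integrable leb01 (\<lambda>x. f x * of_real (sin (pi * x) * H (cos (pi * x))))" if "continuous_on UNIV H" for H
    by (intro L2_mult_continuous_integrable f continuous_intros continuous_on_compose2[OF that]) auto
  have "norm (?I G) \<le> e * (LINT x|leb01. cmod (f x))" if e: "e > 0" for e
  proof -
    have "continuous_on {-1..1} G" using G continuous_on_subset by blast
    then obtain p where p: "real_polynomial_function p" "\<And>y. y \<in> {-1..1} \<Longrightarrow> \<bar>G y - p y\<bar> < e"
      using Stone_Weierstrass_real_polynomial_function[of "{-1..1}" G e] e by blast
    obtain a n where an: "p = (\<lambda>y. \<Sum>i\<le>n. a i * y ^ i)"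
      using p(1) by (auto simp: real_polynomial_function_iff_sum)
    have p_cont: "continuous_on UNIV p" unfolding an by (intro continuous_intros)
    have "?I p = (LINT x|leb01. (\<Sum>i\<le>n. of_real (a i) * (f x * of_real (sin (real 1 * pi * x) * cos (pi * x) ^ i))))"
      by (simp add: an sum_distrib_left mult_ac)
    also have "\<dots> = (\<Sum>i\<le>n. of_real (a i) * (LINT x|leb01. f x * of_real (sin (real 1 * pi * x) * cos (pi * x) ^ i)))"
    proof -
      have "integrable leb01 (\<lambda>x. f x * of_real (sin (real 1 * pi * x) * cos (pi * x) ^ i))" for i
        by (intro L2_mult_continuous_integrable f continuous_intros)
      then show ?thesis
        by (subst Bochner_Integration.integral_sum) (simp_all del: of_nat_1 of_real_mult)
    qed
    also have "\<dots> = 0" by (simp only: sine_orthogonal_imp_polynomial_orthogonal[OF f zero] mult_zero_right sum.neutral_const)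
    finally have "?I G = ?I G - ?I p" by simp
    also have "\<dots> = (LINT x|leb01. f x * of_real (sin (pi * x) * G (cos (pi * x))) - f x * of_real (sin (pi * x) * p (cos (pi * x))))"
      by (rule Bochner_Integration.integral_diff[symmetric, OF int[OF G] int[OF p_cont]])
    finally have split_int: "?I G = (LINT x|leb01. f x * of_real (sin (pi * x) * G (cos (pi * x))) - f x * of_real (sin (pi * x) * p (cos (pi * x))))" .
    have "norm (?I G) \<le> (LINT x|leb01. norm (f x * of_real (sin (pi * x) * G (cos (pi * x))) - f x * of_real (sin (pi * x) * p (cos (pi * x)))))"
      unfolding split_int by (rule integral_norm_bound)
    also have "\<dots> \<le> (LINT x|leb01. e * cmod (f x))"
    proof (rule integral_mono)
      show "integrable leb01 (\<lambda>x. norm (f x * of_real (sin (pi * x) * G (cos (pi * x))) - f x * of_real (sin (pi * x) * p (cos (pi * x)))))"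
        by (rule integrable_norm[OF Bochner_Integration.integrable_diff[OF int[OF G] int[OF p_cont]]])
      show "integrable leb01 (\<lambda>x. e * cmod (f x))" using L2_integrable[OF f] by simp
      fix x
      have split: "f x * of_real (sin (pi * x) * G (cos (pi * x))) - f x * of_real (sin (pi * x) * p (cos (pi * x))) =
          f x * of_real (sin (pi * x) * (G (cos (pi * x)) - p (cos (pi * x))))"
        by (simp add: algebra_simps)
      have "\<bar>sin (pi * x)\<bar> * \<bar>G (cos (pi * x)) - p (cos (pi * x))\<bar> \<le> 1 * e"
        using p(2)[of "cos (pi * x)"] by (intro mult_mono) auto
      then have "cmod (f x) * (\<bar>sin (pi * x)\<bar> * \<bar>G (cos (pi * x)) - p (cos (pi * x))\<bar>) \<le> cmod (f x) * (1 * e)"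
        by (rule mult_left_mono) simp
      then show "norm (f x * of_real (sin (pi * x) * G (cos (pi * x))) - f x * of_real (sin (pi * x) * p (cos (pi * x)))) \<le> e * cmod (f x)"
        unfolding split norm_mult norm_of_real abs_mult by (simp only: mult_1_left mult.commute[of "cmod (f x)" e])
    qed
    finally show ?thesis by simp
  qed
  then have "norm (?I G) \<le> 0"
  proof -
    assume *: "\<And>e. 0 < e \<Longrightarrow> norm (?I G) \<le> e * (LINT x|leb01. cmod (f x))"
    let ?L = "LINT x|leb01. cmod (f x)"
    have L: "0 \<le> ?L" by simp
    show ?thesis
    proof (rule field_le_epsilon)
      fix e :: real assume "0 < e"
      have pos: "0 < ?L + 1" using L by linarith
      have "norm (?I G) \<le> e / (?L + 1) * ?L" by (intro * divide_pos_pos pos \<open>0 < e\<close>)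
      also have "\<dots> \<le> e / (?L + 1) * (?L + 1)"
        by (rule mult_left_mono) (use pos \<open>0 < e\<close> in \<open>auto simp: less_imp_le\<close>)
      also have "\<dots> = e" using pos by (metis less_irrefl nonzero_eq_divide_eq)
      finally show "norm (?I G) \<le> 0 + e" by simp
    qed
  qed
  then show ?thesis by simp
qed

text \<open>
  The cosine is injective on the interval, so functions of \<open>cos (\<pi> x)\<close> approximate the indicators of all
  subintervals, while the factor \<open>sin (\<pi> x)\<close> has no zero.
\<close>

theorem sine_complete:
  assumes f: "f \<in> L2" and zero: "\<And>n. trig_coeff 0 f n = 0"
  shows "AE x in leb01. f x = 0"
proof -
  have int: "integrable leb01 (\<lambda>x. f x * of_real (sin (pi * x)))"
    by (intro L2_mult_continuous_integrable f continuous_intros)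
  have "AE x in leb01. f x * of_real (sin (pi * x)) = 0"
  proof (rule AE_zero_if_interval_integrals_zero[OF int])
    fix a b :: real assume ab: "0 < a" "a < b" "b < 1"
    define G where "G m y = min 1 (real m * max 0 (min (y - cos (pi * b)) (cos (pi * a) - y)))" for m y
    have G_cont: "continuous_on UNIV (G m)" for m unfolding G_def by (intro continuous_intros)
    have G_bound: "0 \<le> G m y" "G m y \<le> 1" for m y by (auto simp: G_def)
    have G_lim: "(\<lambda>m. G m (cos (pi * x))) \<longlonglongrightarrow> indicator {a<..<b} x" if x: "0 < x" "x < 1" for x
    proof -
      have dec: "cos (pi * y) < cos (pi * z)" if "0 \<le> z" "z < y" "y \<le> 1" for y z
        using that by (intro cos_monotone_0_pi) auto
      have "\<forall>\<^sub>F m in sequentially. G m (cos (pi * x)) = indicator {a<..<b} x"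
      proof (cases "a < x \<and> x < b")
        case True
        define d where "d = min (cos (pi * x) - cos (pi * b)) (cos (pi * a) - cos (pi * x))"
        have "d > 0" using True dec[of x b] dec[of a x] ab x
          unfolding d_def min_less_iff_conj diff_gt_0_iff_gt by simp
        obtain m0 where "real m0 > 1 / d" using reals_Archimedean2 by blast
        have "\<forall>\<^sub>F m in sequentially. m \<ge> m0" by (rule eventually_ge_at_top)
        then show ?thesis
        proof eventually_elim
          case (elim m)
          have "1 = 1 / d * d" using \<open>d > 0\<close> by simp
          also have "\<dots> \<le> real m * d" using \<open>d > 0\<close> elim \<open>real m0 > 1 / d\<close> by (intro mult_right_mono) auto
          finally have "1 \<le> real m * max 0 d" using \<open>d > 0\<close> by simp
          then show ?case unfolding G_def d_def using True by (simp only: min_absorb1) simp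
        qed
      next
        case False
        have "min (cos (pi * x) - cos (pi * b)) (cos (pi * a) - cos (pi * x)) \<le> 0"
        proof (cases "a < x")
          case True
          with False have "b \<le> x" by simp
          then have "cos (pi * x) \<le> cos (pi * b)" using dec[of b x] ab x by (cases "b = x") auto
          then show ?thesis by simp
        next
          case False
          then have "cos (pi * a) \<le> cos (pi * x)" using dec[of x a] ab x by (cases "a = x") auto
          then show ?thesis by simp
        qed
        then have "G m (cos (pi * x)) = 0" for m unfolding G_def by (simp add: max_absorb1)
        then show ?thesis using False by (auto simp: indicator_def)
      qed
      then show ?thesis by (rule tendsto_eventually)
    qed
    have "(\<lambda>m. LINT x|leb01. f x * of_real (sin (pi * x) * G m (cos (pi * x)))) \<longlonglongrightarrow>
        (LINT x|leb01. indicator {a<..<b} x *\<^sub>R (f x * of_real (sin (pi * x))))"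
    proof (rule integral_dominated_convergence[where w = "\<lambda>x. cmod (f x)"])
      show "(\<lambda>x. indicator {a<..<b} x *\<^sub>R (f x * of_real (sin (pi * x)))) \<in> borel_measurable leb01"
        by (intro borel_measurable_scaleR borel_measurable_leb01 borel_measurable_integrable[OF int]) simp
      show "(\<lambda>x. f x * of_real (sin (pi * x) * G m (cos (pi * x)))) \<in> borel_measurable leb01" for m
        by (intro borel_measurable_integrable L2_mult_continuous_integrable f continuous_intros
            continuous_on_compose2[OF G_cont]) auto
      show "integrable leb01 (\<lambda>x. cmod (f x))" using L2_integrable[OF f] by simp
      show "AE x in leb01. (\<lambda>m. f x * of_real (sin (pi * x) * G m (cos (pi * x)))) \<longlonglongrightarrow>
          indicator {a<..<b} x *\<^sub>R (f x * of_real (sin (pi * x)))"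
      proof (rule AE_leb01I)
        fix x :: real assume "0 < x" "x < 1"
        then have "(\<lambda>m. f x * of_real (sin (pi * x) * G m (cos (pi * x)))) \<longlonglongrightarrow> f x * of_real (sin (pi * x) * indicator {a<..<b} x)"
          by (intro tendsto_intros G_lim)
        then show "(\<lambda>m. f x * of_real (sin (pi * x) * G m (cos (pi * x)))) \<longlonglongrightarrow> indicator {a<..<b} x *\<^sub>R (f x * of_real (sin (pi * x)))"
          by (simp add: scaleR_conv_of_real mult_ac)
      qed
      show "AE x in leb01. norm (f x * of_real (sin (pi * x) * G m (cos (pi * x)))) \<le> cmod (f x)" for m
      proof (intro AE_I2)
        fix x
        have "\<bar>sin (pi * x)\<bar> * \<bar>G m (cos (pi * x))\<bar> \<le> 1 * 1"
          using G_bound[of m "cos (pi * x)"] by (intro mult_mono) auto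
        then show "norm (f x * of_real (sin (pi * x) * G m (cos (pi * x)))) \<le> cmod (f x)"
          by (simp only: norm_mult norm_of_real abs_mult mult_1_right mult_left_le norm_ge_zero)
      qed
    qed
    then show "(LINT x|leb01. indicator {a<..<b} x *\<^sub>R (f x * of_real (sin (pi * x)))) = 0"
      unfolding sine_orthogonal_imp_continuous_orthogonal[OF f zero G_cont] by (simp add: LIMSEQ_const_iff)
  qed
  moreover have "AE x in leb01. 0 < sin (pi * x)"
    by (rule AE_leb01I) (simp add: sin_gt_zero)
  ultimately show ?thesis by eventually_elim auto
qed

lemma trig_coeff_trig: "trig_coeff j (\<lambda>x. of_real (trig j (Suc m) x)) n = (if m = n then 1 else 0)"
proof -
  have "trig_coeff j (\<lambda>x. of_real (trig j (Suc m) x)) n = (LINT x|leb01. of_real (trig j (Suc m) x * trig j (Suc n) x))"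
    by (simp add: trig_coeff_def)
  also have "\<dots> = of_real (LINT x|leb01. trig j (Suc m) x * trig j (Suc n) x)"
    by (rule integral_of_real) (use L2_mult_integrable[OF L2_trig L2_trig, of j "Suc m" j "Suc n"] integrable_Re in force)
  finally show ?thesis by (simp add: trig_orthonormal)
qed

lemma riesz_fischer_coeff:
  assumes "summable (\<lambda>n. (cmod (c n))\<^sup>2)"
  shows "\<exists>g\<in>L2. (\<forall>m. trig_coeff j g m = c m) \<and>
    (\<forall>u\<in>borel_measurable leb01. (\<exists>B. \<forall>x. cmod (u x) \<le> B) \<longrightarrow>
      (\<lambda>n. c n * trig_coeff j u n) sums (LINT x|leb01. u x * g x))"
proof -
  obtain g where g: "g \<in> L2" "\<And>u. u \<in> borel_measurable leb01 \<Longrightarrow> \<exists>B. \<forall>x. cmod (u x) \<le> B \<Longrightarrow>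
      (\<lambda>n. c n * trig_coeff j u n) sums (LINT x|leb01. u x * g x)"
    using riesz_fischer[OF assms, of j] by blast
  have "trig_coeff j g m = c m" for m
  proof (rule sums_unique2)
    have "(\<lambda>n. c n * trig_coeff j (\<lambda>x. of_real (trig j (Suc m) x)) n) sums (LINT x|leb01. of_real (trig j (Suc m) x) * g x)"
      by (rule g(2)[OF measurable_trig]) (use trig_bound[of j "Suc m"] in \<open>auto intro!: exI[of _ 2]\<close>)
    then show "(\<lambda>n. if n = m then c n else 0) sums trig_coeff j g m"
    proof -
      assume "(\<lambda>n. c n * trig_coeff j (\<lambda>x. of_real (trig j (Suc m) x)) n) sums (LINT x|leb01. of_real (trig j (Suc m) x) * g x)"
      moreover have "(\<lambda>n. c n * (if m = n then 1 else 0)) = (\<lambda>n. if n = m then c n else 0)" by auto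
      ultimately show ?thesis unfolding trig_coeff_trig trig_coeff_def[of j g] by (simp only: mult.commute)
    qed
    show "(\<lambda>n. if n = m then c n else 0) sums c m" by (rule sums_single)
  qed
  with g show ?thesis by blast
qed

lemma ae_eq_if_same_coeff:
  assumes "f \<in> L2" "g \<in> L2" "\<And>n. trig_coeff 0 f n = trig_coeff 0 g n"
  shows "ae_eq f g"
proof -
  have "trig_coeff 0 (\<lambda>x. f x - g x) n = 0" for n
    using assms trig_coeff_integrable[of f 0 "Suc n"] trig_coeff_integrable[of g 0 "Suc n"]
    by (simp add: trig_coeff_def left_diff_distrib)
  from sine_complete[OF L2_diff[OF assms(1,2)] this] show ?thesis
    unfolding ae_eq_def by eventually_elim simp
qed

lemma trig_coeff_cong:
  assumes "ae_eq f g" "f \<in> L2" "g \<in> L2"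
  shows "trig_coeff j f n = trig_coeff j g n"
  unfolding trig_coeff_def
proof (rule integral_cong_AE)
  show "AE x in leb01. f x * of_real (trig j (Suc n) x) = g x * of_real (trig j (Suc n) x)"
    using assms(1) unfolding ae_eq_def by eventually_elim simp
qed (auto intro!: borel_measurable_integrable trig_coeff_integrable assms)

text \<open>
  The function that Riesz-Fischer yields for the sine coefficients of \<open>f\<close> is \<open>f\<close> itself, by
  completeness.
\<close>

lemma sine_expansion:
  assumes f: "f \<in> L2" and u: "u \<in> borel_measurable leb01" "\<And>x. cmod (u x) \<le> B"
  shows "(\<lambda>n. trig_coeff 0 f n * trig_coeff 0 u n) sums (LINT x|leb01. u x * f x)"
proof -
  obtain g where g: "g \<in> L2" "\<And>m. trig_coeff 0 g m = trig_coeff 0 f m"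
    "(\<lambda>n. trig_coeff 0 f n * trig_coeff 0 u n) sums (LINT x|leb01. u x * g x)"
    using riesz_fischer_coeff[OF summable_trig_coeff[OF f], of 0 0] u by blast
  have ae: "ae_eq g f" by (rule ae_eq_if_same_coeff[OF g(1) f g(2)])
  have "(LINT x|leb01. u x * g x) = (LINT x|leb01. u x * f x)"
  proof (rule integral_cong_AE)
    show "AE x in leb01. u x * g x = u x * f x"
      using ae unfolding ae_eq_def by eventually_elim simp
    show "(\<lambda>x. u x * g x) \<in> borel_measurable leb01" by (rule borel_measurable_times[OF u(1) L2_measurable[OF g(1)]])
    show "(\<lambda>x. u x * f x) \<in> borel_measurable leb01" by (rule borel_measurable_times[OF u(1) L2_measurable[OF f]])
  qed
  with g(3) show ?thesis by simp
qed

section \<open>Smooth functions and test functions\<close>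

text \<open>
  The regularity required of test functions, without the condition on the support.
\<close>

definition smooth :: "(real \<Rightarrow> real) \<Rightarrow> bool"
  where "smooth f \<longleftrightarrow> (\<forall>n x. (deriv ^^ n) f differentiable at x)"

text \<open>
  A class of differentiable functions that is closed under taking derivatives consists of smooth
  functions. This replaces all inductions on the order of the derivative.
\<close>

lemma smooth_coinduct:
  assumes "P f" and step: "\<And>f. P f \<Longrightarrow> (\<forall>x. f differentiable at x) \<and> P (deriv f)"
  shows "smooth f"
proof -
  have "P ((deriv ^^ n) f)" for n
    by (induction n) (use assms(1) step in auto)
  then show ?thesis using step by (auto simp: smooth_def)
qed

lemma smooth_differentiable: "smooth f \<Longrightarrow> f differentiable at x"
  unfolding smooth_def by (metis funpow_0)

lemma smooth_deriv: "smooth f \<Longrightarrow> smooth (deriv f)"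
  unfolding smooth_def by (metis comp_apply funpow_Suc_right)

lemma smooth_has_deriv: "smooth f \<Longrightarrow> (f has_real_derivative deriv f x) (at x)"
  using smooth_differentiable[of f x]
  by (simp add: DERIV_deriv_iff_real_differentiable)

lemma smooth_continuous: "smooth f \<Longrightarrow> continuous_on A f"
  by (meson differentiable_imp_continuous_within continuous_at_imp_continuous_on smooth_differentiable)

text \<open>
  The closure of the smooth functions under the operations for which there is a rule of
  differentiation. It is closed under derivatives, so its members are smooth.
\<close>

inductive smooth_combination :: "(real \<Rightarrow> real) \<Rightarrow> bool" where
  base: "smooth f \<Longrightarrow> smooth_combination f"
| add: "smooth_combination f \<Longrightarrow> smooth_combination g \<Longrightarrow> smooth_combination (\<lambda>x. f x + g x)"
| mult: "smooth_combination f \<Longrightarrow> smooth_combination g \<Longrightarrow> smooth_combination (\<lambda>x. f x * g x)"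
| affine: "smooth_combination f \<Longrightarrow> smooth_combination (\<lambda>x. a * f (b * x + c))"

lemma smooth_combination_deriv:
  "smooth_combination f \<Longrightarrow> \<exists>f'. (\<forall>x. (f has_real_derivative f' x) (at x)) \<and> smooth_combination f'"
proof (induction rule: smooth_combination.induct)
  case (base f)
  then show ?case using smooth_has_deriv smooth_deriv smooth_combination.base by blast
next
  case (add f g)
  then obtain f' g' where "\<forall>x. (f has_real_derivative f' x) (at x)" "smooth_combination f'"
    "\<forall>x. (g has_real_derivative g' x) (at x)" "smooth_combination g'" by blast
  then show ?case
    by (intro exI[of _ "\<lambda>x. f' x + g' x"]) (auto intro!: derivative_intros smooth_combination.add)
next
  case (mult f g)
  then obtain f' g' where "\<forall>x. (f has_real_derivative f' x) (at x)" "smooth_combination f'"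
    "\<forall>x. (g has_real_derivative g' x) (at x)" "smooth_combination g'" by blast
  with mult.hyps show ?case
    by (intro exI[of _ "\<lambda>x. f' x * g x + g' x * f x"])
      (auto intro!: DERIV_mult smooth_combination.add smooth_combination.mult)
next
  case (affine f a b c)
  then obtain f' where f': "\<forall>x. (f has_real_derivative f' x) (at x)" "smooth_combination f'" by blast
  have "((\<lambda>x. a * f (b * x + c)) has_real_derivative (a * b) * f' (b * x + c)) (at x)" for x
  proof -
    have "((\<lambda>x. f (b * x + c)) has_real_derivative f' (b * x + c) * b) (at x)"
      by (rule DERIV_chain2[of f]) (use f' in \<open>auto intro!: derivative_eq_intros\<close>)
    from DERIV_cmult[OF this, of a] show ?thesis by (simp add: mult_ac)
  qed
  then show ?case
    using f'(2) by (intro exI[of _ "\<lambda>x. (a * b) * f' (b * x + c)"]) (auto intro!: smooth_combination.affine)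
qed

lemma smooth_combination_smooth: "smooth_combination f \<Longrightarrow> smooth f"
proof (erule smooth_coinduct)
  fix f assume "smooth_combination f"
  then obtain f' where f': "\<And>x. (f has_real_derivative f' x) (at x)" "smooth_combination f'"
    using smooth_combination_deriv by blast
  then have "deriv f = f'" by (intro ext DERIV_imp_deriv)
  with f' show "(\<forall>x. f differentiable at x) \<and> smooth_combination (deriv f)"
    by (auto simp: real_differentiable_def)
qed

lemma smooth_add: "smooth f \<Longrightarrow> smooth g \<Longrightarrow> smooth (\<lambda>x. f x + g x)"
  by (rule smooth_combination_smooth[OF smooth_combination.add[OF smooth_combination.base smooth_combination.base]])

lemma smooth_mult: "smooth f \<Longrightarrow> smooth g \<Longrightarrow> smooth (\<lambda>x. f x * g x)"
  by (rule smooth_combination_smooth[OF smooth_combination.mult[OF smooth_combination.base smooth_combination.base]])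

lemma smooth_affine: "smooth f \<Longrightarrow> smooth (\<lambda>x. a * f (b * x + c))"
  by (rule smooth_combination_smooth[OF smooth_combination.affine[OF smooth_combination.base]])

lemma smooth_trig: "smooth (trig j k)"
proof (rule smooth_coinduct[where P = "\<lambda>f. \<exists>c j. f = (\<lambda>x. c * trig j k x)"])
  show "\<exists>c j'. trig j k = (\<lambda>x. c * trig j' k x)" by (rule exI[of _ 1]) auto
  fix f assume "\<exists>c j. f = (\<lambda>x. c * trig j k x)"
  then obtain c j where f: "f = (\<lambda>x. c * trig j k x)" by blast
  have d: "(f has_real_derivative (c * (real k * pi)) * trig (Suc j) k x) (at x)" for x
    unfolding f using DERIV_cmult[OF trig_deriv] by (simp add: mult.assoc)
  then have "deriv f = (\<lambda>x. (c * (real k * pi)) * trig (Suc j) k x)" by (intro ext DERIV_imp_deriv)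
  with d show "(\<forall>x. f differentiable at x) \<and> (\<exists>c j. deriv f = (\<lambda>x. c * trig j k x))"
    by (auto simp: real_differentiable_def)
qed

definition flat_exp :: "real \<Rightarrow> real"
  where "flat_exp x = (if x > 0 then exp (- 1 / x) else 0)"

lemma poly_times_exp_tendsto_zero: "((\<lambda>y. y ^ k * poly r y * exp (- y)) \<longlongrightarrow> (0 :: real)) at_top"
proof (induction r arbitrary: k)
  case (pCons a p)
  have "((\<lambda>y. a * (y ^ k / exp y) + y ^ Suc k * poly p y * exp (- y)) \<longlongrightarrow> a * 0 + 0) at_top"
    by (intro tendsto_add tendsto_mult tendsto_const tendsto_power_div_exp_0 pCons.IH)
  then show ?case by (simp add: algebra_simps exp_minus divide_inverse)
qed simp

lemma smooth_flat_exp: "smooth flat_exp"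
proof (rule smooth_coinduct[where P = "\<lambda>f. \<exists>p. f = (\<lambda>x. if x > 0 then poly p (1 / x) * exp (- 1 / x) else 0)"])
  show "\<exists>p. flat_exp = (\<lambda>x. if x > 0 then poly p (1 / x) * exp (- 1 / x) else 0)"
    by (rule exI[of _ 1]) (auto simp: flat_exp_def)
  fix f :: "real \<Rightarrow> real"
  assume "\<exists>p. f = (\<lambda>x. if x > 0 then poly p (1 / x) * exp (- 1 / x) else 0)"
  then obtain p where f: "f = (\<lambda>x. if x > 0 then poly p (1 / x) * exp (- 1 / x) else 0)" by blast
  define q where "q = [:0, 0, 1:] * (p - pderiv p)"
  have d: "(f has_real_derivative (if x > 0 then poly q (1 / x) * exp (- 1 / x) else 0)) (at x)" for x
  proof -
    consider "x > 0" | "x < 0" | "x = 0" by linarith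
    then show ?thesis
    proof cases
      case 1
      have "((\<lambda>x. poly p (1 / x) * exp (- 1 / x)) has_real_derivative poly q (1 / x) * exp (- 1 / x)) (at x)"
      proof -
        have "((\<lambda>x. poly p (1 / x)) has_real_derivative poly (pderiv p) (1 / x) * (- 1 / x\<^sup>2)) (at x)"
          by (rule DERIV_chain2[OF poly_DERIV]) (use 1 in \<open>auto intro!: derivative_eq_intros simp: power2_eq_square\<close>)
        moreover have "((\<lambda>x. exp (- 1 / x)) has_real_derivative exp (- 1 / x) * (1 / x\<^sup>2)) (at x)"
          using 1 by (auto intro!: derivative_eq_intros simp: power2_eq_square)
        ultimately have "((\<lambda>x. poly p (1 / x) * exp (- 1 / x)) has_real_derivative
            poly (pderiv p) (1 / x) * (- 1 / x\<^sup>2) * exp (- 1 / x) + exp (- 1 / x) * (1 / x\<^sup>2) * poly p (1 / x)) (at x)"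
          by (rule DERIV_mult)
        moreover have "poly (pderiv p) (1 / x) * (- 1 / x\<^sup>2) * exp (- 1 / x) + exp (- 1 / x) * (1 / x\<^sup>2) * poly p (1 / x) = poly q (1 / x) * exp (- 1 / x)"
          by (simp add: q_def power2_eq_square algebra_simps)
        ultimately show ?thesis by simp
      qed
      then have "(f has_real_derivative poly q (1 / x) * exp (- 1 / x)) (at x)"
        by (rule has_field_derivative_transform_within_open[where S = "{0<..}"]) (use 1 in \<open>auto simp: f\<close>)
      then show ?thesis using 1 by simp
    next
      case 2
      have "((\<lambda>x. 0) has_real_derivative 0) (at x)" by simp
      then have "(f has_real_derivative 0) (at x)"
        by (rule has_field_derivative_transform_within_open[where S = "{..<0}"]) (use 2 in \<open>auto simp: f\<close>)
      then show ?thesis using 2 by simp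
    next
      case 3
      have "((\<lambda>h. (f (0 + h) - f 0) / h) \<longlongrightarrow> 0) (at 0)"
        unfolding filterlim_at_split
      proof
        show "((\<lambda>h. (f (0 + h) - f 0) / h) \<longlongrightarrow> 0) (at_left 0)"
          by (rule tendsto_eventually) (auto simp: f eventually_at_filter)
        have "((\<lambda>h. inverse h ^ 1 * poly p (inverse h) * exp (- inverse h)) \<longlongrightarrow> 0) (at_right 0)"
          by (rule filterlim_compose[OF poly_times_exp_tendsto_zero filterlim_inverse_at_top_right])
        then show "((\<lambda>h. (f (0 + h) - f 0) / h) \<longlongrightarrow> 0) (at_right 0)"
          by (rule Lim_transform_eventually) (auto simp: f eventually_at_filter divide_inverse mult_ac)
      qed
      then show ?thesis using 3 by (simp add: DERIV_def)
    qed
  qed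
  then have "deriv f = (\<lambda>x. if x > 0 then poly q (1 / x) * exp (- 1 / x) else 0)"
    by (intro ext DERIV_imp_deriv)
  with d show "(\<forall>x. f differentiable at x) \<and> (\<exists>p. deriv f = (\<lambda>x. if x > 0 then poly p (1 / x) * exp (- 1 / x) else 0))"
    by (auto simp: real_differentiable_def)
qed

text \<open>
  For \<open>m\<close> tending to infinity this smooth function tends to the indicator of \<open>{a<..<b}\<close>, and it stays
  between 0 and 1.
\<close>

definition bump :: "real \<Rightarrow> real \<Rightarrow> real \<Rightarrow> real \<Rightarrow> real"
  where "bump m a b x = flat_exp (m * (x - a)) * flat_exp (m * (b - x))"

lemma flat_exp_bounds: "0 \<le> flat_exp x" "flat_exp x \<le> 1"
  by (auto simp: flat_exp_def)

lemma smooth_bump: "smooth (bump m a b)"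
proof -
  have "smooth (\<lambda>x. (1 * flat_exp (m * x + - (m * a))) * (1 * flat_exp (- m * x + m * b)))"
    by (intro smooth_mult smooth_affine smooth_flat_exp)
  then show ?thesis by (simp add: bump_def[abs_def] algebra_simps)
qed

lemma bump_bounds: "0 \<le> bump m a b x" "bump m a b x \<le> 1"
  unfolding bump_def by (rule mult_nonneg_nonneg mult_le_one; rule flat_exp_bounds)+

lemma bump_support: "m > 0 \<Longrightarrow> x \<notin> {a<..<b} \<Longrightarrow> bump m a b x = 0"
  by (auto simp: bump_def flat_exp_def zero_less_mult_iff)

lemma bump_test: "m > 0 \<Longrightarrow> 0 < a \<Longrightarrow> b < 1 \<Longrightarrow> bump m a b \<in> test_functions"
  using smooth_bump[of m a b] bump_support[of m _ a b] unfolding test_functions_def smooth_def by fastforce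

lemma flat_exp_limit: "x > 0 \<Longrightarrow> (\<lambda>n. flat_exp (real (Suc n) * x)) \<longlonglongrightarrow> 1"
proof -
  assume x: "x > 0"
  have "(\<lambda>n. exp (- (inverse (real (Suc n)) / x))) \<longlonglongrightarrow> exp (- (0 / x))"
    using x by (intro tendsto_intros LIMSEQ_inverse_real_of_nat) auto
  moreover have "flat_exp (real (Suc n) * x) = exp (- (inverse (real (Suc n)) / x))" for n
    using x by (simp add: flat_exp_def divide_inverse zero_less_mult_iff mult_ac del: of_nat_Suc)
  ultimately show ?thesis by simp
qed

lemma bump_limit: "(\<lambda>n. bump (real (Suc n)) a b x) \<longlonglongrightarrow> indicator {a<..<b} x"
proof (cases "x \<in> {a<..<b}")
  case True
  then have "(\<lambda>n. bump (real (Suc n)) a b x) \<longlonglongrightarrow> 1 * 1"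
    unfolding bump_def by (intro tendsto_mult flat_exp_limit) auto
  then show ?thesis using True by simp
next
  case False
  then show ?thesis by (simp add: bump_support del: greaterThanLessThan_iff)
qed

text \<open>
  The bumps approximate the indicators of all intervals whose closure is contained in \<open>{0<..<1}\<close>.
\<close>

theorem fundamental_lemma_calculus_of_variations:
  fixes g :: "real \<Rightarrow> complex"
  assumes g: "integrable leb01 g" and zero: "\<And>\<eta>. \<eta> \<in> test_functions \<Longrightarrow> (LINT x|leb01. \<eta> x *\<^sub>R g x) = 0"
  shows "AE x in leb01. g x = 0"
proof (rule AE_zero_if_interval_integrals_zero[OF g])
  fix a b :: real assume ab: "0 < a" "a < b" "b < 1"
  have meas: "(\<lambda>x. \<eta> x *\<^sub>R g x) \<in> borel_measurable leb01" if "\<eta> \<in> borel_measurable borel" for \<eta> :: "real \<Rightarrow> real"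
    by (intro borel_measurable_scaleR borel_measurable_leb01 that borel_measurable_integrable[OF g])
  have "(\<lambda>n. LINT x|leb01. bump (real (Suc n)) a b x *\<^sub>R g x) \<longlonglongrightarrow> (LINT x|leb01. indicator {a<..<b} x *\<^sub>R g x)"
  proof (rule integral_dominated_convergence[where w = "\<lambda>x. norm (g x)"])
    show "(\<lambda>x. bump (real (Suc n)) a b x *\<^sub>R g x) \<in> borel_measurable leb01" for n
      by (intro meas borel_measurable_continuous_onI smooth_continuous smooth_bump)
    show "AE x in leb01. norm (bump (real (Suc n)) a b x *\<^sub>R g x) \<le> norm (g x)" for n
      using bump_bounds[of "real (Suc n)" a b] by (intro AE_I2) (simp add: mult_left_le_one_le)
    show "AE x in leb01. (\<lambda>n. bump (real (Suc n)) a b x *\<^sub>R g x) \<longlonglongrightarrow> indicator {a<..<b} x *\<^sub>R g x"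
      by (intro AE_I2 tendsto_scaleR bump_limit tendsto_const)
  qed (use g in \<open>auto intro!: meas\<close>)
  moreover have "(LINT x|leb01. bump (real (Suc n)) a b x *\<^sub>R g x) = 0" for n
    using ab by (intro zero bump_test) auto
  ultimately show "(LINT x|leb01. indicator {a<..<b} x *\<^sub>R g x) = 0"
    by (simp add: LIMSEQ_const_iff)
qed

section \<open>Weak derivatives of sine series\<close>

lemma test_smooth: "\<eta> \<in> test_functions \<Longrightarrow> smooth \<eta>"
  by (simp add: test_functions_def smooth_def)

lemma test_boundary: "\<eta> \<in> test_functions \<Longrightarrow> \<eta> 0 = 0" "\<eta> \<in> test_functions \<Longrightarrow> \<eta> 1 = 0"
  by (fastforce simp: test_functions_def)+

lemma testI:
  assumes "smooth \<eta>" "0 < a" "b < 1" "\<And>x. x \<notin> {a..b} \<Longrightarrow> \<eta> x = 0"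
  shows "\<eta> \<in> test_functions"
  using assms by (auto simp: test_functions_def smooth_def)

lemma test_support:
  assumes "\<eta> \<in> test_functions"
  obtains a b where "0 < a" "b < 1" "\<And>x. x \<notin> {a..b} \<Longrightarrow> \<eta> x = 0"
  using assms by (auto simp: test_functions_def)

lemma test_mult_smooth:
  assumes "\<eta> \<in> test_functions" "smooth w"
  shows "(\<lambda>x. \<eta> x * w x) \<in> test_functions"
proof -
  obtain a b where "0 < a" "b < 1" "\<And>x. x \<notin> {a..b} \<Longrightarrow> \<eta> x = 0"
    using test_support[OF assms(1)] by blast
  then show ?thesis by (intro testI[of _ a b, OF smooth_mult[OF test_smooth[OF assms(1)] assms(2)]]) auto
qed

lemma test_deriv:
  assumes "\<eta> \<in> test_functions"
  shows "deriv \<eta> \<in> test_functions"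
proof -
  obtain a b where ab: "0 < a" "b < 1" "\<And>x. x \<notin> {a..b} \<Longrightarrow> \<eta> x = 0"
    using test_support[OF assms] by blast
  have "deriv \<eta> x = 0" if "x \<notin> {a..b}" for x
  proof -
    have "((\<lambda>x. 0) has_real_derivative 0) (at x)" by simp
    then have "(\<eta> has_real_derivative 0) (at x)"
      by (rule has_field_derivative_transform_within_open[where S = "- {a..b}"]) (use that ab(3) in auto)
    then show ?thesis by (rule DERIV_imp_deriv)
  qed
  then show ?thesis by (intro testI[of _ a b, OF smooth_deriv[OF test_smooth[OF assms]]] ab)
qed

lemma test_funpow: "\<eta> \<in> test_functions \<Longrightarrow> (deriv ^^ n) \<eta> \<in> test_functions"
  by (induction n) (auto intro: test_deriv)

lemma smooth_integrable:
  assumes "smooth w" "f \<in> L2"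
  shows "integrable leb01 (\<lambda>x. w x *\<^sub>R f x)"
  using L2_mult_continuous_integrable[OF assms(2) smooth_continuous[OF assms(1)]]
  by (simp add: scaleR_conv_of_real mult.commute)

lemma smooth_real_integrable:
  assumes "smooth w" "smooth v"
  shows "integrable leb01 (\<lambda>x. w x * v x)"
proof -
  have "continuous_on UNIV (\<lambda>x. complex_of_real (w x))" by (intro continuous_intros smooth_continuous assms)
  from integrable_Re[OF smooth_integrable[OF assms(2) continuous_L2[OF this]]]
  show ?thesis by (simp add: mult.commute)
qed

lemma test_integration_by_parts:
  assumes \<eta>: "\<eta> \<in> test_functions" and w: "smooth w"
  shows "(LINT x|leb01. deriv \<eta> x * w x) = - (LINT x|leb01. \<eta> x * deriv w x)"
proof -
  note s = test_smooth[OF \<eta>]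
  have "(LINT x|leb01. deriv \<eta> x * w x + \<eta> x * deriv w x) = \<eta> 1 * w 1 - \<eta> 0 * w 0"
  proof (rule leb01_FTC)
    show "((\<lambda>x. \<eta> x * w x) has_vector_derivative deriv \<eta> x * w x + \<eta> x * deriv w x) (at x)" for x
      unfolding has_real_derivative_iff_has_vector_derivative[symmetric]
      using DERIV_mult[OF smooth_has_deriv[OF s, of x] smooth_has_deriv[OF w, of x]] by (simp add: mult_ac)
    show "continuous_on UNIV (\<lambda>x. deriv \<eta> x * w x + \<eta> x * deriv w x)"
      by (intro continuous_intros smooth_continuous smooth_deriv s w)
  qed
  moreover have "(LINT x|leb01. deriv \<eta> x * w x + \<eta> x * deriv w x) = (LINT x|leb01. deriv \<eta> x * w x) + (LINT x|leb01. \<eta> x * deriv w x)"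
    by (intro Bochner_Integration.integral_add smooth_real_integrable smooth_deriv s w)
  ultimately show ?thesis using test_boundary[OF \<eta>] by simp
qed

lemma deriv_trig: "deriv (trig j k) = (\<lambda>x. real k * pi * trig (Suc j) k x)"
  by (intro ext DERIV_imp_deriv trig_deriv)

lemma test_trig_by_parts:
  assumes "\<eta> \<in> test_functions"
  shows "(LINT x|leb01. (deriv ^^ i) \<eta> x * trig j k x) = (- 1) ^ i * (real k * pi) ^ i * (LINT x|leb01. \<eta> x * trig (j + i) k x)"
  using assms
proof (induction i arbitrary: j)
  case (Suc i)
  have "(LINT x|leb01. (deriv ^^ Suc i) \<eta> x * trig j k x) = - (LINT x|leb01. (deriv ^^ i) \<eta> x * deriv (trig j k) x)"
    using test_integration_by_parts[OF test_funpow[OF Suc.prems] smooth_trig] by simp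
  also have "\<dots> = - (real k * pi) * (LINT x|leb01. (deriv ^^ i) \<eta> x * trig (Suc j) k x)"
    unfolding deriv_trig by (simp add: mult.left_commute[of _ "real k * pi"])
  finally show ?case using Suc.IH[OF Suc.prems, of "Suc j"] by (simp add: mult_ac)
qed simp

lemma trig_coeff_real:
  assumes "continuous_on UNIV u"
  shows "trig_coeff j (\<lambda>x. of_real (u x)) n = of_real (LINT x|leb01. u x * trig j (Suc n) x)"
proof -
  have "trig_coeff j (\<lambda>x. of_real (u x)) n = (LINT x|leb01. of_real (u x * trig j (Suc n) x))"
    by (simp add: trig_coeff_def)
  also have "\<dots> = of_real (LINT x|leb01. u x * trig j (Suc n) x)"
  proof (rule integral_of_real)
    have "continuous_on UNIV (\<lambda>x. complex_of_real (u x))" by (intro continuous_intros assms)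
    from integrable_Re[OF trig_coeff_integrable[OF continuous_L2[OF this]]]
    show "integrable leb01 (\<lambda>x. u x * trig j (Suc n) x)" by simp
  qed
  finally show ?thesis .
qed

lemma weak_deriv_eq:
  "weak_deriv j f g \<longleftrightarrow> (\<forall>\<eta>\<in>test_functions.
     (LINT x|leb01. of_real ((deriv ^^ j) \<eta> x) * f x) = (- 1) ^ j * (LINT x|leb01. of_real (\<eta> x) * g x))"
  by (simp add: weak_deriv_def scaleR_conv_of_real)

lemma test_measurable_bounded:
  assumes "\<eta> \<in> test_functions"
  shows "(\<lambda>x. complex_of_real (\<eta> x)) \<in> borel_measurable leb01" "\<exists>B. \<forall>x. cmod (of_real (\<eta> x)) \<le> B"
proof -
  have c: "continuous_on A \<eta>" for A by (rule smooth_continuous[OF test_smooth[OF assms]])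
  show "(\<lambda>x. complex_of_real (\<eta> x)) \<in> borel_measurable leb01"
    by (intro continuous_measurable_leb01 continuous_on_of_real c)
  obtain a b where ab: "\<And>x. x \<notin> {a..b} \<Longrightarrow> \<eta> x = 0" using test_support[OF assms] by metis
  have "bounded (\<eta> ` {a..b})" by (intro compact_imp_bounded compact_continuous_image c compact_Icc)
  then obtain B where B: "\<forall>x\<in>{a..b}. norm (\<eta> x) \<le> B" by (auto simp: bounded_iff)
  have "cmod (of_real (\<eta> x)) \<le> \<bar>B\<bar>" for x
    using ab[of x] B by (cases "x \<in> {a..b}") force+
  then show "\<exists>B. \<forall>x. cmod (of_real (\<eta> x)) \<le> B" by blast
qed

text \<open>Termwise differentiation of a sine series; \<open>trig i k\<close> is the normalised \<open>i\<close>-th derivative of \<open>trig 0 k\<close>.\<close>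

lemma sine_series_weak_deriv:
  assumes f: "f \<in> L2" and s: "summable (\<lambda>n. (cmod (of_real ((real (Suc n) * pi) ^ i) * trig_coeff 0 f n))\<^sup>2)"
  shows "\<exists>g\<in>L2. weak_deriv i f g \<and> (\<forall>n. trig_coeff i g n = of_real ((real (Suc n) * pi) ^ i) * trig_coeff 0 f n)"
proof -
  obtain g where g: "g \<in> L2" "\<forall>n. trig_coeff i g n = of_real ((real (Suc n) * pi) ^ i) * trig_coeff 0 f n"
    and sums: "\<And>u. u \<in> borel_measurable leb01 \<Longrightarrow> \<exists>B. \<forall>x. cmod (u x) \<le> B \<Longrightarrow>
      (\<lambda>n. of_real ((real (Suc n) * pi) ^ i) * trig_coeff 0 f n * trig_coeff i u n) sums (LINT x|leb01. u x * g x)"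
    using riesz_fischer_coeff[OF s, of i] by blast
  have "weak_deriv i f g"
    unfolding weak_deriv_eq
  proof
    fix \<eta> assume \<eta>: "\<eta> \<in> test_functions"
    note cont = smooth_continuous[OF test_smooth]
    have coeff: "trig_coeff 0 (\<lambda>x. of_real ((deriv ^^ i) \<eta> x)) n =
        (- 1) ^ i * of_real ((real (Suc n) * pi) ^ i) * trig_coeff i (\<lambda>x. of_real (\<eta> x)) n" for n
      unfolding trig_coeff_real[OF cont[OF test_funpow[OF \<eta>]]] trig_coeff_real[OF cont[OF \<eta>]] test_trig_by_parts[OF \<eta>]
      by simp
    obtain B where "\<forall>x. cmod (of_real ((deriv ^^ i) \<eta> x)) \<le> B" using test_measurable_bounded(2)[OF test_funpow[OF \<eta>]] by blast
    then have "(\<lambda>n. trig_coeff 0 f n * trig_coeff 0 (\<lambda>x. of_real ((deriv ^^ i) \<eta> x)) n) sums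
        (LINT x|leb01. of_real ((deriv ^^ i) \<eta> x) * f x)"
      by (intro sine_expansion[OF f test_measurable_bounded(1)[OF test_funpow[OF \<eta>]]]) auto
    moreover have "(\<lambda>n. (- 1) ^ i * (of_real ((real (Suc n) * pi) ^ i) * trig_coeff 0 f n * trig_coeff i (\<lambda>x. of_real (\<eta> x)) n)) sums
        ((- 1) ^ i * (LINT x|leb01. of_real (\<eta> x) * g x))"
      by (rule sums_mult[OF sums[OF test_measurable_bounded[OF \<eta>]]])
    ultimately show "(LINT x|leb01. of_real ((deriv ^^ i) \<eta> x) * f x) = (- 1) ^ i * (LINT x|leb01. of_real (\<eta> x) * g x)"
      unfolding coeff by (simp only: mult_ac sums_unique2)
  qed
  with g show ?thesis by blast
qed

lemma weak_deriv_unique: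
  assumes "weak_deriv j f g" "weak_deriv j f h" "g \<in> L2" "h \<in> L2"
  shows "ae_eq g h"
proof -
  have "AE x in leb01. g x - h x = 0"
  proof (rule fundamental_lemma_calculus_of_variations)
    show "integrable leb01 (\<lambda>x. g x - h x)" using assms by (intro Bochner_Integration.integrable_diff L2_integrable)
    fix \<eta> assume \<eta>: "\<eta> \<in> test_functions"
    have "(- 1) ^ j * (LINT x|leb01. \<eta> x *\<^sub>R g x) = (- 1) ^ j * (LINT x|leb01. \<eta> x *\<^sub>R h x)"
      by (rule trans[OF bspec[OF assms(1)[unfolded weak_deriv_def] \<eta>, symmetric] bspec[OF assms(2)[unfolded weak_deriv_def] \<eta>]])
    then have "(LINT x|leb01. \<eta> x *\<^sub>R g x) = (LINT x|leb01. \<eta> x *\<^sub>R h x)" by simp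
    then show "(LINT x|leb01. \<eta> x *\<^sub>R (g x - h x)) = 0"
      using smooth_integrable[OF test_smooth[OF \<eta>]] assms(3,4) by (simp add: scaleR_diff_right)
  qed
  then show ?thesis unfolding ae_eq_def by eventually_elim simp
qed

text \<open>
  Termwise differentiation gives one weak second derivative with the expected coefficients; the one
  selected in the definition of \<open>laplacian\<close> agrees with it almost everywhere.
\<close>

lemma laplacian_coeff:
  assumes f: "f \<in> L2" and s: "summable (\<lambda>n. (cmod (of_real (freq n) * trig_coeff 0 f n))\<^sup>2)"
  shows "laplacian f \<in> L2" "weak_deriv 2 f (laplacian f)"
    "trig_coeff 0 (laplacian f) n = - of_real (freq n) * trig_coeff 0 f n"
proof -
  have fr: "freq n = (real (Suc n) * pi) ^ 2" for n by (simp add: freq_def eigval_def)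
  obtain g where g: "g \<in> L2" "weak_deriv 2 f g" "\<And>n. trig_coeff 2 g n = of_real (freq n) * trig_coeff 0 f n"
    using sine_series_weak_deriv[OF f, of 2] s unfolding fr by blast
  have "laplacian f \<in> L2 \<and> weak_deriv 2 f (laplacian f)"
    unfolding laplacian_def by (rule someI[of _ g]) (use g in blast)
  then show l: "laplacian f \<in> L2" "weak_deriv 2 f (laplacian f)" by auto
  have "trig 2 k x = - trig 0 k x" for k x by (simp add: trig_def)
  then have "trig_coeff 2 g n = - trig_coeff 0 g n" by (simp add: trig_coeff_def)
  moreover have "trig_coeff 0 (laplacian f) n = trig_coeff 0 g n"
    by (rule trig_coeff_cong[OF weak_deriv_unique[OF l(2) g(2) l(1) g(1)] l(1) g(1)])
  ultimately show "trig_coeff 0 (laplacian f) n = - of_real (freq n) * trig_coeff 0 f n"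
    using g(3)[of n] by simp
qed

section \<open>Sobolev spaces\<close>

lemma weak_deriv_0: "weak_deriv 0 f f"
  by (simp add: weak_deriv_def)

lemma weak_deriv_trans:
  assumes "weak_deriv i f g" "weak_deriv j g h"
  shows "weak_deriv (i + j) f h"
  unfolding weak_deriv_def
proof
  fix \<eta> assume \<eta>: "\<eta> \<in> test_functions"
  have "(LINT x|leb01. (deriv ^^ (i + j)) \<eta> x *\<^sub>R f x) = (- 1) ^ i * (LINT x|leb01. (deriv ^^ j) \<eta> x *\<^sub>R g x)"
    using assms(1) test_funpow[OF \<eta>, of j] by (simp add: weak_deriv_def funpow_add)
  also have "\<dots> = (- 1) ^ (i + j) * (LINT x|leb01. \<eta> x *\<^sub>R h x)"
    using assms(2) \<eta> by (simp add: weak_deriv_def power_add)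
  finally show "(LINT x|leb01. (deriv ^^ (i + j)) \<eta> x *\<^sub>R f x) = (- 1) ^ (i + j) * (LINT x|leb01. \<eta> x *\<^sub>R h x)" .
qed

lemma weak_deriv_cancel:
  assumes "weak_deriv 1 f g" "weak_deriv (Suc j) f h"
  shows "weak_deriv j g h"
  unfolding weak_deriv_def
proof
  fix \<eta> assume \<eta>: "\<eta> \<in> test_functions"
  have "(LINT x|leb01. (deriv ^^ Suc j) \<eta> x *\<^sub>R f x) = - (LINT x|leb01. (deriv ^^ j) \<eta> x *\<^sub>R g x)"
    using assms(1) test_funpow[OF \<eta>, of j] by (simp add: weak_deriv_def)
  moreover have "(LINT x|leb01. (deriv ^^ Suc j) \<eta> x *\<^sub>R f x) = (- 1) ^ Suc j * (LINT x|leb01. \<eta> x *\<^sub>R h x)"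
    using assms(2) \<eta> by (simp only: weak_deriv_def)
  ultimately show "(LINT x|leb01. (deriv ^^ j) \<eta> x *\<^sub>R g x) = (- 1) ^ j * (LINT x|leb01. \<eta> x *\<^sub>R h x)"
    by simp
qed

lemma weak_deriv_add:
  assumes "weak_deriv j f f'" "weak_deriv j g g'" "f \<in> L2" "g \<in> L2" "f' \<in> L2" "g' \<in> L2"
  shows "weak_deriv j (\<lambda>x. f x + g x) (\<lambda>x. f' x + g' x)"
  using assms smooth_integrable[OF test_smooth] smooth_integrable[OF test_smooth[OF test_funpow]]
  by (simp add: weak_deriv_def scaleR_add_right distrib_left)

lemma weak_deriv_scaleR:
  assumes "weak_deriv j f f'"
  shows "weak_deriv j (\<lambda>x. r *\<^sub>R f x) (\<lambda>x. r *\<^sub>R f' x)"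
proof -
  have "(LINT x|leb01. u x *\<^sub>R r *\<^sub>R g x) = r *\<^sub>R (LINT x|leb01. u x *\<^sub>R g x)" for u and g :: "real \<Rightarrow> complex"
    by (simp only: scaleR_left_commute[of _ r] integral_scaleR_right)
  with assms show ?thesis unfolding weak_deriv_def by simp
qed

lemma sobolev_L2: "f \<in> sobolev m \<Longrightarrow> f \<in> L2"
  by (simp add: sobolev_def)

lemma sobolev_mono: "f \<in> sobolev m \<Longrightarrow> k \<le> m \<Longrightarrow> f \<in> sobolev k"
  by (auto simp: sobolev_def)

lemma sobolev_add:
  assumes "f \<in> sobolev m" "g \<in> sobolev m"
  shows "(\<lambda>x. f x + g x) \<in> sobolev m"
proof -
  have "\<exists>h\<in>L2. weak_deriv j (\<lambda>x. f x + g x) h" if j: "j \<le> m" for j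
  proof -
    obtain f' g' where "f' \<in> L2" "weak_deriv j f f'" "g' \<in> L2" "weak_deriv j g g'"
      using assms j unfolding sobolev_def by blast
    then show ?thesis
      using weak_deriv_add[of j f f' g g'] L2_add[of f' g'] assms[THEN sobolev_L2] by blast
  qed
  then show ?thesis using L2_add[OF assms[THEN sobolev_L2]] by (simp add: sobolev_def)
qed

lemma sobolev_scaleR:
  assumes "f \<in> sobolev m"
  shows "(\<lambda>x. r *\<^sub>R f x) \<in> sobolev m"
proof -
  have "\<exists>h\<in>L2. weak_deriv j (\<lambda>x. r *\<^sub>R f x) h" if j: "j \<le> m" for j
  proof -
    obtain f' where "f' \<in> L2" "weak_deriv j f f'"
      using assms j unfolding sobolev_def by blast
    then show ?thesis using weak_deriv_scaleR[of j f f' r] L2_scaleR[of f' r] by blast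
  qed
  then show ?thesis using L2_scaleR[OF sobolev_L2[OF assms]] by (simp add: sobolev_def)
qed

lemma sobolev_Suc:
  "f \<in> sobolev (Suc m) \<longleftrightarrow> f \<in> L2 \<and> (\<exists>g\<in>sobolev m. weak_deriv 1 f g)"
proof
  assume f: "f \<in> sobolev (Suc m)"
  then obtain g where g: "g \<in> L2" "weak_deriv 1 f g" by (force simp: sobolev_def)
  have "\<exists>h\<in>L2. weak_deriv j g h" if "j \<le> m" for j
    using f that weak_deriv_cancel[OF g(2)] by (force simp: sobolev_def)
  with f g show "f \<in> L2 \<and> (\<exists>g\<in>sobolev m. weak_deriv 1 f g)" by (auto simp: sobolev_def)
next
  assume "f \<in> L2 \<and> (\<exists>g\<in>sobolev m. weak_deriv 1 f g)"
  then obtain g where f: "f \<in> L2" and g: "g \<in> sobolev m" "weak_deriv 1 f g" by blast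
  have "\<exists>h\<in>L2. weak_deriv j f h" if "j \<le> Suc m" for j
  proof (cases j)
    case (Suc i)
    then obtain h where "h \<in> L2" "weak_deriv i g h" using g(1) \<open>j \<le> Suc m\<close> by (auto simp: sobolev_def)
    then show ?thesis using weak_deriv_trans[OF g(2)] Suc by auto
  qed (use f weak_deriv_0 in blast)
  with f show "f \<in> sobolev (Suc m)" by (simp add: sobolev_def)
qed

lemma sobolev_add_2:
  assumes "f \<in> sobolev 2" "weak_deriv 2 f g" "g \<in> sobolev m"
  shows "f \<in> sobolev (m + 2)"
proof -
  have "\<exists>h\<in>L2. weak_deriv j f h" if "j \<le> m + 2" for j
  proof (cases "j \<le> 2")
    case True
    then show ?thesis using assms(1) by (auto simp: sobolev_def)
  next
    case False
    define i where "i = j - 2"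
    have i: "j = 2 + i" "i \<le> m" using False that by (auto simp: i_def)
    then obtain h where "h \<in> L2" "weak_deriv i g h" using assms(3) by (auto simp: sobolev_def)
    then show ?thesis using weak_deriv_trans[OF assms(2)] i by auto
  qed
  with assms(1) show ?thesis by (simp add: sobolev_def)
qed

lemma L2_smooth_mult: "f \<in> L2 \<Longrightarrow> smooth w \<Longrightarrow> (\<lambda>x. w x *\<^sub>R f x) \<in> L2"
proof -
  assume f: "f \<in> L2" and w: "smooth w"
  have "bounded (w ` {0..1})" by (intro compact_imp_bounded compact_continuous_image smooth_continuous w compact_Icc)
  then obtain B where "\<forall>x\<in>{0..1}. norm (w x) \<le> B" by (auto simp: bounded_iff)
  then have "(\<lambda>x. of_real (w x) * f x) \<in> L2"
    by (intro L2_mult_bounded[OF f, of _ B] continuous_measurable_leb01 continuous_on_of_real smooth_continuous w) auto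
  then show ?thesis by (simp add: scaleR_conv_of_real)
qed

lemma weak_deriv_smooth_mult:
  assumes fg: "weak_deriv 1 f g" "f \<in> L2" "g \<in> L2" and w: "smooth w"
  shows "weak_deriv 1 (\<lambda>x. w x *\<^sub>R f x) (\<lambda>x. deriv w x *\<^sub>R f x + w x *\<^sub>R g x)"
  unfolding weak_deriv_def
proof
  fix \<eta> assume \<eta>: "\<eta> \<in> test_functions"
  note s = test_smooth[OF \<eta>]
  have d: "deriv (\<lambda>x. \<eta> x * w x) = (\<lambda>x. deriv \<eta> x * w x + \<eta> x * deriv w x)"
  proof (intro ext DERIV_imp_deriv)
    fix x
    show "((\<lambda>x. \<eta> x * w x) has_real_derivative deriv \<eta> x * w x + \<eta> x * deriv w x) (at x)"
      using DERIV_mult[OF smooth_has_deriv[OF s, of x] smooth_has_deriv[OF w, of x]] by (simp add: mult_ac)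
  qed
  have i1: "integrable leb01 (\<lambda>x. (deriv \<eta> x * w x) *\<^sub>R f x)"
    and i2: "integrable leb01 (\<lambda>x. (\<eta> x * deriv w x) *\<^sub>R f x)"
    and i3: "integrable leb01 (\<lambda>x. (\<eta> x * w x) *\<^sub>R g x)"
    by (intro smooth_integrable smooth_mult smooth_deriv s w fg)+
  have "(LINT x|leb01. (deriv \<eta> x * w x) *\<^sub>R f x) + (LINT x|leb01. (\<eta> x * deriv w x) *\<^sub>R f x) = - (LINT x|leb01. (\<eta> x * w x) *\<^sub>R g x)"
    using fg(1) test_mult_smooth[OF \<eta> w] Bochner_Integration.integral_add[OF i1 i2]
    unfolding weak_deriv_def by (fastforce simp: d scaleR_add_left)
  moreover have "(LINT x|leb01. \<eta> x *\<^sub>R (deriv w x *\<^sub>R f x + w x *\<^sub>R g x)) = (LINT x|leb01. (\<eta> x * deriv w x) *\<^sub>R f x) + (LINT x|leb01. (\<eta> x * w x) *\<^sub>R g x)"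
    using Bochner_Integration.integral_add[OF i2 i3] by (simp add: scaleR_add_right)
  ultimately show "(LINT x|leb01. (deriv ^^ 1) \<eta> x *\<^sub>R w x *\<^sub>R f x) = (- 1) ^ 1 * (LINT x|leb01. \<eta> x *\<^sub>R (deriv w x *\<^sub>R f x + w x *\<^sub>R g x))"
    by (simp add: algebra_simps)
qed

text \<open>
  The product rule, iterated along the recursive description of Sobolev spaces by first derivatives.
\<close>

lemma sobolev_smooth_mult: "f \<in> sobolev m \<Longrightarrow> smooth w \<Longrightarrow> (\<lambda>x. w x *\<^sub>R f x) \<in> sobolev m"
proof (induction m arbitrary: f w)
  case 0
  then show ?case using weak_deriv_0 L2_smooth_mult by (fastforce simp: sobolev_def)
next
  case (Suc m)
  then obtain g where g: "g \<in> sobolev m" "weak_deriv 1 f g" by (auto simp: sobolev_Suc)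
  have f: "f \<in> L2" using Suc.prems sobolev_L2 by blast
  have "(\<lambda>x. deriv w x *\<^sub>R f x + w x *\<^sub>R g x) \<in> sobolev m"
    by (intro sobolev_add Suc.IH smooth_deriv Suc.prems g sobolev_mono[OF Suc.prems(1)]) simp
  then show ?case
    unfolding sobolev_Suc
    using weak_deriv_smooth_mult[OF g(2) f sobolev_L2[OF g(1)] Suc.prems(2)] L2_smooth_mult[OF f Suc.prems(2)] by blast
qed

section \<open>Integration by parts up to the boundary\<close>

lemma flat_exp_deriv: "(flat_exp has_real_derivative (if x > 0 then exp (- 1 / x) / x\<^sup>2 else 0)) (at x)"
proof (cases "x > 0")
  case True
  then have "((\<lambda>x. exp (- 1 / x)) has_real_derivative exp (- 1 / x) / x\<^sup>2) (at x)"
    by (auto intro!: derivative_eq_intros simp: power2_eq_square)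
  then have "(flat_exp has_real_derivative exp (- 1 / x) / x\<^sup>2) (at x)"
    by (rule has_field_derivative_transform_within_open[where S = "{0<..}"]) (use True in \<open>auto simp: flat_exp_def\<close>)
  then show ?thesis using True by simp
next
  case False
  have nonneg: "flat_exp x = 0" using False by (simp add: flat_exp_def)
  have "deriv flat_exp x = 0"
  proof (rule DERIV_local_min[OF smooth_has_deriv[OF smooth_flat_exp]])
    show "\<forall>y. \<bar>x - y\<bar> < 1 \<longrightarrow> flat_exp x \<le> flat_exp y" using nonneg flat_exp_bounds(1) by simp
  qed simp
  then show ?thesis using smooth_has_deriv[OF smooth_flat_exp, of x] False by simp
qed

lemma deriv_flat_exp: "deriv flat_exp x = (if x > 0 then exp (- 1 / x) / x\<^sup>2 else 0)"
  by (rule DERIV_imp_deriv[OF flat_exp_deriv])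

text \<open>
  With \<open>s = 1 / x\<close> the product is \<open>(s + s\<^sup>2) exp (- s)\<close>.
\<close>

lemma deriv_flat_exp_weighted_le:
  assumes "x > -1"
  shows "0 \<le> (x + 1) * deriv flat_exp x" "(x + 1) * deriv flat_exp x \<le> 2"
proof -
  show "0 \<le> (x + 1) * deriv flat_exp x" using assms by (simp add: deriv_flat_exp)
  show "(x + 1) * deriv flat_exp x \<le> 2"
  proof (cases "x > 0")
    case True
    define s where "s = 1 / x"
    have s: "s > 0" using True by (simp add: s_def)
    have "(x + 1) * deriv flat_exp x = (s + s\<^sup>2) * exp (- s)"
      using True by (simp add: deriv_flat_exp s_def field_simps power2_eq_square)
    also have "\<dots> = (s + s\<^sup>2) / exp s" by (simp add: exp_minus divide_inverse)
    also have "\<dots> \<le> 2"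
    proof -
      have "1 + s + s\<^sup>2 / 2 \<le> exp s" using exp_lower_Taylor_quadratic[of s] s by simp
      then have "s + s\<^sup>2 \<le> 2 * exp s" using s by simp
      then show ?thesis by (simp add: divide_le_eq)
    qed
    finally show ?thesis .
  qed (simp add: deriv_flat_exp)
qed

lemma bump_deriv:
  "deriv (bump m a b) x = m * deriv flat_exp (m * (x - a)) * flat_exp (m * (b - x)) - m * flat_exp (m * (x - a)) * deriv flat_exp (m * (b - x))"
proof (rule DERIV_imp_deriv)
  have d1: "((\<lambda>x. flat_exp (m * (x - a))) has_real_derivative deriv flat_exp (m * (x - a)) * m) (at x)"
    by (rule DERIV_chain2[OF smooth_has_deriv[OF smooth_flat_exp]]) (auto intro!: derivative_eq_intros)
  have d2: "((\<lambda>x. flat_exp (m * (b - x))) has_real_derivative deriv flat_exp (m * (b - x)) * (- m)) (at x)"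
    by (rule DERIV_chain2[OF smooth_has_deriv[OF smooth_flat_exp]]) (auto intro!: derivative_eq_intros)
  from DERIV_mult[OF d1 d2]
  show "(bump m a b has_real_derivative m * deriv flat_exp (m * (x - a)) * flat_exp (m * (b - x)) - m * flat_exp (m * (x - a)) * deriv flat_exp (m * (b - x))) (at x)"
    by (simp add: bump_def[abs_def] algebra_simps)
qed

text \<open>
  Integration by parts against a smooth function that vanishes at the end points, but not near
  them. The derivative of the cutoff is of order \<open>n\<close> in a layer of width \<open>1 / n\<close>; there the smooth
  function is of order \<open>1 / n\<close>.
\<close>

lemma weak_deriv_by_parts:
  assumes fg: "weak_deriv 1 f g" "f \<in> L2" "g \<in> L2" and u: "smooth u" "u 0 = 0" "u 1 = 0"
  shows "(LINT x|leb01. deriv u x *\<^sub>R f x) = - (LINT x|leb01. u x *\<^sub>R g x)"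
proof -
  define m where "m n = real (n + 3)" for n
  define chi where "chi n = bump (m n) (1 / m n) (1 - 1 / m n)" for n
  have m: "m n > 0" for n by (simp add: m_def)
  have m_lim: "filterlim m at_top sequentially"
    unfolding m_def by (intro filterlim_compose[OF filterlim_real_sequentially] filterlim_add_const_nat_at_top)
  have arg: "m n * (x - 1 / m n) = m n * x - 1" "m n * (1 - 1 / m n - x) = m n * (1 - x) - 1" for n x
    using m[of n] by (simp_all add: algebra_simps)
  have chi_test: "chi n \<in> test_functions" for n
    unfolding chi_def using m[of n] by (intro bump_test) auto
  have chi_smooth: "smooth (chi n)" for n by (rule test_smooth[OF chi_test])
  have "bounded (deriv u ` {0..1})"
    by (intro compact_imp_bounded compact_continuous_image smooth_continuous smooth_deriv u compact_Icc)
  then obtain L where L: "\<forall>x\<in>{0..1}. norm (deriv u x) \<le> L" by (auto simp: bounded_iff)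
  have L0: "L \<ge> 0" using L by (meson atLeastAtMost_iff norm_ge_zero order_refl order_trans zero_le_one)
  have u_le: "\<bar>u x\<bar> \<le> L * x" "\<bar>u x\<bar> \<le> L * (1 - x)" if x: "0 < x" "x < 1" for x
  proof -
    have lip: "norm (u y - u z) \<le> L * norm (y - z)" if "y \<in> {0..1}" "z \<in> {0..1}" for y z
      by (rule field_differentiable_bound[where S = "{0..1}" and f' = "deriv u"])
        (use L that in \<open>auto intro: has_field_derivative_at_within smooth_has_deriv[OF u(1)]\<close>)
    show "\<bar>u x\<bar> \<le> L * x" using lip[of x 0] x u by simp
    show "\<bar>u x\<bar> \<le> L * (1 - x)" using lip[of x 1] x u by (simp add: abs_if)
  qed
  have chi_lim: "(\<lambda>n. chi n x) \<longlonglongrightarrow> 1" if x: "0 < x" "x < 1" for x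
  proof -
    have one: "(\<lambda>n. flat_exp (m n * y - 1)) \<longlonglongrightarrow> 1" if "y > 0" for y
    proof -
      have top: "filterlim (\<lambda>n. m n * y - 1) at_top sequentially"
        using filterlim_tendsto_add_at_top[OF tendsto_const[of "-1"] filterlim_at_top_mult_tendsto_pos[OF tendsto_const that m_lim]]
        by simp
      have "(\<lambda>n. exp (- inverse (m n * y - 1))) \<longlonglongrightarrow> exp (- 0)"
        by (intro tendsto_intros tendsto_inverse_0_at_top top)
      moreover have "\<forall>\<^sub>F n in sequentially. exp (- inverse (m n * y - 1)) = flat_exp (m n * y - 1)"
        using filterlim_at_top_dense[THEN iffD1, OF top, rule_format, of 0]
        by eventually_elim (simp add: flat_exp_def divide_inverse)
      ultimately show ?thesis by (simp add: Lim_transform_eventually)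
    qed
    have "(\<lambda>n. flat_exp (m n * x - 1) * flat_exp (m n * (1 - x) - 1)) \<longlonglongrightarrow> 1 * 1"
      using x by (intro tendsto_mult one) auto
    then show ?thesis by (simp add: chi_def bump_def arg)
  qed
  have layer: "m n * y * deriv flat_exp (m n * y - 1) \<le> 2" "0 \<le> m n * y * deriv flat_exp (m n * y - 1)" if "y > 0" for n y
    using deriv_flat_exp_weighted_le[of "m n * y - 1"] m[of n] that by auto
  have chi_deriv: "\<bar>deriv (chi n) x * u x\<bar> \<le> L * (m n * x * deriv flat_exp (m n * x - 1)) + L * (m n * (1 - x) * deriv flat_exp (m n * (1 - x) - 1))"
    if x: "0 < x" "x < 1" for n x
  proof -
    have nn: "0 \<le> deriv flat_exp y" for y by (simp add: deriv_flat_exp)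
    have A: "\<bar>m n * deriv flat_exp (m n * x - 1) * flat_exp (m n * (1 - x) - 1) * u x\<bar> \<le> (m n * deriv flat_exp (m n * x - 1) * 1) * (L * x)"
      unfolding abs_mult using m[of n] nn[of "m n * x - 1"] flat_exp_bounds[of "m n * (1 - x) - 1"] u_le[OF x]
      by (intro mult_mono) auto
    have B: "\<bar>m n * flat_exp (m n * x - 1) * deriv flat_exp (m n * (1 - x) - 1) * u x\<bar> \<le> (m n * 1 * deriv flat_exp (m n * (1 - x) - 1)) * (L * (1 - x))"
      unfolding abs_mult using m[of n] nn[of "m n * (1 - x) - 1"] flat_exp_bounds[of "m n * x - 1"] u_le[OF x]
      by (intro mult_mono) auto
    have "deriv (chi n) x * u x = m n * deriv flat_exp (m n * x - 1) * flat_exp (m n * (1 - x) - 1) * u x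
        - m n * flat_exp (m n * x - 1) * deriv flat_exp (m n * (1 - x) - 1) * u x"
      unfolding chi_def bump_deriv arg by (simp only: left_diff_distrib)
    then have "\<bar>deriv (chi n) x * u x\<bar> \<le> \<bar>m n * deriv flat_exp (m n * x - 1) * flat_exp (m n * (1 - x) - 1) * u x\<bar>
        + \<bar>m n * flat_exp (m n * x - 1) * deriv flat_exp (m n * (1 - x) - 1) * u x\<bar>"
      by (simp only: abs_triangle_ineq4)
    with A B show ?thesis by (simp add: mult_ac)
  qed
  have chi_deriv_bound: "\<bar>deriv (chi n) x * u x\<bar> \<le> 4 * L" if x: "0 < x" "x < 1" for n x
  proof -
    have "L * (m n * x * deriv flat_exp (m n * x - 1)) \<le> L * 2" "L * (m n * (1 - x) * deriv flat_exp (m n * (1 - x) - 1)) \<le> L * 2"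
      using x by (intro mult_left_mono layer L0; simp)+
    with chi_deriv[OF x, of n] show ?thesis by linarith
  qed
  have chi_deriv_lim: "(\<lambda>n. deriv (chi n) x * u x) \<longlonglongrightarrow> 0" if x: "0 < x" "x < 1" for x
  proof -
    have l: "(\<lambda>n. m n * y * deriv flat_exp (m n * y - 1)) \<longlonglongrightarrow> 0" if y: "y > 0" for y
    proof -
      have top: "filterlim (\<lambda>n. m n * y - 1) at_top sequentially"
        using filterlim_tendsto_add_at_top[OF tendsto_const[of "-1"] filterlim_at_top_mult_tendsto_pos[OF tendsto_const y m_lim]]
        by simp
      have inv: "((\<lambda>t::real. inverse t) \<longlongrightarrow> 0) at_top" by (rule tendsto_inverse_0_at_top[OF filterlim_ident])
      have "((\<lambda>t::real. inverse t + inverse t * inverse t) \<longlongrightarrow> 0 + 0 * 0) at_top"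
        by (intro tendsto_add tendsto_mult inv)
      then have "((\<lambda>t::real. inverse t + inverse t * inverse t) \<longlongrightarrow> 0) at_top" by simp
      moreover have "\<forall>\<^sub>F t in at_top. inverse t + inverse t * inverse t = (t + 1) / (t::real)\<^sup>2"
        using eventually_gt_at_top[of "0::real"] by eventually_elim (simp add: field_simps power2_eq_square)
      ultimately have "((\<lambda>t::real. (t + 1) / t\<^sup>2) \<longlongrightarrow> 0) at_top" by (rule Lim_transform_eventually)
      moreover have "\<forall>\<^sub>F t in at_top. norm ((t + 1) * deriv flat_exp t) \<le> (t + 1) / t\<^sup>2"
        using eventually_gt_at_top[of "0::real"]
      proof eventually_elim
        case (elim t)
        have "(t + 1) / t\<^sup>2 * exp (- 1 / t) \<le> (t + 1) / t\<^sup>2 * 1" using elim by (intro mult_left_mono) auto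
        then show ?case using elim by (simp add: deriv_flat_exp abs_mult)
      qed
      ultimately have "((\<lambda>t. (t + 1) * deriv flat_exp t) \<longlongrightarrow> 0) at_top"
        by (rule Lim_null_comparison[rotated])
      from filterlim_compose[OF this top] show ?thesis by simp
    qed
    have "(\<lambda>n. L * (m n * x * deriv flat_exp (m n * x - 1)) + L * (m n * (1 - x) * deriv flat_exp (m n * (1 - x) - 1))) \<longlonglongrightarrow> L * 0 + L * 0"
      using x by (intro tendsto_add tendsto_mult tendsto_const l[unfolded mult.assoc[symmetric]] l) auto
    then have "(\<lambda>n. L * (m n * x * deriv flat_exp (m n * x - 1)) + L * (m n * (1 - x) * deriv flat_exp (m n * (1 - x) - 1))) \<longlonglongrightarrow> 0"
      by simp
    then show ?thesis
      by (rule Lim_null_comparison[rotated]) (use chi_deriv[OF x] in \<open>auto intro!: always_eventually\<close>)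
  qed
  have parts: "(LINT x|leb01. (deriv (chi n) x * u x) *\<^sub>R f x) + (LINT x|leb01. (chi n x * deriv u x) *\<^sub>R f x) = - (LINT x|leb01. (chi n x * u x) *\<^sub>R g x)" for n
  proof -
    have d: "deriv (\<lambda>x. chi n x * u x) = (\<lambda>x. deriv (chi n) x * u x + chi n x * deriv u x)"
    proof (intro ext DERIV_imp_deriv)
      fix x
      show "((\<lambda>x. chi n x * u x) has_real_derivative deriv (chi n) x * u x + chi n x * deriv u x) (at x)"
        using DERIV_mult[OF smooth_has_deriv[OF chi_smooth, of n x] smooth_has_deriv[OF u(1), of x]] by (simp add: mult_ac)
    qed
    have i1: "integrable leb01 (\<lambda>x. (deriv (chi n) x * u x) *\<^sub>R f x)"
      by (rule smooth_integrable[OF smooth_mult[OF smooth_deriv[OF chi_smooth] u(1)] fg(2)])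
    have i2: "integrable leb01 (\<lambda>x. (chi n x * deriv u x) *\<^sub>R f x)"
      by (rule smooth_integrable[OF smooth_mult[OF chi_smooth smooth_deriv[OF u(1)]] fg(2)])
    have "(LINT x|leb01. deriv (\<lambda>x. chi n x * u x) x *\<^sub>R f x) = - (LINT x|leb01. (chi n x * u x) *\<^sub>R g x)"
      using bspec[OF fg(1)[unfolded weak_deriv_def] test_mult_smooth[OF chi_test u(1)]] by simp
    then show ?thesis using Bochner_Integration.integral_add[OF i1 i2] by (simp add: d scaleR_add_left)
  qed
  have meas: "(\<lambda>x. w x *\<^sub>R h x) \<in> borel_measurable leb01" if "smooth w" "h \<in> L2" for w h
    by (rule borel_measurable_integrable[OF smooth_integrable[OF that]])
  have chi_bound: "\<bar>chi n x\<bar> \<le> 1" for n x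
    using bump_bounds[of "m n" "1 / m n" "1 - 1 / m n" x] by (simp add: chi_def)
  have lim0: "(\<lambda>n. LINT x|leb01. (deriv (chi n) x * u x) *\<^sub>R f x) \<longlonglongrightarrow> (LINT x|leb01. 0)"
  proof (rule integral_dominated_convergence[where w = "\<lambda>x. 4 * L * cmod (f x)"])
    show "AE x in leb01. (\<lambda>n. (deriv (chi n) x * u x) *\<^sub>R f x) \<longlonglongrightarrow> 0"
      by (rule AE_leb01I) (use tendsto_scaleR[OF chi_deriv_lim tendsto_const] in fastforce)
    show "AE x in leb01. norm ((deriv (chi n) x * u x) *\<^sub>R f x) \<le> 4 * L * cmod (f x)" for n
      by (rule AE_leb01I) (use chi_deriv_bound in \<open>simp add: mult_right_mono\<close>)
    show "(\<lambda>x. (deriv (chi n) x * u x) *\<^sub>R f x) \<in> borel_measurable leb01" for n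
      by (rule meas[OF smooth_mult[OF smooth_deriv[OF chi_smooth] u(1)] fg(2)])
    show "integrable leb01 (\<lambda>x. 4 * L * cmod (f x))" using L2_integrable[OF fg(2)] by simp
  qed simp
  have lim1: "(\<lambda>n. LINT x|leb01. (chi n x * w x) *\<^sub>R h x) \<longlonglongrightarrow> (LINT x|leb01. w x *\<^sub>R h x)"
    if w: "smooth w" and h: "h \<in> L2" for w h
  proof (rule integral_dominated_convergence[where w = "\<lambda>x. norm (w x *\<^sub>R h x)"])
    show "AE x in leb01. (\<lambda>n. (chi n x * w x) *\<^sub>R h x) \<longlonglongrightarrow> w x *\<^sub>R h x"
    proof (rule AE_leb01I)
      fix x :: real assume "0 < x" "x < 1"
      then have "(\<lambda>n. (chi n x * w x) *\<^sub>R h x) \<longlonglongrightarrow> (1 * w x) *\<^sub>R h x"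
        by (intro tendsto_scaleR tendsto_mult chi_lim tendsto_const)
      then show "(\<lambda>n. (chi n x * w x) *\<^sub>R h x) \<longlonglongrightarrow> w x *\<^sub>R h x" by simp
    qed
    show "AE x in leb01. norm ((chi n x * w x) *\<^sub>R h x) \<le> norm (w x *\<^sub>R h x)" for n
      using chi_bound[of n] by (intro AE_I2) (simp add: abs_mult mult_left_le_one_le mult_right_mono)
    show "(\<lambda>x. (chi n x * w x) *\<^sub>R h x) \<in> borel_measurable leb01" for n
      by (rule meas[OF smooth_mult[OF chi_smooth w] h])
    show "(\<lambda>x. w x *\<^sub>R h x) \<in> borel_measurable leb01" by (rule meas[OF w h])
    show "integrable leb01 (\<lambda>x. norm (w x *\<^sub>R h x))" using smooth_integrable[OF w h] by (rule integrable_norm)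
  qed
  have "(\<lambda>n. (LINT x|leb01. (deriv (chi n) x * u x) *\<^sub>R f x) + (LINT x|leb01. (chi n x * deriv u x) *\<^sub>R f x)) \<longlonglongrightarrow>
      0 + (LINT x|leb01. deriv u x *\<^sub>R f x)"
    using tendsto_add[OF lim0 lim1[OF smooth_deriv[OF u(1)] fg(2)]] by simp
  moreover have "(\<lambda>n. - (LINT x|leb01. (chi n x * u x) *\<^sub>R g x)) \<longlonglongrightarrow> - (LINT x|leb01. u x *\<^sub>R g x)"
    by (intro tendsto_minus lim1 u fg)
  ultimately show ?thesis unfolding parts using LIMSEQ_unique by fastforce
qed

section \<open>Decay of the control coefficients\<close>

lemma by_parts_sine:
  assumes "weak_deriv 1 f g" "f \<in> L2" "g \<in> L2"
  shows "of_real (real j * pi) * (LINT x|leb01. trig 1 j x *\<^sub>R f x) = - (LINT x|leb01. trig 0 j x *\<^sub>R g x)"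
proof -
  have "(LINT x|leb01. deriv (trig 0 j) x *\<^sub>R f x) = - (LINT x|leb01. trig 0 j x *\<^sub>R g x)"
    by (rule weak_deriv_by_parts[OF assms smooth_trig]) (simp_all add: trig_def)
  moreover have "(LINT x|leb01. deriv (trig 0 j) x *\<^sub>R f x) = (real j * pi) *\<^sub>R (LINT x|leb01. trig 1 j x *\<^sub>R f x)"
    unfolding deriv_trig by (simp only: scaleR_scaleR[symmetric] integral_scaleR_right One_nat_def)
  ultimately show ?thesis by (simp add: scaleR_conv_of_real)
qed

lemma smooth_linear: "smooth (\<lambda>x. p + q * x)"
proof (rule smooth_coinduct[where P = "\<lambda>f. \<exists>p q. f = (\<lambda>x. p + q * x)"])
  fix f :: "real \<Rightarrow> real" assume "\<exists>p q. f = (\<lambda>x. p + q * x)"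
  then obtain p q where f: "f = (\<lambda>x. p + q * x)" by blast
  have d: "(f has_real_derivative q) (at x)" for x
    unfolding f by (auto intro!: derivative_eq_intros)
  then have "deriv f = (\<lambda>x. q + 0 * x)" by (intro ext) (simp add: DERIV_imp_deriv)
  then have "\<exists>p q. deriv f = (\<lambda>x. p + q * x)" by blast
  moreover have "\<forall>x. f differentiable at x" using d by (auto simp: real_differentiable_def)
  ultimately show "(\<forall>x. f differentiable at x) \<and> (\<exists>p q. deriv f = (\<lambda>x. p + q * x))" by blast
qed blast

text \<open>
  The boundary values of the cosine enter through an affine correction. They depend only on the
  parity of \<open>j\<close>.
\<close>

lemma by_parts_cosine:
  assumes "weak_deriv 1 f g" "f \<in> L2" "g \<in> L2"
  shows "of_real (real j * pi) * (LINT x|leb01. trig 0 j x *\<^sub>R f x) = (LINT x|leb01. trig 1 j x *\<^sub>R g x)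
     - (of_real (sqrt 2 * ((- 1) ^ j - 1)) * ((LINT x|leb01. f x) + (LINT x|leb01. x *\<^sub>R g x))
        + of_real (sqrt 2) * (LINT x|leb01. g x))"
proof -
  define q where "q = sqrt 2 * ((- 1) ^ j - 1)"
  \<comment> \<open>\<open>trig 1 j\<close> has the values \<open>sqrt 2\<close> and \<open>sqrt 2 * (- 1) ^ j\<close> at the end points; \<open>l\<close> removes them\<close>
  define l where "l x = - sqrt 2 + (- q) * x" for x :: real
  define u where "u x = trig 1 j x + l x" for x
  have sl: "smooth l" unfolding l_def by (rule smooth_linear)
  have su: "smooth u" unfolding u_def by (rule smooth_add[OF smooth_trig sl])
  have du: "deriv u x = - (real j * pi * trig 0 j x) - q" for x
  proof (rule DERIV_imp_deriv)
    have "(u has_real_derivative real j * pi * trig 2 j x + - q) (at x)"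
      unfolding u_def[abs_def] l_def using trig_deriv[of 1 j x]
      by (auto intro!: derivative_eq_intros simp: numeral_2_eq_2)
    then show "(u has_real_derivative - (real j * pi * trig 0 j x) - q) (at x)" by (simp add: trig_def)
  qed
  have "trig 1 j 1 = sqrt 2 * (- 1) ^ j"
    by (simp add: trig_def sin_add)
  then have "u 0 = 0" "u 1 = 0" by (simp_all add: u_def l_def q_def trig_def algebra_simps)
  then have main: "(LINT x|leb01. deriv u x *\<^sub>R f x) = - (LINT x|leb01. u x *\<^sub>R g x)"
    by (intro weak_deriv_by_parts[OF assms su])
  have i: "integrable leb01 (\<lambda>x. trig 0 j x *\<^sub>R f x)" "integrable leb01 f"
    "integrable leb01 (\<lambda>x. trig 1 j x *\<^sub>R g x)" "integrable leb01 g" "integrable leb01 (\<lambda>x. x *\<^sub>R g x)"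
    using smooth_integrable[OF smooth_linear[of 0 1] assms(3)]
    by (simp_all add: smooth_integrable smooth_trig assms L2_integrable)
  have "(LINT x|leb01. deriv u x *\<^sub>R f x) = - of_real (real j * pi) * (LINT x|leb01. trig 0 j x *\<^sub>R f x) - of_real q * (LINT x|leb01. f x)"
  proof -
    have "deriv u x *\<^sub>R f x = (- (real j * pi)) *\<^sub>R (trig 0 j x *\<^sub>R f x) - q *\<^sub>R f x" for x
      by (simp add: du algebra_simps)
    then have "(LINT x|leb01. deriv u x *\<^sub>R f x) = (LINT x|leb01. (- (real j * pi)) *\<^sub>R (trig 0 j x *\<^sub>R f x) - q *\<^sub>R f x)"
      by (simp only:)
    also have "\<dots> = (LINT x|leb01. (- (real j * pi)) *\<^sub>R (trig 0 j x *\<^sub>R f x)) - (LINT x|leb01. q *\<^sub>R f x)"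
      by (intro Bochner_Integration.integral_diff integrable_scaleR_right i)
    finally show ?thesis by (simp only: integral_scaleR_right) (simp only: scaleR_conv_of_real of_real_minus)
  qed
  moreover have "(LINT x|leb01. u x *\<^sub>R g x) = (LINT x|leb01. trig 1 j x *\<^sub>R g x) - of_real (sqrt 2) * (LINT x|leb01. g x) - of_real q * (LINT x|leb01. x *\<^sub>R g x)"
  proof -
    have "u x *\<^sub>R g x = trig 1 j x *\<^sub>R g x - sqrt 2 *\<^sub>R g x - q *\<^sub>R (x *\<^sub>R g x)" for x
      by (simp add: u_def l_def algebra_simps)
    then have "(LINT x|leb01. u x *\<^sub>R g x) = (LINT x|leb01. trig 1 j x *\<^sub>R g x - sqrt 2 *\<^sub>R g x - q *\<^sub>R (x *\<^sub>R g x))"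
      by (simp only:)
    also have "\<dots> = (LINT x|leb01. trig 1 j x *\<^sub>R g x) - (LINT x|leb01. sqrt 2 *\<^sub>R g x) - (LINT x|leb01. q *\<^sub>R (x *\<^sub>R g x))"
      by (simp only: Bochner_Integration.integral_diff Bochner_Integration.integrable_diff integrable_scaleR_right i)
    finally show ?thesis by (simp only: integral_scaleR_right) (simp only: scaleR_conv_of_real)
  qed
  ultimately show ?thesis using main unfolding q_def[symmetric] by (simp add: algebra_simps)
qed

text \<open>
  Two consecutive coefficients of the same parity share the leading term \<open>E\<close>, so that it is divided by
  \<open>n\<^sup>2\<close> and by \<open>(n + 2)\<^sup>2\<close>, and the difference is of order \<open>n\<^sup>-\<^sup>3\<close>.
\<close>

lemma second_difference_bound:
  fixes n :: nat and E d d' :: complex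
  assumes n: "n \<ge> 1" and D: "cmod d \<le> D / (real n * pi)" "cmod d' \<le> D / (real (n + 2) * pi)"
  shows "(real (n + 1) * pi) ^ 3 * cmod ((E - d) / of_real ((real n * pi)\<^sup>2) - (E - d') / of_real ((real (n + 2) * pi)\<^sup>2))
    \<le> 16 * pi * cmod E + 9 * D"
proof -
  define a b k where "a = real n * pi" and "b = real (n + 2) * pi" and "k = real (n + 1) * pi"
  have pos: "0 < a" "0 < b" "0 < k" using n by (simp_all add: a_def b_def k_def)
  have ab: "a < b" by (simp add: a_def b_def)
  have k2a: "k \<le> 2 * a" using n by (simp add: a_def k_def)
  have kb: "k \<le> b" by (simp add: b_def k_def)
  have kk: "k\<^sup>2 \<le> 2 * (a * b)"
  proof -
    have r: "1 \<le> real n" "1 * 1 \<le> real n * real n" using n by (simp, intro mult_mono) auto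
    have "(real (n + 1))\<^sup>2 = real n * real n + 2 * real n + 1" "2 * (real n * real (n + 2)) = 2 * (real n * real n) + 4 * real n"
      by (simp_all add: power2_eq_square algebra_simps)
    with r have "(real (n + 1))\<^sup>2 \<le> 2 * (real n * real (n + 2))" by linarith
    then have "(real (n + 1))\<^sup>2 * pi\<^sup>2 \<le> 2 * (real n * real (n + 2)) * pi\<^sup>2" by (rule mult_right_mono) simp
    then show ?thesis by (simp only: a_def b_def k_def power_mult_distrib) (simp add: power2_eq_square mult_ac)
  qed
  have D0: "0 \<le> D"
    using order_trans[OF norm_ge_zero D(1)] pos(1) by (simp add: a_def[symmetric] zero_le_divide_iff)
  have 1: "k ^ 3 * (1 / a\<^sup>2 - 1 / b\<^sup>2) \<le> 16 * pi"
  proof -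
    have "1 / a\<^sup>2 - 1 / b\<^sup>2 = (b - a) * (b + a) / (a * b)\<^sup>2"
      using pos by (simp add: field_simps power2_eq_square)
    also have "(b - a) * (b + a) = 4 * pi * k" by (simp add: a_def b_def k_def algebra_simps)
    finally have "k ^ 3 * (1 / a\<^sup>2 - 1 / b\<^sup>2) = 4 * pi * (k\<^sup>2)\<^sup>2 / (a * b)\<^sup>2"
      by (simp add: power2_eq_square power3_eq_cube)
    also have "\<dots> \<le> 4 * pi * (2 * (a * b))\<^sup>2 / (a * b)\<^sup>2"
      by (intro divide_right_mono mult_left_mono power_mono kk) auto
    also have "\<dots> = 16 * pi" using pos by (simp add: power_mult_distrib)
    finally show ?thesis .
  qed
  have inv_nonneg: "0 \<le> 1 / a\<^sup>2 - 1 / b\<^sup>2" using pos ab by (simp add: frac_le power_mono)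
  have 2: "k ^ 3 * (cmod d / a\<^sup>2) \<le> 8 * D"
  proof -
    have "k ^ 3 * (cmod d / a\<^sup>2) \<le> (2 * a) ^ 3 * ((D / a) / a\<^sup>2)"
      using pos D(1) k2a by (intro mult_mono power_mono divide_right_mono) (auto simp: a_def)
    also have "\<dots> = 8 * D" using pos by (simp add: power2_eq_square power3_eq_cube)
    finally show ?thesis .
  qed
  have 3: "k ^ 3 * (cmod d' / b\<^sup>2) \<le> D"
  proof -
    have "k ^ 3 * (cmod d' / b\<^sup>2) \<le> b ^ 3 * ((D / b) / b\<^sup>2)"
      using pos D(2) kb by (intro mult_mono power_mono divide_right_mono) (auto simp: b_def)
    also have "\<dots> = D" using pos by (simp add: power2_eq_square power3_eq_cube)
    finally show ?thesis .
  qed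
  have "(E - d) / of_real (a\<^sup>2) - (E - d') / of_real (b\<^sup>2) = E * of_real (1 / a\<^sup>2 - 1 / b\<^sup>2) - d / of_real (a\<^sup>2) + d' / of_real (b\<^sup>2)"
    by (simp add: diff_divide_distrib algebra_simps)
  then have "cmod ((E - d) / of_real (a\<^sup>2) - (E - d') / of_real (b\<^sup>2)) \<le> cmod (E * of_real (1 / a\<^sup>2 - 1 / b\<^sup>2)) + cmod (d / of_real (a\<^sup>2)) + cmod (d' / of_real (b\<^sup>2))"
    by (metis (no_types) norm_triangle_le norm_triangle_ineq4 add_right_mono order_refl)
  also have "\<dots> = cmod E * (1 / a\<^sup>2 - 1 / b\<^sup>2) + cmod d / a\<^sup>2 + cmod d' / b\<^sup>2"
    using inv_nonneg by (simp only: norm_mult norm_divide norm_of_real abs_of_nonneg zero_le_power2)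
  finally have "k ^ 3 * cmod ((E - d) / of_real (a\<^sup>2) - (E - d') / of_real (b\<^sup>2))
      \<le> k ^ 3 * (cmod E * (1 / a\<^sup>2 - 1 / b\<^sup>2) + cmod d / a\<^sup>2 + cmod d' / b\<^sup>2)"
    using pos by (intro mult_left_mono) auto
  also have "\<dots> = cmod E * (k ^ 3 * (1 / a\<^sup>2 - 1 / b\<^sup>2)) + k ^ 3 * (cmod d / a\<^sup>2) + k ^ 3 * (cmod d' / b\<^sup>2)"
    by (simp only: distrib_left mult_ac)
  also have "\<dots> \<le> cmod E * (16 * pi) + 8 * D + D"
    by (intro add_mono mult_left_mono 1 2 3) auto
  finally show ?thesis by (simp add: a_def b_def k_def mult_ac)
qed

text \<open>
  As \<open>2 sin (\<pi> x) sin (k \<pi> x) = cos ((k - 1) \<pi> x) - cos ((k + 1) \<pi> x)\<close>, the sine coefficients of the control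
  profile are differences of cosine coefficients of \<open>\<mu>\<close>. Three integrations by parts give these the form
  \<open>(E - d) / (j \<pi>)\<^sup>2\<close>, where \<open>E\<close> comes from the boundary values and depends on the parity of \<open>j\<close> only, and
  \<open>d\<close> is of order \<open>1 / j\<close>.
\<close>

lemma control_profile_coeff_bound:
  assumes "(\<lambda>x. complex_of_real (\<mu> x)) \<in> sobolev 3"
  shows "\<exists>C. \<forall>n. (real (Suc n) * pi) ^ 3 * cmod (trig_coeff 0 (control_profile \<mu>) n) \<le> C"
proof -
  define f where "f x = complex_of_real (\<mu> x)" for x
  have f: "f \<in> sobolev (Suc (Suc (Suc 0)))" using assms by (simp add: f_def[abs_def] numeral_3_eq_3)
  obtain f1 where f1: "weak_deriv 1 f f1" "f1 \<in> sobolev (Suc (Suc 0))" using f unfolding sobolev_Suc[of f] by blast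
  obtain f2 where f2: "weak_deriv 1 f1 f2" "f2 \<in> sobolev (Suc 0)" using f1(2) unfolding sobolev_Suc[of f1] by blast
  obtain f3 where f3: "weak_deriv 1 f2 f3" "f3 \<in> sobolev 0" using f2(2) unfolding sobolev_Suc[of f2] by blast
  note w = f1(1) f2(1) f3(1)
  note L = f[THEN sobolev_L2] f1(2)[THEN sobolev_L2] f2(2)[THEN sobolev_L2] f3(2)[THEN sobolev_L2]
  define c where "c j = (LINT x|leb01. trig 1 j x *\<^sub>R f x)" for j
  define d where "d j = (LINT x|leb01. trig 1 j x *\<^sub>R f2 x)" for j
  define E where "E j = of_real (sqrt 2 * ((- 1) ^ j - 1)) * ((LINT x|leb01. f1 x) + (LINT x|leb01. x *\<^sub>R f2 x))
        + of_real (sqrt 2) * (LINT x|leb01. f2 x)" for j :: nat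
  define D where "D = 2 * (LINT x|leb01. cmod (f3 x))"
  have d_bound: "cmod (d j) \<le> D / (real j * pi)" if "j \<ge> 1" for j
  proof -
    have "of_real (real j * pi) * d j = - (LINT x|leb01. trig 0 j x *\<^sub>R f3 x)"
      unfolding d_def by (rule by_parts_sine[OF w(3) L(3,4)])
    then have "(real j * pi) * cmod (d j) = cmod (LINT x|leb01. trig 0 j x *\<^sub>R f3 x)"
      by (metis abs_of_nonneg norm_minus_cancel norm_mult norm_of_real mult_nonneg_nonneg of_nat_0_le_iff pi_ge_zero)
    also have "\<dots> \<le> (LINT x|leb01. norm (trig 0 j x *\<^sub>R f3 x))" by (rule integral_norm_bound)
    also have "\<dots> \<le> (LINT x|leb01. 2 * cmod (f3 x))"
    proof (rule integral_mono)
      show "integrable leb01 (\<lambda>x. norm (trig 0 j x *\<^sub>R f3 x))"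
        by (rule integrable_norm[OF smooth_integrable[OF smooth_trig L(4)]])
      show "integrable leb01 (\<lambda>x. 2 * cmod (f3 x))" using L2_integrable[OF L(4)] by simp
      show "norm (trig 0 j x *\<^sub>R f3 x) \<le> 2 * cmod (f3 x)" for x
        using trig_bound[of 0 j x] by (simp add: mult_right_mono)
    qed
    finally show ?thesis using that by (simp add: D_def pos_le_divide_eq mult.commute)
  qed
  \<comment> \<open>integrate by parts twice, but not a third time: the boundary term \<open>E j\<close> is kept\<close>
  have c_eq: "c j = (E j - d j) / of_real ((real j * pi)\<^sup>2)" if "j \<ge> 1" for j
  proof -
    let ?s = "LINT x|leb01. trig 0 j x *\<^sub>R f1 x"
    have nz: "complex_of_real (real j * pi) \<noteq> 0" using that by simp
    have 1: "of_real (real j * pi) * c j = - ?s" unfolding c_def by (rule by_parts_sine[OF w(1) L(1,2)])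
    have 2: "of_real (real j * pi) * ?s = d j - E j" unfolding d_def E_def by (rule by_parts_cosine[OF w(2) L(2,3)])
    have "of_real ((real j * pi)\<^sup>2) * c j = of_real (real j * pi) * (of_real (real j * pi) * c j)"
      by (simp add: power2_eq_square mult_ac)
    also have "\<dots> = - (of_real (real j * pi) * ?s)" unfolding 1 by (simp only: mult_minus_right)
    also have "\<dots> = E j - d j" unfolding 2 by simp
    finally show ?thesis using nz by (simp add: field_simps)
  qed
  have coeff: "trig_coeff 0 (control_profile \<mu>) n = (c n - c (n + 2)) / of_real (sqrt 2)" for n
  proof -
    have pw: "control_profile \<mu> x * of_real (trig 0 (Suc n) x) = (trig 1 n x *\<^sub>R f x - trig 1 (n + 2) x *\<^sub>R f x) / of_real (sqrt 2)" for x
    proof -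
      have c1: "trig 1 j x = sqrt 2 * cos (real j * pi * x)" for j by (simp add: trig_def sin_add)
      have "trig 0 1 x * trig 0 (Suc n) x = cos (- (real n * pi * x)) - cos (real (n + 2) * pi * x)"
        unfolding trig_prod by (simp add: algebra_simps)
      then have "trig 0 1 x * trig 0 (Suc n) x = (trig 1 n x - trig 1 (n + 2) x) / sqrt 2"
        by (simp only: c1 cos_minus) (simp add: diff_divide_distrib)
      then have "control_profile \<mu> x * of_real (trig 0 (Suc n) x) = f x * of_real ((trig 1 n x - trig 1 (n + 2) x) / sqrt 2)"
        by (simp only: control_profile_def eigfun_trig f_def of_real_mult[symmetric] mult.assoc)
      then show ?thesis by (simp add: scaleR_conv_of_real diff_divide_distrib algebra_simps)
    qed
    have i: "integrable leb01 (\<lambda>x. trig 1 j x *\<^sub>R f x)" for j by (rule smooth_integrable[OF smooth_trig L(1)])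
    show ?thesis
      unfolding trig_coeff_def pw c_def using Bochner_Integration.integral_diff[OF i[of n] i[of "n + 2"]]
      by (simp add: integral_divide_zero)
  qed
  have bound: "(real (Suc n) * pi) ^ 3 * cmod (trig_coeff 0 (control_profile \<mu>) n) \<le> 16 * pi * (cmod (E 0) + cmod (E 1)) + 9 * D"
    if n: "n \<ge> 1" for n
  proof -
    have Eeq: "E (n + 2) = E n" by (simp add: E_def)
    have En: "cmod (E n) \<le> cmod (E 0) + cmod (E 1)"
    proof (cases "even n")
      case True
      then have "E n = E 0" by (simp add: E_def)
      then show ?thesis by simp
    next
      case False
      then have "E n = E 1" by (simp add: E_def)
      then show ?thesis by simp
    qed
    have "cmod (trig_coeff 0 (control_profile \<mu>) n) = cmod (c n - c (n + 2)) / sqrt 2"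
      unfolding coeff norm_divide by simp
    also have "\<dots> \<le> cmod (c n - c (n + 2)) / 1" by (intro divide_left_mono) auto
    also have "cmod (c n - c (n + 2)) = cmod ((E n - d n) / of_real ((real n * pi)\<^sup>2) - (E n - d (n + 2)) / of_real ((real (n + 2) * pi)\<^sup>2))"
      using c_eq[OF n] c_eq[of "n + 2"] Eeq by simp
    finally have "(real (Suc n) * pi) ^ 3 * cmod (trig_coeff 0 (control_profile \<mu>) n) \<le>
      (real (n + 1) * pi) ^ 3 * cmod ((E n - d n) / of_real ((real n * pi)\<^sup>2) - (E n - d (n + 2)) / of_real ((real (n + 2) * pi)\<^sup>2))"
      by (simp del: of_nat_add of_real_mult of_real_power add: mult_left_mono)
    also have "\<dots> \<le> 16 * pi * cmod (E n) + 9 * D"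
      by (rule second_difference_bound[OF n d_bound[OF n] d_bound]) simp
    also have "\<dots> \<le> 16 * pi * (cmod (E 0) + cmod (E 1)) + 9 * D"
      using En by (intro add_right_mono mult_left_mono) auto
    finally show ?thesis .
  qed
  show ?thesis
  proof (intro exI allI)
    fix n
    show "(real (Suc n) * pi) ^ 3 * cmod (trig_coeff 0 (control_profile \<mu>) n) \<le>
      max ((real (Suc 0) * pi) ^ 3 * cmod (trig_coeff 0 (control_profile \<mu>) 0)) (16 * pi * (cmod (E 0) + cmod (E 1)) + 9 * D)"
    proof (cases "n = 0")
      case False
      then show ?thesis using bound[of n] by (intro max.coboundedI2) auto
    qed simp
  qed
qed

section \<open>Functions and sequences\<close>

text \<open>
  The index is shifted: \<open>n\<close> stands for the eigenfunction with number \<open>Suc n\<close>.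
\<close>

definition weighted_coeff :: "nat \<Rightarrow> (real \<Rightarrow> complex) \<Rightarrow> nat \<Rightarrow> complex"
  where "weighted_coeff m f n = of_real ((real (Suc n) * pi) ^ m) * trig_coeff 0 f n"

lemma weight_ge_1: "1 \<le> real (Suc n) * pi"
proof -
  have "1 * 1 \<le> real (Suc n) * pi" using pi_gt3 by (intro mult_mono) auto
  then show ?thesis by simp
qed

lemma weight_nz: "complex_of_real ((real (Suc n) * pi) ^ m) \<noteq> 0"
proof -
  have "real (Suc n) * pi \<noteq> 0" using weight_ge_1[of n] by linarith
  then show ?thesis by (metis of_real_eq_0_iff power_not_zero)
qed

lemma weighted_coeff_mono:
  assumes "k \<le> m" "summable (\<lambda>n. (cmod (weighted_coeff m f n))\<^sup>2)"
  shows "summable (\<lambda>n. (cmod (weighted_coeff k f n))\<^sup>2)"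
proof (rule square_summable_comparison[OF assms(2), of _ 1])
  fix n
  have "\<bar>(real (Suc n) * pi) ^ k\<bar> \<le> \<bar>(real (Suc n) * pi) ^ m\<bar>"
    using power_increasing[OF assms(1) weight_ge_1[of n]] weight_ge_1[of n] by simp
  then have "\<bar>(real (Suc n) * pi) ^ k\<bar> * cmod (trig_coeff 0 f n) \<le> \<bar>(real (Suc n) * pi) ^ m\<bar> * cmod (trig_coeff 0 f n)"
    by (rule mult_right_mono) simp
  then show "cmod (weighted_coeff k f n) \<le> 1 * cmod (weighted_coeff m f n)"
    by (simp only: weighted_coeff_def norm_mult norm_of_real mult_1_left)
qed

lemma eigval_weight: "eigval (Suc n) powr real m * (cmod (inner_L2 f (eigfun (Suc n))))\<^sup>2 = (cmod (weighted_coeff m f n))\<^sup>2"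
proof -
  have "eigval (Suc n) powr real m = ((real (Suc n) * pi) ^ m)\<^sup>2"
    using weight_ge_1[of n]
    by (simp add: eigval_def powr_realpow power_mult[symmetric] mult.commute del: of_nat_Suc)
  then show ?thesis
    by (simp only: inner_L2_eigfun weighted_coeff_def norm_mult norm_of_real power_mult_distrib power2_abs)
qed

lemma bij_Suc: "bij_betw Suc UNIV {1..}"
  by (rule bij_betwI[where g = "\<lambda>n. n - 1"]) auto

lemma Hz_real_iff: "f \<in> Hz (real m) \<longleftrightarrow> f \<in> L2 \<and> summable (\<lambda>n. (cmod (weighted_coeff m f n))\<^sup>2)"
  unfolding Hz_def
  using summable_on_reindex_bij_betw[OF bij_Suc, of "\<lambda>k. eigval k powr real m * (cmod (inner_L2 f (eigfun k)))\<^sup>2"]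
    summable_on_UNIV_nonneg_real_iff[of "\<lambda>n. (cmod (weighted_coeff m f n))\<^sup>2"]
  by (simp add: eigval_weight)

lemma Hz_iff:
  "f \<in> Hz 3 \<longleftrightarrow> f \<in> L2 \<and> summable (\<lambda>n. (cmod (weighted_coeff 3 f n))\<^sup>2)"
  "f \<in> Hz 5 \<longleftrightarrow> f \<in> L2 \<and> summable (\<lambda>n. (cmod (weighted_coeff 5 f n))\<^sup>2)"
  using Hz_real_iff[of f 3] Hz_real_iff[of f 5] by simp_all

text \<open>
  The coordinates in which \<open>Hz 3\<close>, up to null sets, is \<open>ell2\<close>, with equal norms.
\<close>

definition state :: "(real \<Rightarrow> complex) \<Rightarrow> ell2"
  where "state f = mk_ell2 (weighted_coeff 3 f)"

lemma coord_state: "f \<in> Hz 3 \<Longrightarrow> coord (state f) n = weighted_coeff 3 f n"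
  by (simp add: state_def Hz_iff coord_mk_ell2)

lemma norm_Hz_state: "f \<in> Hz 3 \<Longrightarrow> norm_Hz 3 f = norm (state f)"
proof -
  assume f: "f \<in> Hz 3"
  have s: "summable (\<lambda>n. (cmod (weighted_coeff 3 f n))\<^sup>2)" using f by (simp add: Hz_iff)
  have "(\<Sum>\<^sub>\<infinity>k\<in>{1..}. eigval k powr 3 * (cmod (inner_L2 f (eigfun k)))\<^sup>2) = (\<Sum>\<^sub>\<infinity>n\<in>UNIV. (cmod (weighted_coeff 3 f n))\<^sup>2)"
    using infsum_reindex_bij_betw[OF bij_Suc, of "\<lambda>k. eigval k powr 3 * (cmod (inner_L2 f (eigfun k)))\<^sup>2"]
      eigval_weight[of _ 3 f] by simp
  also have "\<dots> = (\<Sum>n. (cmod (weighted_coeff 3 f n))\<^sup>2)"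
  proof -
    have "(\<lambda>n. (cmod (weighted_coeff 3 f n))\<^sup>2) summable_on UNIV"
      using s by (subst summable_on_UNIV_nonneg_real_iff) auto
    from has_sum_imp_sums[OF has_sum_infsum[OF this]] show ?thesis by (rule sums_unique)
  qed
  also have "\<dots> = (norm (state f))\<^sup>2" unfolding norm_ell2_sq coord_state[OF f] ..
  finally show ?thesis by (simp add: norm_Hz_def)
qed

lemma Hz_L2: "f \<in> Hz s \<Longrightarrow> f \<in> L2"
  by (simp add: Hz_def)

lemma weighted_coeff_combination:
  assumes "f \<in> L2" "g \<in> L2"
  shows "weighted_coeff m (\<lambda>x. a * f x + b * g x) n = a * weighted_coeff m f n + b * weighted_coeff m g n"
proof -
  have "(LINT x|leb01. a * (f x * of_real (trig 0 (Suc n) x)) + b * (g x * of_real (trig 0 (Suc n) x))) = a * trig_coeff 0 f n + b * trig_coeff 0 g n"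
    unfolding trig_coeff_def using trig_coeff_integrable[OF assms(1)] trig_coeff_integrable[OF assms(2)] by simp
  then show ?thesis by (simp add: weighted_coeff_def trig_coeff_def algebra_simps)
qed

lemma L2_combination: "f \<in> L2 \<Longrightarrow> g \<in> L2 \<Longrightarrow> (\<lambda>x. a * f x + b * g x) \<in> L2"
  by (intro L2_add L2_cmult)

lemma square_summable_combination:
  fixes x y :: "nat \<Rightarrow> complex"
  assumes "summable (\<lambda>n. (cmod (x n))\<^sup>2)" "summable (\<lambda>n. (cmod (y n))\<^sup>2)"
  shows "summable (\<lambda>n. (cmod (a * x n + b * y n))\<^sup>2)"
  by (rule square_summable_add; rule square_summable_comparison[OF assms(1), of _ "cmod a"] square_summable_comparison[OF assms(2), of _ "cmod b"])
    (simp_all add: norm_mult)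

lemma Hz3_complex_combination:
  assumes "f \<in> Hz 3" "g \<in> Hz 3"
  shows "(\<lambda>x. a * f x + b * g x) \<in> Hz 3"
  using assms by (simp add: Hz_iff L2_combination weighted_coeff_combination square_summable_combination)

lemma Hz3_combination:
  assumes "f \<in> Hz 3" "g \<in> Hz 3"
  shows "(\<lambda>x. a *\<^sub>R f x + b *\<^sub>R g x) \<in> Hz 3"
    and "state (\<lambda>x. a *\<^sub>R f x + b *\<^sub>R g x) = a *\<^sub>R state f + b *\<^sub>R state g"
proof -
  show H: "(\<lambda>x. a *\<^sub>R f x + b *\<^sub>R g x) \<in> Hz 3"
    unfolding scaleR_conv_of_real by (rule Hz3_complex_combination[OF assms])
  have "weighted_coeff 3 (\<lambda>x. a *\<^sub>R f x + b *\<^sub>R g x) n = a *\<^sub>R weighted_coeff 3 f n + b *\<^sub>R weighted_coeff 3 g n" for n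
    unfolding scaleR_conv_of_real by (rule weighted_coeff_combination[OF assms[THEN Hz_L2]])
  then show "state (\<lambda>x. a *\<^sub>R f x + b *\<^sub>R g x) = a *\<^sub>R state f + b *\<^sub>R state g"
    by (intro ell2_eqI) (simp add: coord_state[OF H] coord_state[OF assms(1)] coord_state[OF assms(2)])
qed

lemma state_ae_eq:
  assumes "f \<in> Hz 3" "g \<in> Hz 3"
  shows "ae_eq f g \<longleftrightarrow> state f = state g"
proof
  assume "ae_eq f g"
  then show "state f = state g"
    using trig_coeff_cong[OF _ assms[THEN Hz_L2]] by (simp add: state_def weighted_coeff_def[abs_def])
next
  assume "state f = state g"
  then have "weighted_coeff 3 f n = weighted_coeff 3 g n" for n
    using coord_state[OF assms(1), of n] coord_state[OF assms(2), of n] by simp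
  then have "trig_coeff 0 f n = trig_coeff 0 g n" for n
    unfolding weighted_coeff_def using weight_nz[of n 3] by (metis mult_left_cancel)
  then show "ae_eq f g" by (rule ae_eq_if_same_coeff[OF assms[THEN Hz_L2]])
qed

definition synth :: "ell2 \<Rightarrow> real \<Rightarrow> complex"
  where "synth w = (SOME f. f \<in> Hz 3 \<and> state f = w)"

lemma synth: "synth w \<in> Hz 3" "state (synth w) = w"
proof -
  let ?c = "\<lambda>n. coord w n / of_real ((real (Suc n) * pi) ^ 3)"
  have "summable (\<lambda>n. (cmod (?c n))\<^sup>2)"
  proof (rule square_summable_comparison[OF summable_coord[of w], of _ 1])
    fix n
    have "1 \<le> (real (Suc n) * pi) ^ 3" using weight_ge_1[of n] by (rule one_le_power)
    then have "cmod (coord w n) / (real (Suc n) * pi) ^ 3 \<le> cmod (coord w n) / 1" by (intro divide_left_mono) auto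
    then show "cmod (?c n) \<le> 1 * cmod (coord w n)"
      using weight_ge_1[of n] by (simp only: norm_divide norm_of_real abs_power_minus) (simp add: abs_mult power_abs)
  qed
  then obtain f where f: "f \<in> L2" "\<And>n. trig_coeff 0 f n = ?c n"
    using riesz_fischer_coeff[of ?c 0] by blast
  have wc: "weighted_coeff 3 f n = coord w n" for n
    unfolding weighted_coeff_def f(2) using weight_nz[of n 3] by (metis nonzero_mult_div_cancel_left times_divide_eq_right)
  have H: "f \<in> Hz 3" unfolding Hz_iff wc using f(1) summable_coord by blast
  have "state f = w" by (rule ell2_eqI) (simp add: coord_state[OF H] wc)
  with H have "f \<in> Hz 3 \<and> state f = w" by blast
  then have "synth w \<in> Hz 3 \<and> state (synth w) = w"
    unfolding synth_def by (rule someI[where P = "\<lambda>f. f \<in> Hz 3 \<and> state f = w"])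
  then show "synth w \<in> Hz 3" "state (synth w) = w" by auto
qed

lemma synth_state: "f \<in> Hz 3 \<Longrightarrow> ae_eq (synth (state f)) f"
  by (simp add: state_ae_eq synth)

section \<open>Transfer of semigroups\<close>

lemma Hz3_diff_quotient:
  assumes "f \<in> Hz 3" "g \<in> Hz 3" "k \<in> Hz 3"
  shows "norm_Hz 3 (\<lambda>x. (k x - f x) /\<^sub>R h - g x) = norm ((state k - state f) /\<^sub>R h - state g)"
proof -
  have 1: "(\<lambda>x. 1 *\<^sub>R k x + (- 1) *\<^sub>R f x) \<in> Hz 3" "state (\<lambda>x. 1 *\<^sub>R k x + (- 1) *\<^sub>R f x) = 1 *\<^sub>R state k + (- 1) *\<^sub>R state f"
    using Hz3_combination[OF assms(3,1)] by blast+
  have "(\<lambda>x. (k x - f x) /\<^sub>R h - g x) = (\<lambda>x. inverse h *\<^sub>R (1 *\<^sub>R k x + (- 1) *\<^sub>R f x) + (- 1) *\<^sub>R g x)"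
    by simp
  then show ?thesis
    using Hz3_combination[OF 1(1) assms(2), of "inverse h" "- 1"] 1(2) by (simp add: norm_Hz_state)
qed

lemma Hz3_diff: "f \<in> Hz 3 \<Longrightarrow> g \<in> Hz 3 \<Longrightarrow> norm_Hz 3 (\<lambda>x. f x - g x) = norm (state f - state g)"
  using Hz3_combination[of f g 1 "- 1"] norm_Hz_state[of "\<lambda>x. 1 *\<^sub>R f x + (- 1) *\<^sub>R g x"] by simp

text \<open>
  Through \<open>state\<close> and its inverse \<open>synth\<close>, semigroups on sequences and semigroups on \<open>Hz 3\<close> correspond to
  each other, and so do their generators.
\<close>

lemma C0_semigroup_on_synth:
  assumes "seq_semigroup T"
  shows "C0_semigroup_on (Hz 3) (norm_Hz 3) (\<lambda>t f. synth (T t (state f)))"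
proof -
  have lin: "bounded_linear (T t)" if "t \<ge> 0" for t using assms that by (simp add: seq_semigroup_def)
  have bo: "bounded_operator_on (Hz 3) (norm_Hz 3) (\<lambda>f. synth (T t (state f)))" if "t \<ge> 0" for t
    unfolding bounded_operator_on_def
  proof (intro conjI ballI allI impI)
    interpret bounded_linear "T t" by (rule lin[OF that])
    fix f assume f: "f \<in> Hz 3"
    show "synth (T t (state f)) \<in> Hz 3" by (rule synth)
    fix g assume g: "g \<in> Hz 3"
    show "ae_eq (synth (T t (state f))) (synth (T t (state g)))" if "ae_eq f g"
      using that f g by (simp add: state_ae_eq)
    fix a b :: real
    have "state (\<lambda>x. a *\<^sub>R synth (T t (state f)) x + b *\<^sub>R synth (T t (state g)) x) = T t (state (\<lambda>x. a *\<^sub>R f x + b *\<^sub>R g x))"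
      by (simp add: Hz3_combination(2)[OF synth(1) synth(1)] Hz3_combination(2)[OF f g] synth(2) add scale)
    then show "ae_eq (synth (T t (state (\<lambda>x. a *\<^sub>R f x + b *\<^sub>R g x)))) (\<lambda>x. a *\<^sub>R synth (T t (state f)) x + b *\<^sub>R synth (T t (state g)) x)"
      by (subst state_ae_eq) (simp_all add: synth Hz3_combination(1)[OF synth(1) synth(1)])
  next
    interpret bounded_linear "T t" by (rule lin[OF that])
    obtain M where "\<And>w. norm (T t w) \<le> norm w * M" using bounded by blast
    then show "\<exists>M. \<forall>f\<in>Hz 3. norm_Hz 3 (synth (T t (state f))) \<le> M * norm_Hz 3 f"
      by (intro exI[of _ M]) (simp add: norm_Hz_state synth mult.commute)
  qed
  have c: "((\<lambda>s. norm_Hz 3 (\<lambda>x. synth (T s (state f)) x - synth (T t (state f)) x)) \<longlongrightarrow> 0) (at t within {0..})"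
    if "t \<ge> 0" for t f
  proof -
    have "((\<lambda>s. T s (state f)) \<longlongrightarrow> T t (state f)) (at t within {0..})"
      using assms that by (simp add: seq_semigroup_def)
    then have "((\<lambda>s. norm (T s (state f) - T t (state f))) \<longlongrightarrow> 0) (at t within {0..})"
      by (intro tendsto_norm_zero) (simp add: LIM_zero)
    then show ?thesis by (simp add: Hz3_diff synth)
  qed
  show ?thesis
    unfolding C0_semigroup_on_def
  proof (intro conjI allI impI ballI bo c)
    fix f assume f: "f \<in> Hz 3"
    show "ae_eq (synth (T 0 (state f))) f"
      using assms synth_state[OF f] by (simp add: seq_semigroup_def)
    show "ae_eq (synth (T (s + t) (state f))) (synth (T s (state (synth (T t (state f))))))" if "0 \<le> s" "0 \<le> t" for s t
      using assms that by (simp add: seq_semigroup_def synth)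
  qed
qed

lemma
  assumes S: "C0_semigroup_on (Hz 3) (norm_Hz 3) S"
  defines "T \<equiv> \<lambda>t w. state (S t (synth w))"
  shows seq_semigroup_state: "seq_semigroup T"
    and state_semigroup: "t \<ge> 0 \<Longrightarrow> f \<in> Hz 3 \<Longrightarrow> S t f \<in> Hz 3 \<and> state (S t f) = T t (state f)"
    and generator_state: "generator_on (Hz 3) (norm_Hz 3) S f g \<longleftrightarrow> f \<in> Hz 3 \<and> g \<in> Hz 3 \<and> seq_generator T (state f) (state g)"
proof -
  have bo: "bounded_operator_on (Hz 3) (norm_Hz 3) (S t)" if "t \<ge> 0" for t
    using S that by (simp add: C0_semigroup_on_def)
  have in_Hz: "S t f \<in> Hz 3" if "t \<ge> 0" "f \<in> Hz 3" for t f
    using bo[OF that(1)] that(2) by (simp add: bounded_operator_on_def)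
  have st: "state (S t f) = T t (state f)" if "t \<ge> 0" "f \<in> Hz 3" for t f
  proof -
    have "ae_eq (S t (synth (state f))) (S t f)"
      using bo[OF that(1)] that(2) synth(1) synth_state[OF that(2)] unfolding bounded_operator_on_def by blast
    then show ?thesis unfolding T_def using that by (simp add: state_ae_eq in_Hz synth(1))
  qed
  show "S t f \<in> Hz 3 \<and> state (S t f) = T t (state f)" if "t \<ge> 0" "f \<in> Hz 3" for t f
    using in_Hz st that by blast
  show "seq_semigroup T"
    unfolding seq_semigroup_def
  proof (intro conjI allI impI)
    fix t :: real assume t: "0 \<le> t"
    show "bounded_linear (T t)"
    proof -
      have comb: "T t (a *\<^sub>R v + b *\<^sub>R w) = a *\<^sub>R T t v + b *\<^sub>R T t w" for a b v w
      proof -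
        let ?f = "\<lambda>x. a *\<^sub>R synth v x + b *\<^sub>R synth w x"
        have f: "?f \<in> Hz 3" "state ?f = a *\<^sub>R v + b *\<^sub>R w"
          using Hz3_combination[OF synth(1)[of v] synth(1)[of w]] synth(2) by auto
        have "ae_eq (S t ?f) (\<lambda>x. a *\<^sub>R S t (synth v) x + b *\<^sub>R S t (synth w) x)"
          using bo[OF t] synth(1) unfolding bounded_operator_on_def by blast
        then have "state (S t ?f) = a *\<^sub>R state (S t (synth v)) + b *\<^sub>R state (S t (synth w))"
          using in_Hz[OF t] f(1) synth(1) Hz3_combination[OF in_Hz[OF t synth(1)[of v]] in_Hz[OF t synth(1)[of w]]]
          by (simp add: state_ae_eq)
        then show ?thesis using st[OF t f(1)] f(2) by (simp add: T_def)
      qed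
      obtain M where M: "\<And>f. f \<in> Hz 3 \<Longrightarrow> norm_Hz 3 (S t f) \<le> M * norm_Hz 3 f"
        using bo[OF t] unfolding bounded_operator_on_def by blast
      show ?thesis
      proof (rule bounded_linear_intro)
        show "T t (x + y) = T t x + T t y" for x y using comb[of 1 x 1 y] by simp
        show "T t (r *\<^sub>R x) = r *\<^sub>R T t x" for r x using comb[of r x 0 x] by simp
        show "norm (T t x) \<le> norm x * M" for x
          using M[OF synth(1)[of x]] in_Hz[OF t synth(1)[of x]] by (simp add: T_def norm_Hz_state synth mult.commute)
      qed
    qed
    show "((\<lambda>s. T s w) \<longlongrightarrow> T t w) (at t within {0..})" for w
    proof -
      have "((\<lambda>s. norm_Hz 3 (\<lambda>x. S s (synth w) x - S t (synth w) x)) \<longlongrightarrow> 0) (at t within {0..})"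
        using S t synth(1) by (simp add: C0_semigroup_on_def)
      moreover have "\<forall>\<^sub>F s in at t within {0..}. norm_Hz 3 (\<lambda>x. S s (synth w) x - S t (synth w) x) = dist (T s w) (T t w)"
        unfolding eventually_at_filter
        by (intro always_eventually allI impI) (simp add: Hz3_diff in_Hz t synth(1) T_def dist_norm)
      ultimately have "((\<lambda>s. dist (T s w) (T t w)) \<longlongrightarrow> 0) (at t within {0..})"
        by (rule Lim_transform_eventually)
      then show ?thesis by (rule tendsto_dist_iff[THEN iffD2])
    qed
  next
    fix w
    have "ae_eq (S 0 (synth w)) (synth w)" using S synth(1) by (simp add: C0_semigroup_on_def)
    then show "T 0 w = w" unfolding T_def by (simp add: state_ae_eq in_Hz synth)
  next
    fix s t :: real and w assume "0 \<le> s" "0 \<le> t"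
    then have "ae_eq (S (s + t) (synth w)) (S s (S t (synth w)))" using S synth(1) by (simp add: C0_semigroup_on_def)
    then have "state (S (s + t) (synth w)) = state (S s (S t (synth w)))"
      using \<open>0 \<le> s\<close> \<open>0 \<le> t\<close> by (simp add: state_ae_eq in_Hz synth)
    also have "\<dots> = T s (T t w)" using st[OF \<open>0 \<le> s\<close> in_Hz[OF \<open>0 \<le> t\<close> synth(1)]] by (simp add: T_def)
    finally show "T (s + t) w = T s (T t w)" by (simp add: T_def)
  qed
  show "generator_on (Hz 3) (norm_Hz 3) S f g \<longleftrightarrow> f \<in> Hz 3 \<and> g \<in> Hz 3 \<and> seq_generator T (state f) (state g)" for f g
  proof (cases "f \<in> Hz 3 \<and> g \<in> Hz 3")
    case True
    have "\<forall>\<^sub>F h in at_right 0. norm_Hz 3 (\<lambda>x. (S h f x - f x) /\<^sub>R h - g x) = norm ((T h (state f) - state f) /\<^sub>R h - state g)"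
      unfolding eventually_at_filter
    proof (intro always_eventually allI impI)
      fix h :: real assume "h \<in> {0<..}"
      then show "norm_Hz 3 (\<lambda>x. (S h f x - f x) /\<^sub>R h - g x) = norm ((T h (state f) - state f) /\<^sub>R h - state g)"
        using True by (simp add: Hz3_diff_quotient in_Hz st)
    qed
    then have "((\<lambda>h. norm_Hz 3 (\<lambda>x. (S h f x - f x) /\<^sub>R h - g x)) \<longlongrightarrow> 0) (at_right 0) \<longleftrightarrow>
        ((\<lambda>h. norm ((T h (state f) - state f) /\<^sub>R h - state g)) \<longlongrightarrow> 0) (at_right 0)"
      by (rule tendsto_cong)
    also have "\<dots> \<longleftrightarrow> seq_generator T (state f) (state g)"
      unfolding seq_generator_def tendsto_norm_zero_iff by (rule Lim_null[symmetric])
    finally show ?thesis using True by (simp add: generator_on_def)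
  qed (auto simp: generator_on_def)
qed

section \<open>The closed-loop operator in Fourier coefficients\<close>

lemma trig_coeff_re_im:
  assumes "f \<in> L2"
  shows "trig_coeff j (re_part f) n = of_real (Re (trig_coeff j f n))"
    and "trig_coeff j (im_part f) n = of_real (Im (trig_coeff j f n))"
proof -
  note i = trig_coeff_integrable[OF assms, of j "Suc n"]
  have "trig_coeff j (re_part f) n = (LINT x|leb01. of_real (Re (f x * of_real (trig j (Suc n) x))))"
    by (simp add: trig_coeff_def re_part_def)
  also have "\<dots> = of_real (LINT x|leb01. Re (f x * of_real (trig j (Suc n) x)))"
    by (rule integral_of_real[OF integrable_Re[OF i]])
  finally show "trig_coeff j (re_part f) n = of_real (Re (trig_coeff j f n))"
    unfolding integral_Re[OF i] trig_coeff_def .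
  have "trig_coeff j (im_part f) n = (LINT x|leb01. of_real (Im (f x * of_real (trig j (Suc n) x))))"
    by (simp add: trig_coeff_def im_part_def)
  also have "\<dots> = of_real (LINT x|leb01. Im (f x * of_real (trig j (Suc n) x)))"
    by (rule integral_of_real[OF integrable_Im[OF i]])
  finally show "trig_coeff j (im_part f) n = of_real (Im (trig_coeff j f n))"
    unfolding integral_Im[OF i] trig_coeff_def .
qed

lemma weighted_coeff_re_im:
  assumes "f \<in> L2"
  shows "weighted_coeff m (re_part f) n = of_real (Re (weighted_coeff m f n))"
    and "weighted_coeff m (im_part f) n = of_real (Im (weighted_coeff m f n))"
proof -
  have "of_real r * complex_of_real (Re z) = of_real (Re (of_real r * z))"
    and "of_real r * complex_of_real (Im z) = of_real (Im (of_real r * z))" for r z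
    by simp_all
  then show "weighted_coeff m (re_part f) n = of_real (Re (weighted_coeff m f n))"
    and "weighted_coeff m (im_part f) n = of_real (Im (weighted_coeff m f n))"
    unfolding weighted_coeff_def trig_coeff_re_im[OF assms] by blast+
qed

lemma Hz3_re_part:
  assumes "f \<in> Hz 3"
  shows "re_part f \<in> Hz 3"
proof -
  have f: "f \<in> L2" and s: "summable (\<lambda>n. (cmod (weighted_coeff 3 f n))\<^sup>2)"
    using assms by (simp_all add: Hz_iff)
  have "summable (\<lambda>n. (cmod (weighted_coeff 3 (re_part f) n))\<^sup>2)"
    by (rule square_summable_comparison[OF s, where M = 1]) (simp add: weighted_coeff_re_im[OF f] abs_Re_le_cmod)
  then show ?thesis using L2_re_part[OF f] by (simp add: Hz_iff)
qed

lemma Hz5_imp_Hz3: "f \<in> Hz 5 \<Longrightarrow> f \<in> Hz 3"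
  using weighted_coeff_mono[of 3 5 f] by (simp add: Hz_iff)

lemma freq_weight: "freq n = (real (Suc n) * pi) ^ 2"
  by (simp add: freq_def eigval_def)

text \<open>
  On \<open>Hz 3\<close> the Laplacian multiplies the sine coefficients by \<open>- freq\<close>. Its value need not be in
  \<open>Hz 3\<close>; the compatibility condition in the closed-loop domain is about its sum with the control term.
\<close>

lemma Hz3_laplacian:
  assumes "f \<in> Hz 3"
  shows "laplacian f \<in> L2" "weak_deriv 2 f (laplacian f)"
    "weighted_coeff m (laplacian f) n = - of_real (freq n) * weighted_coeff m f n"
proof -
  have "summable (\<lambda>n. (cmod (weighted_coeff 2 f n))\<^sup>2)"
    using assms by (intro weighted_coeff_mono[of 2 3]) (simp_all add: Hz_iff)
  then have s: "summable (\<lambda>n. (cmod (of_real (freq n) * trig_coeff 0 f n))\<^sup>2)"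
    by (simp only: weighted_coeff_def freq_weight)
  note l = laplacian_coeff[OF Hz_L2[OF assms] s]
  show "laplacian f \<in> L2" "weak_deriv 2 f (laplacian f)" by (rule l)+
  show "weighted_coeff m (laplacian f) n = - of_real (freq n) * weighted_coeff m f n"
    unfolding weighted_coeff_def l(3) by (simp only: mult_minus_left mult_minus_right mult.left_commute)
qed

lemma Hz3_subset_sobolev: "f \<in> Hz 3 \<Longrightarrow> f \<in> sobolev 3"
proof -
  assume f: "f \<in> Hz 3"
  have "\<exists>g\<in>L2. weak_deriv j f g" if "j \<le> 3" for j
  proof -
    have "summable (\<lambda>n. (cmod (weighted_coeff j f n))\<^sup>2)"
      using f that by (intro weighted_coeff_mono[of j 3]) (simp_all add: Hz_iff)
    then show ?thesis
      using sine_series_weak_deriv[OF Hz_L2[OF f], of j] unfolding weighted_coeff_def by blast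
  qed
  then show ?thesis using Hz_L2[OF f] by (simp add: sobolev_def)
qed

lemma control_profile_sobolev:
  assumes "(\<lambda>x. complex_of_real (\<mu> x)) \<in> sobolev 3"
  shows "control_profile \<mu> \<in> sobolev 3"
proof -
  have "(\<lambda>x. trig 0 1 x *\<^sub>R complex_of_real (\<mu> x)) \<in> sobolev 3"
    by (rule sobolev_smooth_mult[OF assms smooth_trig])
  then show ?thesis
    by (simp add: control_profile_def eigfun_trig scaleR_conv_of_real mult.commute)
qed

text \<open>
  The conditions that define the closed-loop domain -- the regularity of the real and the imaginary
  part, and the compatibility condition that links them to the feedback -- say together that the formal
  expression for the closed-loop operator has square-summable weighted coefficients.
\<close>

lemma closed_loop_iff:
  assumes \<mu>: "(\<lambda>x. complex_of_real (\<mu> x)) \<in> sobolev 3"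
    and \<beta>: "\<And>n. weighted_coeff 3 (control_profile \<mu>) n = of_real (\<beta> n)"
  shows "f \<in> closed_loop_dom \<mu> K \<and> g \<in> Hz 3 \<and> ae_eq g (closed_loop_op \<mu> K f) \<longleftrightarrow>
    f \<in> Hz 3 \<and> g \<in> Hz 3 \<and>
    (\<forall>n. coord (state g) n = - \<i> * of_real (freq n) * coord (state f) n + \<i> * of_real (\<beta> n) * of_real (K f))"
    (is "?L \<longleftrightarrow> ?R")
proof -
  have profile_L2: "control_profile \<mu> \<in> L2" by (rule sobolev_L2[OF control_profile_sobolev[OF \<mu>]])
  have op_L2: "closed_loop_op \<mu> K f \<in> L2"
    and op_coeff: "weighted_coeff 3 (closed_loop_op \<mu> K f) n =
      - \<i> * of_real (freq n) * coord (state f) n + \<i> * of_real (\<beta> n) * of_real (K f)" if f: "f \<in> Hz 3" for n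
  proof -
    show "closed_loop_op \<mu> K f \<in> L2"
      unfolding closed_loop_op_def by (intro L2_combination Hz3_laplacian f profile_L2)
    have "weighted_coeff 3 (closed_loop_op \<mu> K f) n =
        \<i> * weighted_coeff 3 (laplacian f) n + \<i> * of_real (K f) * weighted_coeff 3 (control_profile \<mu>) n"
      unfolding closed_loop_op_def by (rule weighted_coeff_combination[OF Hz3_laplacian(1)[OF f] profile_L2])
    then show "weighted_coeff 3 (closed_loop_op \<mu> K f) n =
      - \<i> * of_real (freq n) * coord (state f) n + \<i> * of_real (\<beta> n) * of_real (K f)"
      by (simp add: Hz3_laplacian(3)[OF f] \<beta> coord_state[OF f])
  qed
  show ?thesis
  proof
    assume L: ?L
    then have re: "re_part f \<in> Hz 3" and im: "im_part f \<in> Hz 3"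
      by (auto simp: closed_loop_dom_def Hz5_imp_Hz3)
    have "(\<lambda>x. 1 * re_part f x + \<i> * im_part f x) \<in> Hz 3" by (rule Hz3_complex_combination[OF re im])
    moreover have "(\<lambda>x. 1 * re_part f x + \<i> * im_part f x) = f"
      by (auto simp: fun_eq_iff re_part_def im_part_def complex_eq_iff)
    ultimately have f: "f \<in> Hz 3" by simp
    have g: "g \<in> Hz 3" using L by simp
    have "trig_coeff 0 g n = trig_coeff 0 (closed_loop_op \<mu> K f) n" for n
      using L by (intro trig_coeff_cong Hz_L2[OF g] op_L2[OF f]) simp
    then have "coord (state g) n = weighted_coeff 3 (closed_loop_op \<mu> K f) n" for n
      by (simp add: coord_state[OF g] weighted_coeff_def)
    with f g show ?R by (simp add: op_coeff[OF f])
  next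
    assume R: ?R
    then have f: "f \<in> Hz 3" and g: "g \<in> Hz 3"
      and rel: "\<And>n. coord (state g) n = - \<i> * of_real (freq n) * coord (state f) n + \<i> * of_real (\<beta> n) * of_real (K f)" by auto
    note fL = Hz_L2[OF f]
    have re: "re_part f \<in> Hz 3" by (rule Hz3_re_part[OF f])
    have im: "im_part f \<in> Hz 5"
    proof -
      have "weighted_coeff 5 (im_part f) n = of_real (Re (coord (state g) n))" for n
      proof -
        have "weighted_coeff 5 (im_part f) n = of_real (freq n) * weighted_coeff 3 (im_part f) n"
          by (simp add: weighted_coeff_def freq_weight power_add[symmetric] mult.assoc[symmetric] del: of_nat_Suc)
        also have "\<dots> = of_real (Re (coord (state g) n))"
          unfolding rel weighted_coeff_re_im[OF fL] coord_state[OF f] by (simp add: complex_eq_iff)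
        finally show ?thesis .
      qed
      then have "summable (\<lambda>n. (cmod (weighted_coeff 5 (im_part f) n))\<^sup>2)"
        by (intro square_summable_comparison[OF summable_coord[of "state g"], of _ 1]) (simp add: abs_Re_le_cmod)
      then show ?thesis using L2_im_part[OF fL] by (simp add: Hz_iff)
    qed
    \<comment> \<open>the real part gains two derivatives over \<open>h\<close> and the control profile, which have three\<close>
    define h where "h x = laplacian (re_part f) x + K f *\<^sub>R control_profile \<mu> x" for x
    have h: "h \<in> Hz 3"
    proof -
      have hc: "h = (\<lambda>x. 1 * laplacian (re_part f) x + of_real (K f) * control_profile \<mu> x)"
        by (simp add: h_def fun_eq_iff scaleR_conv_of_real)
      have hL: "h \<in> L2" unfolding hc by (intro L2_combination Hz3_laplacian re profile_L2)
      have "weighted_coeff 3 h n = of_real (Im (coord (state g) n))" for n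
      proof -
        have "weighted_coeff 3 h n = 1 * weighted_coeff 3 (laplacian (re_part f)) n + of_real (K f) * weighted_coeff 3 (control_profile \<mu>) n"
          unfolding hc by (rule weighted_coeff_combination[OF Hz3_laplacian(1)[OF re] profile_L2])
        also have "\<dots> = of_real (Im (coord (state g) n))"
          unfolding rel Hz3_laplacian(3)[OF re] weighted_coeff_re_im[OF fL] coord_state[OF f] \<beta> by (simp add: complex_eq_iff)
        finally show ?thesis .
      qed
      then have "summable (\<lambda>n. (cmod (weighted_coeff 3 h n))\<^sup>2)"
        by (intro square_summable_comparison[OF summable_coord[of "state g"], of _ 1]) (simp add: abs_Im_le_cmod)
      with hL show ?thesis by (simp add: Hz_iff)
    qed
    have "re_part f \<in> sobolev (3 + 2)"
    proof (rule sobolev_add_2[OF _ Hz3_laplacian(2)[OF re]])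
      show "re_part f \<in> sobolev 2" by (rule sobolev_mono[OF Hz3_subset_sobolev[OF re]]) simp
      have "(\<lambda>x. h x + (- K f) *\<^sub>R control_profile \<mu> x) \<in> sobolev 3"
        by (intro sobolev_add Hz3_subset_sobolev h sobolev_scaleR control_profile_sobolev \<mu>)
      then show "laplacian (re_part f) \<in> sobolev 3" by (simp add: h_def)
    qed
    then have "f \<in> closed_loop_dom \<mu> K"
      using re im h by (simp add: closed_loop_dom_def h_def[abs_def])
    moreover have "ae_eq g (closed_loop_op \<mu> K f)"
    proof (rule ae_eq_if_same_coeff[OF Hz_L2[OF g] op_L2[OF f]])
      fix n
      have "weighted_coeff 3 g n = weighted_coeff 3 (closed_loop_op \<mu> K f) n"
        using rel[of n] by (simp only: op_coeff[OF f] coord_state[OF g, symmetric])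
      then show "trig_coeff 0 g n = trig_coeff 0 (closed_loop_op \<mu> K f) n"
        unfolding weighted_coeff_def using weight_nz[of n 3] by (metis mult_left_cancel)
    qed
    ultimately show ?L using g by blast
  qed
qed

text \<open>
  Closed-loop solutions are prescribed only up to null sets; their norms are well defined because
  Lebesgue measure is complete.
\<close>

lemma measurable_if_ae_eq:
  assumes "ae_eq f g" "g \<in> borel_measurable leb01"
  shows "f \<in> borel_measurable leb01"
proof -
  let ?I = "{0<..<1::real}"
  have "(\<lambda>x. if x \<in> ?I then g x else 0) \<in> borel_measurable lebesgue"
    by (rule borel_measurable_if_I[OF assms(2)]) simp
  moreover have "AE x in lebesgue. (if x \<in> ?I then g x else 0) = (if x \<in> ?I then f x else 0)"
    using assms(1) unfolding ae_eq_def
    by (subst (asm) AE_restrict_space_iff) (auto elim: eventually_mono)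
  ultimately have "(\<lambda>x. if x \<in> ?I then f x else 0) \<in> borel_measurable lebesgue"
    by (rule borel_measurable_AE)
  then show ?thesis by (rule borel_measurable_if_D)
qed

lemma norm_Hz_cong:
  assumes "ae_eq f g" "g \<in> L2"
  shows "norm_Hz s f = norm_Hz s g"
proof -
  have "inner_L2 f (eigfun k) = inner_L2 g (eigfun k)" for k
    unfolding inner_L2_def
  proof (rule integral_cong_AE)
    have e: "(\<lambda>x. cnj (eigfun k x)) \<in> borel_measurable leb01"
      unfolding eigfun_trig using measurable_trig by simp
    show "(\<lambda>x. f x * cnj (eigfun k x)) \<in> borel_measurable leb01"
      by (intro borel_measurable_times e measurable_if_ae_eq[OF assms(1)] L2_measurable[OF assms(2)])
    show "(\<lambda>x. g x * cnj (eigfun k x)) \<in> borel_measurable leb01"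
      by (intro borel_measurable_times e L2_measurable[OF assms(2)])
    show "AE x in leb01. f x * cnj (eigfun k x) = g x * cnj (eigfun k x)"
      using assms(1) unfolding ae_eq_def by eventually_elim simp
  qed
  then show ?thesis by (simp add: norm_Hz_def)
qed

lemma control_profile_coeff_real:
  assumes "(\<lambda>x. complex_of_real (\<mu> x)) \<in> sobolev 3"
  shows "weighted_coeff 3 (control_profile \<mu>) n = of_real (Re (weighted_coeff 3 (control_profile \<mu>) n))"
proof -
  have real: "re_part (control_profile \<mu>) = control_profile \<mu>"
    by (simp add: re_part_def control_profile_def eigfun_def fun_eq_iff)
  from weighted_coeff_re_im(1)[OF sobolev_L2[OF control_profile_sobolev[OF assms]], of 3 n]
  show ?thesis unfolding real .
qed

section \<open>Rapid stabilization\<close>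

theorem theorem1p5:
  fixes \<mu> :: "real \<Rightarrow> real"
  assumes "(\<lambda>x. complex_of_real (\<mu> x)) \<in> sobolev 3"
    and "\<exists>c>0. \<forall>k::nat. k \<ge> 1 \<longrightarrow>
      cmod (inner_L2 (\<lambda>x. complex_of_real (\<mu> x) * eigfun 1 x) (eigfun k)) \<ge> c / real k ^ 3"
  shows "\<forall>\<omega>::real. \<omega> > 0 \<longrightarrow>
    (\<exists>C>0. \<exists>K. feedback_law \<mu> K \<and>
      (\<forall>\<Psi>0\<in>Hz 3. \<forall>\<Psi>. closed_loop_solution \<mu> K \<Psi>0 \<Psi> \<longrightarrow>
        (\<forall>t\<ge>0. norm_Hz 3 (\<Psi> t) \<le> C * exp (- \<omega> * t) * norm_Hz 3 \<Psi>0)))"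
proof (intro allI impI)
  fix \<omega> :: real assume \<omega>: "\<omega> > 0"
  define \<beta> where "\<beta> n = Re (weighted_coeff 3 (control_profile \<mu>) n)" for n
  have \<beta>: "weighted_coeff 3 (control_profile \<mu>) n = of_real (\<beta> n)" for n
    unfolding \<beta>_def by (rule control_profile_coeff_real[OF assms(1)])
  have abs_\<beta>: "\<bar>\<beta> n\<bar> = (real (Suc n) * pi) ^ 3 * cmod (trig_coeff 0 (control_profile \<mu>) n)" for n
  proof -
    have "\<bar>\<beta> n\<bar> = cmod (weighted_coeff 3 (control_profile \<mu>) n)" unfolding \<beta> by simp
    then show ?thesis using weight_ge_1[of n] by (simp add: weighted_coeff_def norm_mult norm_power del: of_nat_Suc)
  qed
  obtain c where c: "c > 0" "\<And>k::nat. k \<ge> 1 \<Longrightarrow> c / real k ^ 3 \<le> cmod (inner_L2 (control_profile \<mu>) (eigfun k))"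
    using assms(2) unfolding control_profile_def by blast
  obtain bu where bu: "\<And>n. (real (Suc n) * pi) ^ 3 * cmod (trig_coeff 0 (control_profile \<mu>) n) \<le> bu"
    using control_profile_coeff_bound[OF assms(1)] by blast
  have bl: "c * pi ^ 3 \<le> \<bar>\<beta> n\<bar>" for n
  proof -
    have "c * pi ^ 3 = (real (Suc n) * pi) ^ 3 * (c / real (Suc n) ^ 3)"
      by (simp add: power_mult_distrib del: of_nat_Suc)
    also have "\<dots> \<le> (real (Suc n) * pi) ^ 3 * cmod (trig_coeff 0 (control_profile \<mu>) n)"
      using c(2)[of "Suc n"] weight_ge_1[of n] by (intro mult_left_mono) (auto simp: inner_L2_eigfun)
    finally show ?thesis by (simp only: abs_\<beta>)
  qed
  \<comment> \<open>the rate of the Gramian is the decay rate of the closed loop, so it is \<open>\<omega>\<close> itself\<close>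
  interpret gramian \<omega> \<beta> "c * pi ^ 3" bu
    by unfold_locales (use \<omega> c bl bu in \<open>simp_all add: abs_\<beta>\<close>)
  obtain \<kappa> where \<kappa>: "linear \<kappa>"
    and gen: "\<And>z p. gen_rel z p \<longleftrightarrow>
      (\<forall>n. coord p n = - \<i> * of_real (freq n) * coord z n + \<i> * of_real (\<beta> n) * of_real (\<kappa> z))"
    using exists_feedback by blast
  interpret \<kappa>: linear \<kappa> by (rule \<kappa>)
  define K where "K f = \<kappa> (state f)" for f
  have op: "f \<in> closed_loop_dom \<mu> K \<and> g \<in> Hz 3 \<and> ae_eq g (closed_loop_op \<mu> K f) \<longleftrightarrow>
      f \<in> Hz 3 \<and> g \<in> Hz 3 \<and> gen_rel (state f) (state g)" for f g
    unfolding closed_loop_iff[OF assms(1) \<beta>] gen K_def ..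
  obtain C where C: "C > 0" "\<And>t w. norm (closed_loop t w) \<le> C * exp (- \<omega> * t) * norm w"
    using closed_loop_decay by blast
  have "feedback_law \<mu> K"
    unfolding feedback_law_def
  proof (intro conjI ballI allI impI)
    fix f g assume "f \<in> feedback_dom" "g \<in> feedback_dom"
    then have fg: "f \<in> Hz 3" "g \<in> Hz 3" by (auto simp: feedback_dom_def)
    show "K f = K g" if "ae_eq f g" using that by (simp add: K_def state_ae_eq[OF fg])
    show "K (\<lambda>x. a *\<^sub>R f x + b *\<^sub>R g x) = a * K f + b * K g" for a b
      by (simp add: K_def Hz3_combination(2)[OF fg] \<kappa>.add \<kappa>.scale)
  next
    let ?S = "\<lambda>t f. synth (closed_loop t (state f))"
    have C0: "C0_semigroup_on (Hz 3) (norm_Hz 3) ?S"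
      by (rule C0_semigroup_on_synth[OF seq_semigroup_closed_loop])
    have "generator_on (Hz 3) (norm_Hz 3) ?S f g \<longleftrightarrow> f \<in> Hz 3 \<and> g \<in> Hz 3 \<and> gen_rel (state f) (state g)" for f g
      unfolding generator_state[OF C0] using seq_generator_closed_loop[of "state f" "state g"] by (simp add: synth(2))
    with C0 have "closed_loop_semigroup \<mu> K ?S" by (simp only: closed_loop_semigroup_def op simp_thms)
    then show "\<exists>S. closed_loop_semigroup \<mu> K S" by blast
  qed
  moreover have "norm_Hz 3 (\<Psi> t) \<le> C * exp (- \<omega> * t) * norm_Hz 3 \<Psi>0"
    if \<Psi>0: "\<Psi>0 \<in> Hz 3" and sol: "closed_loop_solution \<mu> K \<Psi>0 \<Psi>" and t: "t \<ge> 0" for \<Psi>0 \<Psi> t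
  proof -
    obtain S where S: "closed_loop_semigroup \<mu> K S" and \<Psi>: "ae_eq (\<Psi> t) (S t \<Psi>0)"
      using sol t by (auto simp: closed_loop_solution_def)
    have C0: "C0_semigroup_on (Hz 3) (norm_Hz 3) S" using S by (simp add: closed_loop_semigroup_def)
    let ?T = "\<lambda>t w. state (S t (synth w))"
    have T_gen: "seq_generator ?T z p \<longleftrightarrow> gen_rel z p" for z p
    proof -
      have "seq_generator ?T z p \<longleftrightarrow> generator_on (Hz 3) (norm_Hz 3) S (synth z) (synth p)"
        unfolding generator_state[OF C0] by (simp add: synth)
      also have "\<dots> \<longleftrightarrow> gen_rel z p"
        using S unfolding closed_loop_semigroup_def op by (simp add: synth)
      finally show ?thesis .
    qed
    have St: "S t \<Psi>0 \<in> Hz 3" "state (S t \<Psi>0) = closed_loop t (state \<Psi>0)"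
      using state_semigroup[OF C0 t \<Psi>0] closed_loop_unique[OF seq_semigroup_state[OF C0] T_gen t] by auto
    have "norm_Hz 3 (\<Psi> t) = norm_Hz 3 (S t \<Psi>0)" by (rule norm_Hz_cong[OF \<Psi> Hz_L2[OF St(1)]])
    also have "\<dots> = norm (closed_loop t (state \<Psi>0))" by (simp add: norm_Hz_state St)
    also have "\<dots> \<le> C * exp (- \<omega> * t) * norm_Hz 3 \<Psi>0" using C(2) by (simp add: norm_Hz_state[OF \<Psi>0])
    finally show ?thesis .
  qed
  ultimately show "\<exists>C>0. \<exists>K. feedback_law \<mu> K \<and>
      (\<forall>\<Psi>0\<in>Hz 3. \<forall>\<Psi>. closed_loop_solution \<mu> K \<Psi>0 \<Psi> \<longrightarrow>
        (\<forall>t\<ge>0. norm_Hz 3 (\<Psi> t) \<le> C * exp (- \<omega> * t) * norm_Hz 3 \<Psi>0))"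
    using C(1) by blast
qed

end
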